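(* Let $\alpha\in(0,2)$ and $\rho_\alpha(s)=(1+s)^\alpha$. Let $H$ be a finitely generated group of polynomial volume growth of degree $d$, and let $K$ be a finitely generated group. 1. If $K\ne\{e_K\}$ is finite, then $$\widetilde\Phi_{K\wr H,\rho_\alpha}(n)\simeq\exp\left(-n^{d/(\alpha+d)}\right).$$ 2. If $K$ is not finite and has polynomial volume growth, then $$\widetilde\Phi_{K\wr H,\rho_\alpha}(n)\simeq\exp\left(-n^{d/(\alpha+d)}(\log n)^{\alpha/(\alpha+d)}\right).$$ 3. If $K$ has exponential volume growth and satisfies $\Phi_K(n)\simeq\exp(-n^{1/3})$, then $$\widetilde\Phi_{K\wr H,\rho_\alpha}(n)\simeq\exp\left(-n^{(d+1)/(\alpha+d+1)}\right).$$
   Context: For a finitely generated group $G$ with a fixed finite symmetric generating set $S^*$ containing the identity $e$, $|\cdot|$ is the word length and $\mathbf u$ the uniform probability measure on $S^*$; $\Phi_G$ is represented by $\Phi_G(n)=\mathbf u^{(n)}(e)$, where $\phi^{(n)}$ denotes the $n$-fold convolution power. Polynomial volume growth of degree $d$ means $|\{g:|g|\le r\}|\simeq r^d$. For a probability measure $\mu$ on $G$, $W(\rho,\mu)=\sup_{s>0}\{s\,\mu(\{g:\rho(|g|)>s\})\}$ and $$\widetilde\Phi_{G,\rho}(n)=\inf\{\phi^{(2n)}(e):\phi\text{ symmetric probability measure on }G,\ W(\rho,\phi)\le2\rho(0)\}.$$ $K\wr H$ is the wreath product with lamp group $K$ and base $H$: the semidirect product $\left(\bigoplus_{h\in H}K\right)\rtimes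 H$ with $H$ acting by left translation of coordinates. For monotone functions near infinity (on integers extended to reals by integer parts), $f\simeq g$ means there are constants $c_i\in(0,\infty)$ with $c_1f(c_2t)\le g(t)\le c_3f(c_4t)$.
   Formalization: Part 2 is stated for d > 0 (H infinite); for d = 0 the printed formula gives 1/n, which fails, e.g. for H trivial, K = Z and α = 3/2, where the true order is n^{-1/α}. *)

theory Defs
  imports "HOL-Probability.Probability" "HOL-Algebra.Product_Groups"
begin

section \<open>Wreath products\<close>

definition semidirect_product ::
    "('n, 'a) monoid_scheme \<Rightarrow> ('h, 'b) monoid_scheme \<Rightarrow> ('h \<Rightarrow> 'n \<Rightarrow> 'n) \<Rightarrow> ('n \<times> 'h) monoid"
  where "semidirect_product N H \<tau> =
    \<lparr>carrier = carrier N \<times> carrier H,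
     monoid.mult = (\<lambda>(f, h) (f', h'). (f \<otimes>\<^bsub>N\<^esub> \<tau> h f', h \<otimes>\<^bsub>H\<^esub> h')),
     one = (\<one>\<^bsub>N\<^esub>, \<one>\<^bsub>H\<^esub>)\<rparr>"

definition left_translate :: "('h, 'b) monoid_scheme \<Rightarrow> 'h \<Rightarrow> ('h \<Rightarrow> 'k) \<Rightarrow> 'h \<Rightarrow> 'k"
  where "left_translate H h f = (\<lambda>x\<in>carrier H. f (inv\<^bsub>H\<^esub> h \<otimes>\<^bsub>H\<^esub> x))"

definition wreath_product ::
    "('k, 'a) monoid_scheme \<Rightarrow> ('h, 'b) monoid_scheme \<Rightarrow> (('h \<Rightarrow> 'k) \<times> 'h) monoid"  (infixr \<open>\<wr>\<close> 75)
  where "K \<wr> H = semidirect_product (sum_group (carrier H) (\<lambda>_. K)) H (left_translate H)"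

lemma left_translate_closed:
  assumes "group H" "group K" "h \<in> carrier H" "f \<in> carrier (sum_group (carrier H) (\<lambda>_. K))"
  shows "left_translate H h f \<in> carrier (sum_group (carrier H) (\<lambda>_. K))"
proof -
  interpret H: group H by fact
  have f: "f \<in> carrier H \<rightarrow>\<^sub>E carrier K" "finite {x \<in> carrier H. f x \<noteq> \<one>\<^bsub>K\<^esub>}"
    using assms by (auto simp: carrier_sum_group)
  have "{x \<in> carrier H. f (inv\<^bsub>H\<^esub> h \<otimes>\<^bsub>H\<^esub> x) \<noteq> \<one>\<^bsub>K\<^esub>}
      \<subseteq> (\<lambda>y. h \<otimes>\<^bsub>H\<^esub> y) ` {x \<in> carrier H. f x \<noteq> \<one>\<^bsub>K\<^esub>}"
  proof
    fix x assume x: "x \<in> {x \<in> carrier H. f (inv\<^bsub>H\<^esub> h \<otimes>\<^bsub>H\<^esub> x) \<noteq> \<one>\<^bsub>K\<^esub>}"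
    then have "x = h \<otimes>\<^bsub>H\<^esub> (inv\<^bsub>H\<^esub> h \<otimes>\<^bsub>H\<^esub> x)"
      using assms(3) by (simp add: H.m_assoc[symmetric])
    with x assms(3) show "x \<in> (\<lambda>y. h \<otimes>\<^bsub>H\<^esub> y) ` {x \<in> carrier H. f x \<noteq> \<one>\<^bsub>K\<^esub>}"
      by blast
  qed
  then have "finite {x \<in> carrier H. f (inv\<^bsub>H\<^esub> h \<otimes>\<^bsub>H\<^esub> x) \<noteq> \<one>\<^bsub>K\<^esub>}"
    using f(2) finite_surj by blast
  then show ?thesis
    using f(1) assms by (auto simp: carrier_sum_group left_translate_def PiE_iff cong: conj_cong)
qed

lemma group_wreath_product:
  assumes "group K" "group H"
  shows "group (K \<wr> H)"
proof -
  interpret H: group H by fact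
  interpret K: group K by fact
  let ?N = "sum_group (carrier H) (\<lambda>_. K)"
  interpret N: group ?N by (simp add: assms)
  note cl = left_translate_closed[OF assms(2,1)]
  have app: "f x \<in> carrier K" if "f \<in> carrier ?N" "x \<in> carrier H" for f x
    using that assms by (auto simp: carrier_sum_group PiE_iff)
  have ext: "f \<in> extensional (carrier H)" if "f \<in> carrier ?N" for f
    using that assms by (auto simp: carrier_sum_group PiE_iff)
  have hom: "left_translate H h (f \<otimes>\<^bsub>?N\<^esub> g) = left_translate H h f \<otimes>\<^bsub>?N\<^esub> left_translate H h g"
    if "h \<in> carrier H" for h f g
    using that by (auto simp: left_translate_def)
  have act: "left_translate H h (left_translate H h' f) = left_translate H (h \<otimes>\<^bsub>H\<^esub> h') f"
    if "h \<in> carrier H" "h' \<in> carrier H" for h h' f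
    using that by (auto simp: left_translate_def H.inv_mult_group H.m_assoc)
  have one: "left_translate H \<one>\<^bsub>H\<^esub> f = f" if "f \<in> carrier ?N" for f
    using ext[OF that] by (auto simp: left_translate_def extensional_def)
  have lone: "left_translate H h \<one>\<^bsub>?N\<^esub> = \<one>\<^bsub>?N\<^esub>" if "h \<in> carrier H" for h
    using that by (auto simp: left_translate_def)
  note defs = wreath_product_def semidirect_product_def
  show ?thesis
  proof (rule groupI)
    fix x y assume "x \<in> carrier (K \<wr> H)" "y \<in> carrier (K \<wr> H)"
    then show "x \<otimes>\<^bsub>K \<wr> H\<^esub> y \<in> carrier (K \<wr> H)"
      using cl N.m_closed by (auto simp: defs simp del: mult_sum_group)
  next
    show "\<one>\<^bsub>K \<wr> H\<^esub> \<in> carrier (K \<wr> H)"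
      using N.one_closed by (auto simp: defs simp del: one_sum_group)
  next
    fix x y z assume "x \<in> carrier (K \<wr> H)" "y \<in> carrier (K \<wr> H)" "z \<in> carrier (K \<wr> H)"
    then show "x \<otimes>\<^bsub>K \<wr> H\<^esub> y \<otimes>\<^bsub>K \<wr> H\<^esub> z = x \<otimes>\<^bsub>K \<wr> H\<^esub> (y \<otimes>\<^bsub>K \<wr> H\<^esub> z)"
      by (auto simp: defs cl N.m_assoc H.m_assoc hom act simp del: mult_sum_group)
  next
    fix x assume "x \<in> carrier (K \<wr> H)"
    then show "\<one>\<^bsub>K \<wr> H\<^esub> \<otimes>\<^bsub>K \<wr> H\<^esub> x = x"
      using one N.l_one by (auto simp: defs simp del: mult_sum_group one_sum_group)
  next
    fix x assume x: "x \<in> carrier (K \<wr> H)"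
    obtain f h where fh: "x = (f, h)" "f \<in> carrier ?N" "h \<in> carrier H"
      using x by (auto simp: defs)
    let ?y = "(left_translate H (inv\<^bsub>H\<^esub> h) (inv\<^bsub>?N\<^esub> f), inv\<^bsub>H\<^esub> h)"
    have "?y \<otimes>\<^bsub>K \<wr> H\<^esub> x = \<one>\<^bsub>K \<wr> H\<^esub>"
      using fh by (simp add: defs hom[symmetric] N.l_inv lone del: mult_sum_group one_sum_group inv_sum_group)
    moreover have "?y \<in> carrier (K \<wr> H)"
      using fh cl N.inv_closed by (auto simp: defs)
    ultimately show "\<exists>y\<in>carrier (K \<wr> H). y \<otimes>\<^bsub>K \<wr> H\<^esub> x = \<one>\<^bsub>K \<wr> H\<^esub>"
      by blast
  qed
qed


section \<open>Word length and volume growth\<close>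

definition symmetric_generating_set :: "('g, 'a) monoid_scheme \<Rightarrow> 'g set \<Rightarrow> bool"
  where "symmetric_generating_set G S \<longleftrightarrow>
    finite S \<and> S \<subseteq> carrier G \<and> \<one>\<^bsub>G\<^esub> \<in> S \<and> (\<forall>s\<in>S. inv\<^bsub>G\<^esub> s \<in> S) \<and> generate G S = carrier G"

definition word_length :: "('g, 'a) monoid_scheme \<Rightarrow> 'g set \<Rightarrow> 'g \<Rightarrow> nat"
  where "word_length G S g =
    (LEAST n. \<exists>ws. set ws \<subseteq> S \<and> length ws = n \<and> foldr (\<otimes>\<^bsub>G\<^esub>) ws \<one>\<^bsub>G\<^esub> = g)"

definition volume :: "('g, 'a) monoid_scheme \<Rightarrow> 'g set \<Rightarrow> nat \<Rightarrow> real"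
  where "volume G S r = real (card {g \<in> carrier G. word_length G S g \<le> r})"

definition by_integer_part :: "(nat \<Rightarrow> real) \<Rightarrow> real \<Rightarrow> real"
  where "by_integer_part f t = f (nat \<lfloor>t\<rfloor>)"

definition growth_equiv :: "(real \<Rightarrow> real) \<Rightarrow> (real \<Rightarrow> real) \<Rightarrow> bool"  (infix \<open>\<simeq>\<close> 50)
  where "f \<simeq> g \<longleftrightarrow>
    (\<exists>c1>0. \<exists>c2>0. \<exists>c3>0. \<exists>c4>0.
      \<forall>\<^sub>F t in at_top. c1 * f (c2 * t) \<le> g t \<and> g t \<le> c3 * f (c4 * t))"

definition polynomial_growth :: "('g, 'a) monoid_scheme \<Rightarrow> 'g set \<Rightarrow> nat \<Rightarrow> bool"
  where "polynomial_growth G S d \<longleftrightarrow> by_integer_part (volume G S) \<simeq> (\<lambda>r. r ^ d)"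

definition exponential_growth :: "('g, 'a) monoid_scheme \<Rightarrow> 'g set \<Rightarrow> bool"
  where "exponential_growth G S \<longleftrightarrow> by_integer_part (volume G S) \<simeq> exp"


section \<open>Return probabilities\<close>

text \<open>A finitely generated group is countable, so its probability measures are exactly
  the probability mass functions supported on the carrier.\<close>

definition convolution :: "('g, 'a) monoid_scheme \<Rightarrow> 'g pmf \<Rightarrow> 'g pmf \<Rightarrow> 'g pmf"
  where "convolution G \<mu> \<nu> = map_pmf (\<lambda>(x, y). x \<otimes>\<^bsub>G\<^esub> y) (pair_pmf \<mu> \<nu>)"

definition conv_power :: "('g, 'a) monoid_scheme \<Rightarrow> 'g pmf \<Rightarrow> nat \<Rightarrow> 'g pmf"
  where "conv_power G \<mu> n = (convolution G \<mu> ^^ n) (return_pmf \<one>\<^bsub>G\<^esub>)"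

definition Phi :: "('g, 'a) monoid_scheme \<Rightarrow> 'g set \<Rightarrow> nat \<Rightarrow> real"
  where "Phi G S n = pmf (conv_power G (pmf_of_set S) n) \<one>\<^bsub>G\<^esub>"

definition symmetric_probability :: "('g, 'a) monoid_scheme \<Rightarrow> 'g pmf \<Rightarrow> bool"
  where "symmetric_probability G \<phi> \<longleftrightarrow>
    set_pmf \<phi> \<subseteq> carrier G \<and> (\<forall>g\<in>carrier G. pmf \<phi> (inv\<^bsub>G\<^esub> g) = pmf \<phi> g)"

text \<open>The supremum may be infinite, hence the extended real value.\<close>

definition weak_moment :: "('g, 'a) monoid_scheme \<Rightarrow> 'g set \<Rightarrow> (real \<Rightarrow> real) \<Rightarrow> 'g pmf \<Rightarrow> ereal"
  where "weak_moment G S \<rho> \<mu> =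
    (SUP s\<in>{0<..}. ereal (s * measure_pmf.prob \<mu> {g \<in> carrier G. \<rho> (real (word_length G S g)) > s}))"

definition Phi_tilde :: "('g, 'a) monoid_scheme \<Rightarrow> 'g set \<Rightarrow> (real \<Rightarrow> real) \<Rightarrow> nat \<Rightarrow> real"
  where "Phi_tilde G S \<rho> n =
    (INF \<phi>\<in>{\<phi>. symmetric_probability G \<phi> \<and> weak_moment G S \<rho> \<phi> \<le> ereal (2 * \<rho> 0)}.
      pmf (conv_power G \<phi> (2 * n)) \<one>\<^bsub>G\<^esub>)"

definition power_moment :: "real \<Rightarrow> real \<Rightarrow> real"  (\<open>\<rho>\<^bsub>_\<^esub>\<close>)
  where "\<rho>\<^bsub>\<alpha>\<^esub> = (\<lambda>s. (1 + s) powr \<alpha>)"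

end

theory Submission
  imports Defs "HOL-Real_Asymp.Real_Asymp"
begin

text \<open>
  Both bounds hold for every number of steps and every large radius, and only the last step optimises the
  radius. Write \<open>V\<^sub>H\<close> and \<open>V\<^sub>K\<close> for the volume functions, and let \<open>w r\<close> be the logarithmic size of a
  good finite set of lamp states at scale \<open>r\<close>: a constant if \<open>K\<close> is finite, \<open>ln (1 + r)\<close> if \<open>K\<close> is infinite of
  polynomial growth, and \<open>r\<close> in the exponential case. Up to constants in the exponents,
  the infimum over the admissible measures at time \<open>n\<close> lies between \<open>exp (- (r ^ d * w r + n * r powr - \<alpha>))\<close> and the sum of
  \<open>exp (- (r ^ d * w r))\<close> and \<open>exp (- (n * r powr - \<alpha>))\<close>. Choosing \<open>r\<close> so that the two terms balance
  gives the three rates.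

  Lower bound. Every admissible measure has to be bounded at once. A nonnegative function \<open>f\<close> of norm one
  supported on a finite set \<open>\<Omega>\<close> gives a return probability of at least the Rayleigh quotient to the power
  \<open>2 * n\<close>, divided by the size of \<open>\<Omega>\<close> (\<open>return_probability_ge_rayleigh\<close>). If right translation by a
  generator moves \<open>f\<close> by at most \<open>A / R\<close> in norm, then translation by \<open>y\<close> moves it by at most a multiple of
  \<open>min |y| R / R\<close>, and the weak moment condition bounds the mean square of this by a multiple of
  \<open>R powr - \<alpha>\<close>; here \<open>\<alpha> < 2\<close> is essential (\<open>Phi_tilde_ge_test_function\<close>). So only the simple generators matter,
  and a suitable \<open>f\<close> on the wreath product is a product of a tent function of the position in \<open>H\<close> and of one
  function on \<open>K\<close> for each lamp in the ball of radius \<open>R\<close> (\<open>wreath_test_function\<close>). On \<open>K\<close> one takes a constant,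
  a tent function, or, in the exponential case, a truncated convolution power of the uniform measure at a time of
  order \<open>R ^ 3\<close> at which its return probability decays slowly (\<open>test_profile_return_probability\<close>).

  Upper bound. The infimum allows the measure to depend on \<open>n\<close>. Take a lazy walk that jumps with probability
  \<open>p\<close> of order \<open>r powr - \<alpha>\<close>, which is what the weak moment condition permits for jumps of length of order \<open>r\<close>;
  a jump randomises the current lamp over the ball of radius \<open>r\<close> in \<open>K\<close>, moves to a uniform point of the
  surrounding ball of radius \<open>r\<close> in \<open>H\<close>, and randomises the lamp there. As long as less than a
  quarter of the volume of that ball has been visited, most jumps reach a fresh lamp, and each fresh lamp divides the
  largest atom of the lamp configuration by \<open>V\<^sub>K r\<close>. Hence the return probability is at most the sum of
  \<open>V\<^sub>K r powr - (V\<^sub>H r / 4)\<close> and \<open>(1 - 3 / 8 * p) ^ (2 * n)\<close> (\<open>spread_return_bound\<close>). Counting fresh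
  lamps is this simple because a single jump is already uniform at the scale that matters.
\<close>

section \<open>Word length and volume growth\<close>

text \<open>
  The scaling factors in the relation are positive reals, so the arguments \<open>n / c2\<close> and \<open>n / c4\<close> hit every
  natural number exactly and the integer part disappears.
\<close>

lemma growth_equiv_at_nat:
  assumes "by_integer_part f \<simeq> g"
  shows "\<exists>a>0. \<exists>b>0. \<exists>a'>0. \<exists>b'>0. \<exists>N. \<forall>n\<ge>N.
    f n \<le> b * g (a * real n) \<and> b' * g (a' * real n) \<le> f n"
proof -
  obtain c1 c2 c3 c4 where c: "c1 > 0" "c2 > 0" "c3 > 0" "c4 > 0"
    and ev: "\<forall>\<^sub>F t in at_top. c1 * by_integer_part f (c2 * t) \<le> g t \<and> g t \<le> c3 * by_integer_part f (c4 * t)"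
    using assms unfolding growth_equiv_def by blast
  obtain T where T: "\<And>t. t \<ge> T \<Longrightarrow> c1 * by_integer_part f (c2 * t) \<le> g t \<and> g t \<le> c3 * by_integer_part f (c4 * t)"
    using ev unfolding eventually_at_top_linorder by blast
  \<comment> \<open>beyond this bound both rescaled arguments exceed the threshold\<close>
  define N where "N = nat \<lceil>max (c2 * T) (c4 * T)\<rceil>"
  show ?thesis
  proof (rule exI[of _ "1/c2"], intro conjI, goal_cases)
    case 2 show ?case
    proof (rule exI[of _ "1/c1"], intro conjI, goal_cases)
      case 2 show ?case
      proof (rule exI[of _ "1/c4"], intro conjI, goal_cases)
        case 2 show ?case
        proof (rule exI[of _ "1/c3"], intro conjI exI[of _ N] allI impI, goal_cases)
          case (2 n)
          then have "real n / c2 \<ge> T" using c unfolding N_def by (simp add: field_simps)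
          from T[OF this] have "c1 * f n \<le> g (real n / c2)" using c by (simp add: by_integer_part_def)
          then show ?case using c by (simp add: field_simps)
        next
          case (3 n)
          then have "real n / c4 \<ge> T" using c unfolding N_def by (simp add: field_simps)
          from T[OF this] have "g (real n / c4) \<le> c3 * f n" using c by (simp add: by_integer_part_def)
          then show ?case using c by (simp add: field_simps)
        qed (use c in auto)
      qed (use c in auto)
    qed (use c in auto)
  qed (use c in auto)
qed

locale fg_group = group G for G :: "('g, 'a) monoid_scheme" (structure) +
  fixes S :: "'g set"
  assumes gen: "symmetric_generating_set G S"
begin

abbreviation wl :: "'g \<Rightarrow> nat" where "wl \<equiv> word_length G S"

abbreviation word :: "'g list \<Rightarrow> 'g" where "word ws \<equiv> foldr (\<otimes>) ws \<one>"

definition wball :: "nat \<Rightarrow> 'g set" where "wball r = {g \<in> carrier G. wl g \<le> r}"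

lemma finite_S: "finite S" and S_sub: "S \<subseteq> carrier G" and one_in_S: "\<one> \<in> S"
  and inv_in_S: "s \<in> S \<Longrightarrow> inv s \<in> S" and generate_S: "generate G S = carrier G"
  using gen unfolding symmetric_generating_set_def by auto

lemma word_closed: "set ws \<subseteq> carrier G \<Longrightarrow> word ws \<in> carrier G"
  by (induction ws) auto

lemma word_append:
  "set us \<subseteq> carrier G \<Longrightarrow> set vs \<subseteq> carrier G \<Longrightarrow> word (us @ vs) = word us \<otimes> word vs"
  by (induction us) (auto simp: word_closed m_assoc)

lemma ex_word: assumes "g \<in> carrier G" shows "\<exists>ws. set ws \<subseteq> S \<and> word ws = g"
proof -
  have "g \<in> generate G S" using assms generate_S by simp
  then show ?thesis
  proof (induction g rule: generate.induct)
    case one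
    show ?case by (rule exI[of _ "[]"]) simp
  next
    case (incl h)
    then show ?case using S_sub by (intro exI[of _ "[h]"]) auto
  next
    case (inv h)
    then show ?case using S_sub inv_in_S by (intro exI[of _ "[inv h]"]) auto
  next
    case (eng h1 h2)
    then obtain us vs where "set us \<subseteq> S" "word us = h1" "set vs \<subseteq> S" "word vs = h2" by blast
    moreover from this have "word (us @ vs) = word us \<otimes> word vs"
      using S_sub by (intro word_append) auto
    ultimately have "set (us @ vs) \<subseteq> S" "word (us @ vs) = h1 \<otimes> h2" by (simp_all del: foldr_append)
    then show ?case by blast
  qed
qed

lemma geodesic_word:
  assumes "g \<in> carrier G" shows "\<exists>ws. set ws \<subseteq> S \<and> length ws = wl g \<and> word ws = g"
  unfolding word_length_def by (rule LeastI_ex) (use ex_word[OF assms] in blast)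

lemma wl_le: "set ws \<subseteq> S \<Longrightarrow> word ws = g \<Longrightarrow> wl g \<le> length ws"
  unfolding word_length_def by (rule Least_le) blast

lemma wl_mult: assumes "g \<in> carrier G" "h \<in> carrier G" shows "wl (g \<otimes> h) \<le> wl g + wl h"
proof -
  obtain us vs where *: "set us \<subseteq> S" "length us = wl g" "word us = g"
    "set vs \<subseteq> S" "length vs = wl h" "word vs = h"
    using geodesic_word assms by metis
  then have "word (us @ vs) = g \<otimes> h" using word_append S_sub by (metis subset_trans)
  then show ?thesis using wl_le[of "us @ vs" "g \<otimes> h"] * by auto
qed

lemma wl_one [simp]: "wl \<one> = 0"
  using wl_le[of "[]" "\<one>"] by simp

lemma wl_S: "s \<in> S \<Longrightarrow> wl s \<le> 1"
  using wl_le[of "[s]" s] S_sub by auto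

text \<open>
  Any subadditive cost on the group grows at most linearly in the word length. The cost is given as a relation
  so that the same principle bounds translation norms and word lengths in another group.
\<close>

lemma wl_induct_bound:
  assumes one: "P \<one> 0"
    and mult: "\<And>g h r t. g \<in> carrier G \<Longrightarrow> h \<in> carrier G \<Longrightarrow> P g r \<Longrightarrow> P h t \<Longrightarrow> P (g \<otimes> h) (r + t)"
    and gen: "\<And>s. s \<in> S \<Longrightarrow> P s (a :: real)" and g: "g \<in> carrier G"
  shows "P g (real (wl g) * a)"
proof -
  have "P (word ws) (real (length ws) * a)" if "set ws \<subseteq> S" for ws
    using that
  proof (induction ws)
    case Nil
    then show ?case by (simp add: one)
  next
    case (Cons s ws)
    then have "P (s \<otimes> word ws) (a + real (length ws) * a)"
      using S_sub by (intro mult gen word_closed) auto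
    then show ?case by (simp add: algebra_simps)
  qed
  then show ?thesis using geodesic_word[OF g] by metis
qed

lemma wl_inv: assumes "g \<in> carrier G" shows "wl (inv g) = wl g"
proof -
  have *: "wl (inv g) \<le> wl g" if "g \<in> carrier G" for g
  proof -
    have inv_word: "inv (word ws) = word (rev (map (m_inv G) ws))" if "set ws \<subseteq> S" for ws
      using that
    proof (induction ws)
      case (Cons a ws)
      have "word (rev (map (m_inv G) ws) @ [inv a]) = word (rev (map (m_inv G) ws)) \<otimes> word [inv a]"
        using Cons S_sub by (intro word_append) auto
      moreover have "inv (word (a # ws)) = inv (word ws) \<otimes> inv a"
        using Cons.prems S_sub word_closed[of ws] subset_trans[of "set ws" S "carrier G"]
        by (auto simp: inv_mult_group subset_iff)
      moreover have "a \<in> carrier G" using Cons.prems S_sub by auto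
      ultimately show ?case using Cons by (simp del: foldr_append)
    qed auto
    obtain ws where ws: "set ws \<subseteq> S" "length ws = wl g" "word ws = g" using geodesic_word \<open>g \<in> carrier G\<close> by blast
    then show ?thesis using inv_word[OF ws(1)] inv_in_S
      by (metis (no_types, lifting) image_subset_iff length_map length_rev set_map set_rev subset_iff wl_le)
  qed
  show ?thesis using *[OF assms] *[of "inv g"] assms by simp
qed

lemma wball_carrier: "wball r \<subseteq> carrier G" by (auto simp: wball_def)

lemma one_in_wball [simp]: "\<one> \<in> wball r" by (simp add: wball_def)

lemma wball_mono: "r \<le> r' \<Longrightarrow> wball r \<subseteq> wball r'" by (auto simp: wball_def)

lemma inv_wball: "g \<in> wball r \<Longrightarrow> inv g \<in> wball r" by (auto simp: wball_def wl_inv)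

lemma finite_wball [simp]: "finite (wball r)"
proof (rule finite_subset)
  show "wball r \<subseteq> word ` {ws. set ws \<subseteq> S \<and> length ws \<le> r}"
  proof
    fix g assume "g \<in> wball r"
    then have "g \<in> carrier G" "wl g \<le> r" by (auto simp: wball_def)
    moreover obtain ws where "set ws \<subseteq> S" "length ws = wl g" "word ws = g"
      using geodesic_word \<open>g \<in> carrier G\<close> by blast
    ultimately show "g \<in> word ` {ws. set ws \<subseteq> S \<and> length ws \<le> r}" by force
  qed
qed (use finite_S finite_lists_length_le in blast)

lemma card_wball_pos: "card (wball r) > 0"
  unfolding card_gt_0_iff using one_in_wball[of r] finite_wball[of r] by blast

lemma volume_eq: "volume G S r = real (card (wball r))"
  by (simp add: volume_def wball_def)

lemma volume_mono: "r \<le> r' \<Longrightarrow> volume G S r \<le> volume G S r'"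
  unfolding volume_eq using wball_mono by (simp add: card_mono)

lemma volume_ge_1: "volume G S r \<ge> 1"
  unfolding volume_eq using card_wball_pos[of r] by linarith

lemma card_wball_ge_2:
  assumes "carrier G \<noteq> {\<one>}" "r \<ge> 1" shows "card (wball r) \<ge> 2"
proof -
  have "\<exists>s\<in>S. s \<noteq> \<one>"
  proof (rule ccontr)
    assume "\<not> ?thesis"
    then have "S = {\<one>}" using one_in_S by blast
    then show False using generate_S generate_one assms(1) by simp
  qed
  then obtain s where "s \<in> S" "s \<noteq> \<one>" by blast
  then have "s \<in> wball r" using wl_S[of s] S_sub assms(2) by (auto simp: wball_def)
  then have "{\<one>, s} \<subseteq> wball r" by simp
  from card_mono[OF finite_wball this] show ?thesis using \<open>s \<noteq> \<one>\<close> by simp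
qed

text \<open>
  Prefixes of a geodesic word are geodesic, so every length below a realised one is realised.
\<close>

lemma ex_wl_eq:
  assumes "g \<in> carrier G" "j \<le> wl g" shows "\<exists>h\<in>carrier G. wl h = j"
proof -
  obtain ws where ws: "set ws \<subseteq> S" "length ws = wl g" "word ws = g" using geodesic_word assms by blast
  let ?u = "take j ws" and ?v = "drop j ws"
  have sub: "set ?u \<subseteq> S" "set ?v \<subseteq> S" using ws(1) set_take_subset set_drop_subset by fast+
  have c: "word ?u \<in> carrier G" "word ?v \<in> carrier G" using sub S_sub by (auto intro!: word_closed)
  have "g = word ?u \<otimes> word ?v" using word_append[of ?u ?v] sub S_sub ws(3) by auto
  then have "wl g \<le> wl (word ?u) + wl (word ?v)" using wl_mult c by metis
  moreover have "wl (word ?u) \<le> j" "wl (word ?v) \<le> wl g - j"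
    using wl_le[OF sub(1) refl] wl_le[OF sub(2) refl] ws(2) assms by auto
  ultimately have "wl (word ?u) = j" using assms by linarith
  then show ?thesis using c by blast
qed

lemma card_wball_infinite:
  assumes "infinite (carrier G)" shows "card (wball r) \<ge> r + 1"
proof -
  have "\<exists>g\<in>carrier G. wl g \<ge> r"
  proof (rule ccontr)
    assume "\<not> ?thesis"
    then have "carrier G \<subseteq> wball r" by (auto simp: wball_def not_le le_less)
    then show False using assms finite_subset finite_wball by blast
  qed
  then obtain g where g: "g \<in> carrier G" "wl g \<ge> r" by blast
  have "{..r} \<subseteq> wl ` wball r"
  proof
    fix j assume "j \<in> {..r}"
    then obtain h where "h \<in> carrier G" "wl h = j" using ex_wl_eq[OF g(1), of j] g(2) by auto
    then show "j \<in> wl ` wball r" using \<open>j \<in> {..r}\<close> by (auto simp: wball_def)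
  qed
  from card_mono[OF _ this] have "r + 1 \<le> card (wl ` wball r)" by simp
  then show ?thesis using card_image_le[OF finite_wball, of wl r] by linarith
qed

text \<open>
  Monotonicity of the volume, together with \<open>1 \<le> volume G S r\<close>, extends the comparison from large radii to all
  positive ones, at the price of the constants.
\<close>

lemma polynomial_growth_bounds:
  assumes "polynomial_growth G S d"
  shows "\<exists>c>0. \<exists>C>0. \<forall>r\<ge>1. c * real r ^ d \<le> volume G S r \<and> volume G S r \<le> C * real r ^ d"
proof -
  obtain a b a' b' N where p: "a > 0" "b > 0" "a' > 0" "b' > 0" and
    *: "\<And>n. n \<ge> N \<Longrightarrow> volume G S n \<le> b * (a * real n) ^ d \<and> b' * (a' * real n) ^ d \<le> volume G S n"
    using growth_equiv_at_nat[OF assms[unfolded polynomial_growth_def]] by blast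
  define M where "M = max 1 N"
  define c where "c = min (b' * a' ^ d) (1 / real M ^ d)"
  define C where "C = max (b * a ^ d) (volume G S M)"
  have M: "real M > 0" unfolding M_def by linarith
  have "c > 0" "C > 0" unfolding c_def C_def using p M volume_ge_1[of M] by auto
  moreover have "c * real r ^ d \<le> volume G S r \<and> volume G S r \<le> C * real r ^ d" if "r \<ge> 1" for r
  proof (cases "r \<ge> N")
    case True
    have "c * real r ^ d \<le> b' * a' ^ d * real r ^ d" by (intro mult_right_mono) (auto simp: c_def)
    moreover have "b * a ^ d * real r ^ d \<le> C * real r ^ d" by (intro mult_right_mono) (auto simp: C_def)
    ultimately show ?thesis using *[OF True] by (auto simp: power_mult_distrib)
  next
    case False
    then have rM: "r \<le> M" by (simp add: M_def)
    have "c * real r ^ d \<le> (1 / real M ^ d) * real M ^ d"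
      using rM M by (intro mult_mono power_mono) (auto simp: c_def)
    then have 1: "c * real r ^ d \<le> volume G S r" using volume_ge_1[of r] M by auto
    have "volume G S r * 1 \<le> C * real r ^ d"
      using volume_mono[OF rM] that volume_ge_1[of r] volume_ge_1[of M] by (intro mult_mono) (auto simp: C_def)
    then show ?thesis using 1 by simp
  qed
  ultimately show ?thesis by blast
qed

end

section \<open>Convolution powers of symmetric measures\<close>

context group begin

lemma convolution_bind:
  "convolution G \<mu> \<nu> = bind_pmf \<mu> (\<lambda>x. bind_pmf \<nu> (\<lambda>y. return_pmf (x \<otimes> y)))"
  by (simp add: convolution_def pair_pmf_def map_bind_pmf)

lemma set_pmf_convolution:
  "set_pmf \<mu> \<subseteq> carrier G \<Longrightarrow> set_pmf \<nu> \<subseteq> carrier G \<Longrightarrow> set_pmf (convolution G \<mu> \<nu>) \<subseteq> carrier G"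
  by (auto simp: convolution_bind)

lemma convolution_assoc:
  assumes "set_pmf \<mu> \<subseteq> carrier G" "set_pmf \<nu> \<subseteq> carrier G" "set_pmf \<xi> \<subseteq> carrier G"
  shows "convolution G (convolution G \<mu> \<nu>) \<xi> = convolution G \<mu> (convolution G \<nu> \<xi>)"
  unfolding convolution_bind bind_assoc_pmf bind_return_pmf
  using assms by (intro bind_pmf_cong refl) (auto simp: m_assoc subset_iff)

lemma convolution_one:
  assumes "set_pmf \<mu> \<subseteq> carrier G"
  shows "convolution G \<mu> (return_pmf \<one>) = \<mu>" "convolution G (return_pmf \<one>) \<mu> = \<mu>"
proof -
  have "bind_pmf \<mu> (\<lambda>x. return_pmf (x \<otimes> \<one>)) = bind_pmf \<mu> return_pmf"
    using assms by (intro bind_pmf_cong refl) auto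
  then show "convolution G \<mu> (return_pmf \<one>) = \<mu>"
    by (simp add: convolution_bind bind_return_pmf bind_return_pmf')
  have "bind_pmf \<mu> (\<lambda>x. return_pmf (\<one> \<otimes> x)) = bind_pmf \<mu> return_pmf"
    using assms by (intro bind_pmf_cong refl) auto
  then show "convolution G (return_pmf \<one>) \<mu> = \<mu>"
    by (simp add: convolution_bind bind_return_pmf bind_return_pmf')
qed

lemma conv_power_0: "conv_power G \<mu> 0 = return_pmf \<one>"
  and conv_power_Suc: "conv_power G \<mu> (Suc n) = convolution G \<mu> (conv_power G \<mu> n)"
  by (simp_all add: conv_power_def)

lemma set_pmf_conv_power: "set_pmf \<mu> \<subseteq> carrier G \<Longrightarrow> set_pmf (conv_power G \<mu> n) \<subseteq> carrier G"
  by (induction n) (simp_all add: conv_power_0 conv_power_Suc set_pmf_convolution)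

lemma conv_power_add:
  assumes "set_pmf \<mu> \<subseteq> carrier G"
  shows "conv_power G \<mu> (m + n) = convolution G (conv_power G \<mu> m) (conv_power G \<mu> n)"
proof (induction m)
  case 0
  then show ?case using convolution_one(2)[OF set_pmf_conv_power[OF assms]] by (simp add: conv_power_0)
next
  case (Suc m)
  then show ?case
    using convolution_assoc[OF assms set_pmf_conv_power[OF assms] set_pmf_conv_power[OF assms]]
    by (simp add: conv_power_Suc)
qed

lemma inj_on_inv: "inj_on (m_inv G) (carrier G)"
  by (metis inj_onI inv_inv)

text \<open>
  Invariance under the inversion map is easier to propagate through convolutions than the pointwise identity.
\<close>

lemma symmetric_probability_iff:
  "symmetric_probability G \<phi> \<longleftrightarrow> set_pmf \<phi> \<subseteq> carrier G \<and> map_pmf (m_inv G) \<phi> = \<phi>"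
proof (cases "set_pmf \<phi> \<subseteq> carrier G")
  case True
  have *: "pmf (map_pmf (m_inv G) \<phi>) (inv g) = pmf \<phi> g" if "g \<in> carrier G" for g
  proof (cases "g \<in> set_pmf \<phi>")
    case True
    then show ?thesis using inj_on_subset[OF inj_on_inv] \<open>set_pmf \<phi> \<subseteq> carrier G\<close> by (intro pmf_map_inj) auto
  next
    case False
    then have "inv g \<notin> set_pmf (map_pmf (m_inv G) \<phi>)"
      using that \<open>set_pmf \<phi> \<subseteq> carrier G\<close> by (auto dest!: inj_onD[OF inj_on_inv])
    then show ?thesis using False by (metis set_pmf_iff)
  qed
  show ?thesis
  proof (safe, goal_cases)
    case 1
    then show ?case by (auto simp: symmetric_probability_def)
  next
    case 2
    show ?case
    proof (rule pmf_eqI)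
      fix g
      show "pmf (map_pmf (m_inv G) \<phi>) g = pmf \<phi> g"
      proof (cases "g \<in> carrier G")
        case True
        then show ?thesis using *[of "inv g"] 2 by (auto simp: symmetric_probability_def)
      next
        case False
        then have "g \<notin> set_pmf \<phi>" "g \<notin> set_pmf (map_pmf (m_inv G) \<phi>)" using \<open>set_pmf \<phi> \<subseteq> carrier G\<close> by auto
        then show ?thesis by (metis set_pmf_iff)
      qed
    qed
  next
    case 3
    then show ?case using * by (auto simp: symmetric_probability_def)
  qed
qed (auto simp: symmetric_probability_def)

lemma map_inv_convolution:
  assumes "set_pmf \<mu> \<subseteq> carrier G" "set_pmf \<nu> \<subseteq> carrier G"
  shows "map_pmf (m_inv G) (convolution G \<mu> \<nu>) = convolution G (map_pmf (m_inv G) \<nu>) (map_pmf (m_inv G) \<mu>)"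
proof -
  have "map_pmf (m_inv G) (convolution G \<mu> \<nu>)
      = bind_pmf \<mu> (\<lambda>x. bind_pmf \<nu> (\<lambda>y. return_pmf (inv y \<otimes> inv x)))"
    unfolding convolution_bind map_bind_pmf map_return_pmf
    using assms by (intro bind_pmf_cong refl) (auto simp: inv_mult_group subset_iff)
  also have "\<dots> = bind_pmf \<nu> (\<lambda>y. bind_pmf \<mu> (\<lambda>x. return_pmf (inv y \<otimes> inv x)))"
    by (rule bind_commute_pmf)
  also have "\<dots> = convolution G (map_pmf (m_inv G) \<nu>) (map_pmf (m_inv G) \<mu>)"
    by (simp add: convolution_bind bind_map_pmf)
  finally show ?thesis .
qed

lemma symmetric_conv_power:
  assumes "symmetric_probability G \<phi>" shows "symmetric_probability G (conv_power G \<phi> n)"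
proof -
  have sub: "set_pmf \<phi> \<subseteq> carrier G" and sym: "map_pmf (m_inv G) \<phi> = \<phi>"
    using assms by (auto simp: symmetric_probability_iff)
  have "map_pmf (m_inv G) (conv_power G \<phi> n) = conv_power G \<phi> n"
  proof (induction n)
    case (Suc n)
    have "conv_power G \<phi> 1 = \<phi>" using convolution_one(1)[OF sub] by (simp add: conv_power_Suc conv_power_0)
    then have "convolution G (conv_power G \<phi> n) \<phi> = conv_power G \<phi> (Suc n)"
      using conv_power_add[OF sub, of n 1] by simp
    then show ?case
      using Suc sym map_inv_convolution[OF sub set_pmf_conv_power[OF sub], of n] by (simp add: conv_power_Suc)
  qed (simp add: conv_power_0)
  then show ?thesis using set_pmf_conv_power[OF sub] by (simp add: symmetric_probability_iff)
qed

text \<open>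
  Only finitely many intermediate points are summed, so the estimates for a measure of infinite support can be
  carried out with finite sums.
\<close>

lemma convolution_ge_partial_sum:
  assumes "finite Z" "Z \<subseteq> carrier G" "x \<in> carrier G" "y \<in> carrier G"
  shows "(\<Sum>z\<in>Z. pmf \<mu> (inv x \<otimes> z) * pmf \<nu> (inv z \<otimes> y)) \<le> pmf (convolution G \<mu> \<nu>) (inv x \<otimes> y)"
proof -
  let ?g = "\<lambda>z. (inv x \<otimes> z, inv z \<otimes> y)"
  have inj: "inj_on ?g Z"
    using assms by (intro inj_onI) (auto simp: subset_iff)
  have "(\<Sum>z\<in>Z. pmf \<mu> (inv x \<otimes> z) * pmf \<nu> (inv z \<otimes> y)) = (\<Sum>w\<in>?g ` Z. pmf (pair_pmf \<mu> \<nu>) w)"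
    by (simp add: sum.reindex[OF inj] pmf_pair)
  also have "\<dots> = measure_pmf.prob (pair_pmf \<mu> \<nu>) (?g ` Z)"
    using assms by (simp add: measure_measure_pmf_finite)
  also have "\<dots> \<le> measure_pmf.prob (pair_pmf \<mu> \<nu>) ((\<lambda>(x, y). x \<otimes> y) -` {inv x \<otimes> y})"
  proof (rule measure_pmf.finite_measure_mono)
    have "(inv x \<otimes> z) \<otimes> (inv z \<otimes> y) = inv x \<otimes> y" if "z \<in> carrier G" for z
      using that assms by (metis inv_solve_left inv_closed m_assoc m_closed)
    then show "?g ` Z \<subseteq> (\<lambda>(x, y). x \<otimes> y) -` {inv x \<otimes> y}" using assms by auto
  qed simp
  also have "\<dots> = pmf (convolution G \<mu> \<nu>) (inv x \<otimes> y)"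
    by (simp add: convolution_def pmf_map)
  finally show ?thesis .
qed

section \<open>The norm of a translation and return probabilities\<close>

text \<open>
  The quantity bounded here is the \<open>L2\<close> distance between \<open>f\<close> and its right translate by \<open>y\<close>. Bounding all finite
  partial sums avoids naming the support of the difference, which depends on \<open>y\<close>, and makes the triangle
  inequality below a matter of reindexing.
\<close>

definition shift_le :: "('a \<Rightarrow> real) \<Rightarrow> 'a \<Rightarrow> real \<Rightarrow> bool" where
  "shift_le f y a \<longleftrightarrow> (\<forall>Z. finite Z \<longrightarrow> Z \<subseteq> carrier G \<longrightarrow> L2_set (\<lambda>x. f x - f (x \<otimes> y)) Z \<le> a)"

lemma shift_leD: "shift_le f y a \<Longrightarrow> finite Z \<Longrightarrow> Z \<subseteq> carrier G \<Longrightarrow> L2_set (\<lambda>x. f x - f (x \<otimes> y)) Z \<le> a"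
  by (simp add: shift_le_def)

lemma shift_le_nonneg: "shift_le f y a \<Longrightarrow> 0 \<le> a"
  using shift_leD[of f y a "{}"] by simp

lemma shift_le_mono: "shift_le f y a \<Longrightarrow> a \<le> b \<Longrightarrow> shift_le f y b"
  by (force simp: shift_le_def)

lemma L2_set_reindex: "inj_on h Z \<Longrightarrow> L2_set f (h ` Z) = L2_set (\<lambda>x. f (h x)) Z"
  by (simp add: L2_set_def sum.reindex)

lemma inj_on_mult_right: "y \<in> carrier G \<Longrightarrow> Z \<subseteq> carrier G \<Longrightarrow> inj_on (\<lambda>x. x \<otimes> y) Z"
  by (auto intro!: inj_onI simp: subset_iff)

text \<open>
  Telescoping \<open>f x - f (x y z)\<close> through \<open>f (x y)\<close>, and reindexing the second sum by \<open>x \<mapsto> x y\<close>.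
\<close>

lemma shift_le_mult:
  assumes "y \<in> carrier G" "z \<in> carrier G" "shift_le f y a" "shift_le f z b"
  shows "shift_le f (y \<otimes> z) (a + b)"
  unfolding shift_le_def
proof (intro allI impI)
  fix Z assume Z: "finite Z" "Z \<subseteq> carrier G"
  have "L2_set (\<lambda>x. f x - f (x \<otimes> (y \<otimes> z))) Z
      = L2_set (\<lambda>x. (f x - f (x \<otimes> y)) + (f (x \<otimes> y) - f ((x \<otimes> y) \<otimes> z))) Z"
    using Z assms by (intro L2_set_cong refl) (auto simp: m_assoc subset_iff)
  also have "\<dots> \<le> L2_set (\<lambda>x. f x - f (x \<otimes> y)) Z + L2_set (\<lambda>x. f (x \<otimes> y) - f ((x \<otimes> y) \<otimes> z)) Z"
    by (rule L2_set_triangle_ineq)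
  also have "L2_set (\<lambda>x. f (x \<otimes> y) - f ((x \<otimes> y) \<otimes> z)) Z = L2_set (\<lambda>x. f x - f (x \<otimes> z)) ((\<lambda>x. x \<otimes> y) ` Z)"
    by (simp add: L2_set_reindex[OF inj_on_mult_right[OF assms(1) Z(2)]])
  also have "L2_set (\<lambda>x. f x - f (x \<otimes> y)) Z + \<dots> \<le> a + b"
    using assms Z by (intro add_mono shift_leD) auto
  finally show "L2_set (\<lambda>x. f x - f (x \<otimes> (y \<otimes> z))) Z \<le> a + b" .
qed

lemma shift_le_one: "0 \<le> a \<Longrightarrow> shift_le f \<one> a"
  by (auto simp: shift_le_def L2_set_def sum.neutral subset_iff)

lemma L2_set_support:
  assumes "finite \<Omega>" "\<And>x. x \<in> carrier G - \<Omega> \<Longrightarrow> f x = 0" "finite Z" "Z \<subseteq> carrier G"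
  shows "L2_set f Z \<le> L2_set f \<Omega>"
proof -
  have "(\<Sum>x\<in>Z. (f x)\<^sup>2) = (\<Sum>x\<in>Z \<inter> \<Omega>. (f x)\<^sup>2)"
    using assms by (intro sum.mono_neutral_right) auto
  also have "\<dots> \<le> (\<Sum>x\<in>\<Omega>. (f x)\<^sup>2)" using assms by (intro sum_mono2) auto
  finally show ?thesis by (simp add: L2_set_def)
qed

lemma shift_le_trivial:
  assumes "finite \<Omega>" "\<And>x. x \<in> carrier G - \<Omega> \<Longrightarrow> f x = 0" "y \<in> carrier G"
  shows "shift_le f y (2 * L2_set f \<Omega>)"
  unfolding shift_le_def
proof (intro allI impI)
  fix Z assume Z: "finite Z" "Z \<subseteq> carrier G"
  have "L2_set (\<lambda>x. f x + - f (x \<otimes> y)) Z \<le> L2_set f Z + L2_set (\<lambda>x. - f (x \<otimes> y)) Z"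
    by (rule L2_set_triangle_ineq)
  also have "L2_set (\<lambda>x. - f (x \<otimes> y)) Z = L2_set (\<lambda>x. f (x \<otimes> y)) Z" by (simp add: L2_set_def)
  also have "\<dots> = L2_set f ((\<lambda>x. x \<otimes> y) ` Z)"
    by (simp add: L2_set_reindex[OF inj_on_mult_right[OF assms(3) Z(2)]])
  also have "L2_set f Z + \<dots> \<le> L2_set f \<Omega> + L2_set f \<Omega>"
    using Z assms by (intro add_mono L2_set_support) auto
  finally show "L2_set (\<lambda>x. f x - f (x \<otimes> y)) Z \<le> 2 * L2_set f \<Omega>" by simp
qed

text \<open>
  Expanding the square of \<open>f x - f (x y)\<close> over a set that contains \<open>\<Omega>\<close> and its translate by the inverse of
  \<open>y\<close>, where both squared terms have full mass.
\<close>

lemma correlation_ge: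
  assumes "finite \<Omega>" "\<Omega> \<subseteq> carrier G" "\<And>x. x \<in> carrier G - \<Omega> \<Longrightarrow> f x = 0" "y \<in> carrier G" "shift_le f y a"
  shows "(\<Sum>x\<in>\<Omega>. f x * f (x \<otimes> y)) \<ge> (\<Sum>x\<in>\<Omega>. (f x)\<^sup>2) - a\<^sup>2 / 2"
proof -
  define Z where "Z = \<Omega> \<union> (\<lambda>x. x \<otimes> inv y) ` \<Omega>"
  have Z: "finite Z" "Z \<subseteq> carrier G" using assms by (auto simp: Z_def)
  have inj: "inj_on (\<lambda>x. x \<otimes> y) Z" using inj_on_mult_right[OF assms(4) Z(2)] .
  have sub: "\<Omega> \<subseteq> (\<lambda>x. x \<otimes> y) ` Z"
  proof
    fix x assume x: "x \<in> \<Omega>"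
    then have "(x \<otimes> inv y) \<otimes> y = x" using assms(2,4) by (auto simp: m_assoc)
    moreover have "x \<otimes> inv y \<in> Z" using x by (auto simp: Z_def)
    ultimately show "x \<in> (\<lambda>x. x \<otimes> y) ` Z" by (metis imageI)
  qed
  have 1: "(\<Sum>x\<in>Z. (f x)\<^sup>2) = (\<Sum>x\<in>\<Omega>. (f x)\<^sup>2)"
    using Z assms(3) by (intro sum.mono_neutral_right) (auto simp: Z_def)
  have 2: "(\<Sum>x\<in>Z. (f (x \<otimes> y))\<^sup>2) \<ge> (\<Sum>x\<in>\<Omega>. (f x)\<^sup>2)"
  proof -
    have "(\<Sum>x\<in>\<Omega>. (f x)\<^sup>2) \<le> (\<Sum>x\<in>(\<lambda>x. x \<otimes> y) ` Z. (f x)\<^sup>2)"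
      using Z sub by (intro sum_mono2) auto
    then show ?thesis by (simp add: sum.reindex[OF inj])
  qed
  have 3: "(\<Sum>x\<in>Z. f x * f (x \<otimes> y)) = (\<Sum>x\<in>\<Omega>. f x * f (x \<otimes> y))"
    using Z assms(3) by (intro sum.mono_neutral_right) (auto simp: Z_def)
  have "sqrt (\<Sum>x\<in>Z. (f x - f (x \<otimes> y))\<^sup>2) \<le> a"
    using shift_leD[OF assms(5) Z] by (simp add: L2_set_def)
  then have "(\<Sum>x\<in>Z. (f x - f (x \<otimes> y))\<^sup>2) \<le> a\<^sup>2" by (rule sqrt_le_D)
  moreover have "(\<Sum>x\<in>Z. (f x - f (x \<otimes> y))\<^sup>2)
      = (\<Sum>x\<in>Z. (f x)\<^sup>2) + (\<Sum>x\<in>Z. (f (x \<otimes> y))\<^sup>2) - 2 * (\<Sum>x\<in>Z. f x * f (x \<otimes> y))"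
    by (simp add: power2_diff sum.distrib sum_subtractf sum_distrib_left mult.assoc)
  ultimately show ?thesis using 1 2 3 by simp
qed

lemma quadratic_form_eq_expectation:
  assumes "finite \<Omega>" "\<Omega> \<subseteq> carrier G" "\<And>x. x \<in> carrier G - \<Omega> \<Longrightarrow> f x = 0" "set_pmf \<phi> \<subseteq> carrier G"
  shows "(\<Sum>x\<in>\<Omega>. \<Sum>z\<in>\<Omega>. f x * pmf \<phi> (inv x \<otimes> z) * f z)
    = measure_pmf.expectation \<phi> (\<lambda>y. \<Sum>x\<in>\<Omega>. f x * f (x \<otimes> y))"
proof -
  have eq: "f (x \<otimes> y) = (\<Sum>z\<in>\<Omega>. f z * indicator {inv x \<otimes> z} y)" if "x \<in> \<Omega>" "y \<in> carrier G" for x y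
  proof -
    have "(\<Sum>z\<in>\<Omega>. f z * indicator {inv x \<otimes> z} y) = (\<Sum>z\<in>\<Omega>. if z = x \<otimes> y then f z else 0)"
      using that assms(2)
      by (intro sum.cong refl) (auto simp: indicator_def subset_iff m_assoc[symmetric])
    also have "\<dots> = (if x \<otimes> y \<in> \<Omega> then f (x \<otimes> y) else 0)" using assms(1) by simp
    also have "\<dots> = f (x \<otimes> y)" using assms that by auto
    finally show ?thesis by simp
  qed
  have "measure_pmf.expectation \<phi> (\<lambda>y. \<Sum>x\<in>\<Omega>. f x * f (x \<otimes> y))
      = measure_pmf.expectation \<phi> (\<lambda>y. \<Sum>x\<in>\<Omega>. \<Sum>z\<in>\<Omega>. f x * f z * indicator {inv x \<otimes> z} y)"
    using assms(4) eq
    by (intro integral_cong_AE) (auto simp: AE_measure_pmf_iff subset_iff sum_distrib_left mult.assoc intro!: sum.cong)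
  also have "\<dots> = (\<Sum>x\<in>\<Omega>. \<Sum>z\<in>\<Omega>. f x * f z * pmf \<phi> (inv x \<otimes> z))"
  proof -
    have int: "integrable (measure_pmf \<phi>) (\<lambda>y. f x * f z * indicator {inv x \<otimes> z} y)" for x z
      by (rule measure_pmf.integrable_const_bound[where B = "\<bar>f x * f z\<bar>"]) (auto simp: indicator_def)
    have "measure_pmf.expectation \<phi> (\<lambda>y. \<Sum>x\<in>\<Omega>. \<Sum>z\<in>\<Omega>. f x * f z * indicator {inv x \<otimes> z} y)
      = (\<Sum>x\<in>\<Omega>. \<Sum>z\<in>\<Omega>. measure_pmf.expectation \<phi> (\<lambda>y. f x * f z * indicator {inv x \<otimes> z} y))"
      using int by (simp add: Bochner_Integration.integral_sum Bochner_Integration.integrable_sum)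
    then show ?thesis by (simp add: measure_pmf_single)
  qed
  also have "\<dots> = (\<Sum>x\<in>\<Omega>. \<Sum>z\<in>\<Omega>. f x * pmf \<phi> (inv x \<otimes> z) * f z)"
    by (intro sum.cong refl) (simp add: mult_ac)
  finally show ?thesis ..
qed

text \<open>
  The walk killed outside \<open>\<Omega>\<close> is a symmetric operator \<open>A\<close> on a finite-dimensional space, and the numbers
  \<open>c m\<close>, the squared norms of \<open>A ^^ m\<close> applied to \<open>f\<close>, are log-convex by Cauchy-Schwarz. Their first ratio is at
  least \<open>q\<^sup>2\<close>, hence so are all ratios and \<open>q ^ (2 * n) \<le> c n\<close>. Conversely \<open>c n\<close> is at most the squared
  Hilbert-Schmidt norm of the free kernel restricted to \<open>\<Omega>\<close>, and each of its \<open>card \<Omega>\<close> columns contributes at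
  most the return probability at time \<open>2 * n\<close>.
\<close>

lemma return_probability_ge_rayleigh:
  assumes sym: "symmetric_probability G \<phi>"
    and \<Omega>: "finite \<Omega>" "\<Omega> \<subseteq> carrier G"
    and f: "\<And>x. f x \<ge> 0" "(\<Sum>x\<in>\<Omega>. (f x)\<^sup>2) = 1"
    and q: "0 \<le> q" "q \<le> (\<Sum>x\<in>\<Omega>. \<Sum>z\<in>\<Omega>. f x * pmf \<phi> (inv x \<otimes> z) * f z)"
  shows "q ^ (2 * n) \<le> real (card \<Omega>) * pmf (conv_power G \<phi> (2 * n)) \<one>"
proof -
  define A where "A = (\<lambda>(u :: 'a \<Rightarrow> real) x. \<Sum>z\<in>\<Omega>. pmf \<phi> (inv x \<otimes> z) * u z)"
  define u where "u m = (A ^^ m) f" for m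
  define c where "c m = (\<Sum>x\<in>\<Omega>. (u m x)\<^sup>2)" for m
  have sub: "set_pmf \<phi> \<subseteq> carrier G" using sym by (simp add: symmetric_probability_def)
  have sym_kernel: "pmf (conv_power G \<phi> m) (inv x \<otimes> z) = pmf (conv_power G \<phi> m) (inv z \<otimes> x)"
    if "x \<in> carrier G" "z \<in> carrier G" for x z m
  proof -
    have "inv (inv z \<otimes> x) = inv x \<otimes> z" using that by (simp add: inv_mult_group)
    then show ?thesis using symmetric_conv_power[OF sym, of m] that
      by (metis inv_closed m_closed symmetric_probability_def)
  qed
  have pw1: "conv_power G \<phi> 1 = \<phi>" using convolution_one(1)[OF sub] by (simp add: conv_power_Suc conv_power_0)
  have adj: "(\<Sum>x\<in>\<Omega>. v x * A w x) = (\<Sum>x\<in>\<Omega>. A v x * w x)" for v w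
  proof -
    have "(\<Sum>x\<in>\<Omega>. v x * A w x) = (\<Sum>x\<in>\<Omega>. \<Sum>z\<in>\<Omega>. v x * (pmf \<phi> (inv x \<otimes> z) * w z))"
      by (simp add: A_def sum_distrib_left)
    also have "\<dots> = (\<Sum>z\<in>\<Omega>. \<Sum>x\<in>\<Omega>. v x * (pmf \<phi> (inv x \<otimes> z) * w z))" by (rule sum.swap)
    also have "\<dots> = (\<Sum>z\<in>\<Omega>. \<Sum>x\<in>\<Omega>. pmf \<phi> (inv z \<otimes> x) * v x * w z)"
      using sym_kernel[of _ _ 1] \<Omega>(2) pw1 by (intro sum.cong refl) (auto simp: subset_iff)
    also have "\<dots> = (\<Sum>x\<in>\<Omega>. A v x * w x)" by (simp add: A_def sum_distrib_right)
    finally show ?thesis .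
  qed
  have uS: "u (Suc m) = A (u m)" for m by (simp add: u_def)
  have c_nonneg: "c m \<ge> 0" for m unfolding c_def by (simp add: sum_nonneg)
  have c0: "c 0 = 1" using f(2) by (simp add: c_def u_def)
  have logconvex: "(c (Suc m))\<^sup>2 \<le> c m * c (Suc (Suc m))" for m
  proof -
    have "c (Suc m) = (\<Sum>x\<in>\<Omega>. u (Suc m) x * A (u m) x)" by (simp add: c_def uS power2_eq_square)
    also have "\<dots> = (\<Sum>x\<in>\<Omega>. u (Suc (Suc m)) x * u m x)" by (simp add: adj uS)
    finally have "(c (Suc m))\<^sup>2 \<le> (\<Sum>x\<in>\<Omega>. (u (Suc (Suc m)) x)\<^sup>2) * (\<Sum>x\<in>\<Omega>. (u m x)\<^sup>2)"
      using Cauchy_Schwarz_ineq_sum[of "u (Suc (Suc m))" "u m" \<Omega>] by simp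
    then show ?thesis by (simp add: c_def mult.commute)
  qed
  have ratio: "q\<^sup>2 * c m \<le> c (Suc m)" for m
  proof (induction m)
    case 0
    have "(\<Sum>x\<in>\<Omega>. \<Sum>z\<in>\<Omega>. f x * pmf \<phi> (inv x \<otimes> z) * f z) = (\<Sum>x\<in>\<Omega>. u 0 x * u 1 x)"
      by (simp add: u_def A_def sum_distrib_left mult.assoc)
    then have "q\<^sup>2 \<le> (\<Sum>x\<in>\<Omega>. u 0 x * u 1 x)\<^sup>2" using q by (intro power_mono) auto
    also have "\<dots> \<le> c 0 * c 1" unfolding c_def by (rule Cauchy_Schwarz_ineq_sum)
    finally show ?case by (simp add: c0)
  next
    case (Suc m)
    show ?case
    proof (cases "c m = 0")
      case True
      then have "c (Suc m) = 0" using logconvex[of m] by simp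
      then show ?thesis using c_nonneg by simp
    next
      case False
      then have pos: "c m > 0" using c_nonneg[of m] by simp
      have "c m * (q\<^sup>2 * c (Suc m)) = (q\<^sup>2 * c m) * c (Suc m)" by simp
      also have "\<dots> \<le> c (Suc m) * c (Suc m)" using Suc c_nonneg by (intro mult_right_mono) auto
      also have "\<dots> \<le> c m * c (Suc (Suc m))" using logconvex[of m] by (simp add: power2_eq_square)
      finally show ?thesis using pos by simp
    qed
  qed
  have c_ge: "q ^ (2 * m) \<le> c m" for m
  proof (induction m)
    case (Suc m)
    have "q ^ (2 * Suc m) = q\<^sup>2 * q ^ (2 * m)" by (simp add: power2_eq_square)
    also have "\<dots> \<le> q\<^sup>2 * c m" using Suc by (intro mult_left_mono) auto
    finally show ?case using ratio[of m] by simp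
  qed (simp add: c0)
  have u_nonneg: "u m x \<ge> 0" for m x
    by (induction m arbitrary: x) (auto simp: u_def A_def f(1) intro!: sum_nonneg)
  have u_le: "u m x \<le> (\<Sum>y\<in>\<Omega>. pmf (conv_power G \<phi> m) (inv x \<otimes> y) * f y)" if "x \<in> \<Omega>" for m x
    using that
  proof (induction m arbitrary: x)
    case 0
    have "(\<Sum>y\<in>\<Omega>. pmf (conv_power G \<phi> 0) (inv x \<otimes> y) * f y) = (\<Sum>y\<in>\<Omega>. if y = x then f y else 0)"
    proof (intro sum.cong refl)
      fix y assume "y \<in> \<Omega>"
      then have "(\<one> = inv x \<otimes> y) = (y = x)"
        using 0 \<Omega>(2) by (metis in_mono inv_closed inv_equality inv_inv l_inv)
      then show "pmf (conv_power G \<phi> 0) (inv x \<otimes> y) * f y = (if y = x then f y else 0)"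
        by (auto simp: conv_power_0 pmf_return)
    qed
    then show ?case using 0 \<Omega>(1) by (simp add: u_def)
  next
    case (Suc m)
    have "u (Suc m) x \<le> (\<Sum>z\<in>\<Omega>. pmf \<phi> (inv x \<otimes> z) * (\<Sum>y\<in>\<Omega>. pmf (conv_power G \<phi> m) (inv z \<otimes> y) * f y))"
      unfolding uS A_def using Suc.IH by (intro sum_mono mult_left_mono) auto
    also have "\<dots> = (\<Sum>z\<in>\<Omega>. \<Sum>y\<in>\<Omega>. pmf \<phi> (inv x \<otimes> z) * pmf (conv_power G \<phi> m) (inv z \<otimes> y) * f y)"
      by (simp add: sum_distrib_left mult.assoc)
    also have "\<dots> = (\<Sum>y\<in>\<Omega>. \<Sum>z\<in>\<Omega>. pmf \<phi> (inv x \<otimes> z) * pmf (conv_power G \<phi> m) (inv z \<otimes> y) * f y)"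
      by (rule sum.swap)
    also have "\<dots> = (\<Sum>y\<in>\<Omega>. (\<Sum>z\<in>\<Omega>. pmf \<phi> (inv x \<otimes> z) * pmf (conv_power G \<phi> m) (inv z \<otimes> y)) * f y)"
      by (simp add: sum_distrib_right)
    also have "\<dots> \<le> (\<Sum>y\<in>\<Omega>. pmf (conv_power G \<phi> (Suc m)) (inv x \<otimes> y) * f y)"
      unfolding conv_power_Suc using Suc.prems \<Omega> f(1)
      by (intro sum_mono mult_right_mono convolution_ge_partial_sum) auto
    finally show ?case .
  qed
  have "c n \<le> (\<Sum>x\<in>\<Omega>. \<Sum>y\<in>\<Omega>. (pmf (conv_power G \<phi> n) (inv x \<otimes> y))\<^sup>2)"
    unfolding c_def
  proof (rule sum_mono)
    fix x assume x: "x \<in> \<Omega>"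
    have "(u n x)\<^sup>2 \<le> (\<Sum>y\<in>\<Omega>. pmf (conv_power G \<phi> n) (inv x \<otimes> y) * f y)\<^sup>2"
      using u_le[OF x] u_nonneg by (intro power_mono) auto
    also have "\<dots> \<le> (\<Sum>y\<in>\<Omega>. (pmf (conv_power G \<phi> n) (inv x \<otimes> y))\<^sup>2) * (\<Sum>y\<in>\<Omega>. (f y)\<^sup>2)"
      by (rule Cauchy_Schwarz_ineq_sum)
    finally show "(u n x)\<^sup>2 \<le> (\<Sum>y\<in>\<Omega>. (pmf (conv_power G \<phi> n) (inv x \<otimes> y))\<^sup>2)" using f(2) by simp
  qed
  also have "\<dots> = (\<Sum>y\<in>\<Omega>. \<Sum>x\<in>\<Omega>. (pmf (conv_power G \<phi> n) (inv x \<otimes> y))\<^sup>2)" by (rule sum.swap)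
  also have "\<dots> \<le> (\<Sum>y\<in>\<Omega>. pmf (conv_power G \<phi> (2 * n)) \<one>)"
  proof (rule sum_mono)
    fix y assume y: "y \<in> \<Omega>"
    have "(\<Sum>x\<in>\<Omega>. (pmf (conv_power G \<phi> n) (inv x \<otimes> y))\<^sup>2)
      = (\<Sum>x\<in>\<Omega>. pmf (conv_power G \<phi> n) (inv y \<otimes> x) * pmf (conv_power G \<phi> n) (inv x \<otimes> y))"
      using y \<Omega>(2) sym_kernel[of _ y n] by (intro sum.cong refl) (auto simp: power2_eq_square subset_iff)
    also have "\<dots> \<le> pmf (convolution G (conv_power G \<phi> n) (conv_power G \<phi> n)) (inv y \<otimes> y)"
      using y \<Omega> by (intro convolution_ge_partial_sum) auto
    also have "\<dots> = pmf (conv_power G \<phi> (2 * n)) \<one>"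
      using y \<Omega>(2) conv_power_add[OF sub, of n n] by (auto simp: mult_2 subset_iff)
    finally show "(\<Sum>x\<in>\<Omega>. (pmf (conv_power G \<phi> n) (inv x \<otimes> y))\<^sup>2) \<le> pmf (conv_power G \<phi> (2 * n)) \<one>" .
  qed
  also have "\<dots> = real (card \<Omega>) * pmf (conv_power G \<phi> (2 * n)) \<one>" by simp
  finally show ?thesis using c_ge[of n] by linarith
qed

end

section \<open>Consequences of the weak moment condition\<close>

text \<open>
  A discrete mean value estimate that treats \<open>\<beta> < 1\<close> and \<open>\<beta> \<ge> 1\<close> alike, from
  \<open>(1 - 1 / x) powr \<beta> \<le> exp (- (\<beta> / x)) \<le> 1 / (1 + \<beta> / x)\<close>.
\<close>

lemma powr_diff_lower:
  fixes x \<beta> :: real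
  assumes "0 < \<beta>" "\<beta> \<le> 2" "1 \<le> x"
  shows "x powr (\<beta> - 1) \<le> 3 / \<beta> * (x powr \<beta> - (x - 1) powr \<beta>)"
proof -
  have "(x - 1) powr \<beta> \<le> x powr \<beta> * (1 / (1 + \<beta> / x))"
  proof (cases "x = 1")
    case False
    then have x: "x > 1" using assms by simp
    \<comment> \<open>\<open>x = 1\<close> is treated separately because \<open>ln (1 - 1 / x)\<close> is meaningful for \<open>x > 1\<close> only; there \<open>(x - 1) powr \<beta>\<close> vanishes\<close>
    have "((x - 1) / x) powr \<beta> = exp (\<beta> * ln (1 - 1 / x))"
      using x by (simp add: powr_def diff_divide_distrib)
    also have "\<dots> \<le> exp (- (\<beta> / x))"
    proof -
      have "ln (1 - 1 / x) \<le> (1 - 1 / x) - 1" using x by (intro ln_le_minus_one) simp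
      then show ?thesis using assms by (simp add: mult_left_mono[of _ "- (1 / x)" \<beta>, simplified])
    qed
    also have "\<dots> = 1 / exp (\<beta> / x)" by (simp add: exp_minus inverse_eq_divide)
    also have "\<dots> \<le> 1 / (1 + \<beta> / x)"
      using assms x exp_ge_add_one_self[of "\<beta> / x"] by (intro divide_left_mono) (auto intro!: mult_pos_pos add_pos_pos)
    finally have "((x - 1) / x) powr \<beta> \<le> 1 / (1 + \<beta> / x)" .
    then have "x powr \<beta> * ((x - 1) / x) powr \<beta> \<le> x powr \<beta> * (1 / (1 + \<beta> / x))"
      by (intro mult_left_mono) auto
    moreover have "x powr \<beta> * ((x - 1) / x) powr \<beta> = (x - 1) powr \<beta>"
      using x by (simp add: powr_divide)
    ultimately show ?thesis by simp
  qed (use assms in auto)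
  then have "x powr \<beta> * (1 - 1 / (1 + \<beta> / x)) \<le> x powr \<beta> - (x - 1) powr \<beta>" by (simp add: algebra_simps)
  moreover have "1 - 1 / (1 + \<beta> / x) \<ge> \<beta> / (3 * x)"
  proof -
    have "1 - 1 / (1 + \<beta> / x) = \<beta> / (x + \<beta>)" using assms by (simp add: field_simps)
    also have "\<dots> \<ge> \<beta> / (3 * x)" using assms by (intro divide_left_mono) auto
    finally show ?thesis .
  qed
  ultimately have le: "x powr \<beta> * (\<beta> / (3 * x)) \<le> x powr \<beta> - (x - 1) powr \<beta>"
    using mult_left_mono[of "\<beta> / (3 * x)" "1 - 1 / (1 + \<beta> / x)" "x powr \<beta>"] by simp
  have eq: "x powr \<beta> * (\<beta> / (3 * x)) = \<beta> / 3 * x powr (\<beta> - 1)"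
    using assms by (simp add: powr_diff)
  have "\<beta> / 3 * x powr (\<beta> - 1) \<le> x powr \<beta> - (x - 1) powr \<beta>" using le by (simp only: eq)
  then have "3 / \<beta> * (\<beta> / 3 * x powr (\<beta> - 1)) \<le> 3 / \<beta> * (x powr \<beta> - (x - 1) powr \<beta>)"
    using assms by (intro mult_left_mono) auto
  then show ?thesis using assms by simp
qed

lemma sum_powr_le:
  fixes \<beta> :: real
  assumes "0 < \<beta>" "\<beta> \<le> 2"
  shows "(\<Sum>j=1..R. real j powr (\<beta> - 1)) \<le> 3 / \<beta> * real R powr \<beta>"
proof (induction R)
  case (Suc R)
  have "real (Suc R) powr (\<beta> - 1) \<le> 3 / \<beta> * (real (Suc R) powr \<beta> - real R powr \<beta>)"
    using powr_diff_lower[OF assms, of "real (Suc R)"] by simp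
  then show ?case using Suc by (simp add: right_diff_distrib)
qed simp

text \<open>
  Summation by parts: the mean of a truncated square is thereby a weighted sum of tail probabilities.
\<close>

lemma min_power2_eq_sum:
  "real (min l R) ^ 2 = (\<Sum>j=1..R. (2 * real j - 1) * (if j \<le> l then 1 else 0))"
proof (induction R)
  case (Suc R)
  have "real (min l (Suc R)) ^ 2 = real (min l R) ^ 2 + (2 * real (Suc R) - 1) * (if Suc R \<le> l then 1 else 0)"
    by (cases "Suc R \<le> l") (auto simp: min_def power2_eq_square algebra_simps not_less_eq_eq)
  then show ?case using Suc by simp
qed simp

context fg_group
begin

lemma shift_le_wl:
  assumes "\<And>s. s \<in> S \<Longrightarrow> shift_le f s a" "g \<in> carrier G"
  shows "shift_le f g (real (wl g) * a)"
  by (rule wl_induct_bound[where P = "shift_le f"])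
    (auto intro: shift_le_one shift_le_mult assms)

text \<open>
  The threshold \<open>s = j powr \<alpha>\<close> makes the event in the weak moment exactly \<open>j \<le> wl g\<close>, because \<open>\<rho>\<^bsub>\<alpha>\<^esub>\<close> is
  evaluated at \<open>1 + wl g\<close>.
\<close>

lemma weak_moment_tail:
  assumes "0 < \<alpha>" "weak_moment G S \<rho>\<^bsub>\<alpha>\<^esub> \<phi> \<le> ereal (2 * \<rho>\<^bsub>\<alpha>\<^esub> 0)" "j \<ge> 1"
  shows "measure_pmf.prob \<phi> {g \<in> carrier G. j \<le> wl g} \<le> 2 * real j powr - \<alpha>"
proof -
  let ?s = "real j powr \<alpha>"
  have s: "?s > 0" using assms by simp
  have "?s < (1 + real n) powr \<alpha> \<longleftrightarrow> j \<le> n" for n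
  proof (cases "j \<le> n")
    case True
    then show ?thesis using assms powr_less_mono2[of \<alpha> "real j" "1 + real n"] by simp
  next
    case False
    then show ?thesis using assms powr_mono2[of \<alpha> "1 + real n" "real j"] by simp
  qed
  then have *: "{g \<in> carrier G. \<rho>\<^bsub>\<alpha>\<^esub> (real (wl g)) > ?s} = {g \<in> carrier G. j \<le> wl g}"
    by (simp add: power_moment_def)
  have "ereal (?s * measure_pmf.prob \<phi> {g \<in> carrier G. \<rho>\<^bsub>\<alpha>\<^esub> (real (wl g)) > ?s}) \<le> weak_moment G S \<rho>\<^bsub>\<alpha>\<^esub> \<phi>"
    unfolding weak_moment_def using s by (intro SUP_upper) auto
  also have "\<dots> \<le> ereal 2" using assms(2) by (simp add: power_moment_def)
  finally have "?s * measure_pmf.prob \<phi> {g \<in> carrier G. j \<le> wl g} \<le> 2" unfolding * by simp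
  then show ?thesis using s by (simp add: powr_minus field_simps)
qed

text \<open>
  Tails of order \<open>j powr - \<alpha>\<close> give a sum of terms \<open>j powr (1 - \<alpha>)\<close>, which is dominated by its largest scale
  precisely because \<open>\<alpha> < 2\<close>.
\<close>

lemma truncated_second_moment:
  assumes "0 < \<alpha>" "\<alpha> < 2" "set_pmf \<phi> \<subseteq> carrier G" "weak_moment G S \<rho>\<^bsub>\<alpha>\<^esub> \<phi> \<le> ereal (2 * \<rho>\<^bsub>\<alpha>\<^esub> 0)"
  shows "measure_pmf.expectation \<phi> (\<lambda>g. real (min (wl g) R) ^ 2) \<le> 12 / (2 - \<alpha>) * real R powr (2 - \<alpha>)"
proof -
  have int: "integrable (measure_pmf \<phi>) (indicator {g \<in> carrier G. j \<le> wl g} :: _ \<Rightarrow> real)" for j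
    by (intro measure_pmf.integrable_const_bound[where B = 1]) (auto simp: indicator_def)
  have "measure_pmf.expectation \<phi> (\<lambda>g. real (min (wl g) R) ^ 2)
      = measure_pmf.expectation \<phi> (\<lambda>g. \<Sum>j=1..R. (2 * real j - 1) * indicator {g \<in> carrier G. j \<le> wl g} g)"
    unfolding min_power2_eq_sum using assms(3)
    by (intro integral_cong_AE AE_pmfI sum.cong refl) (auto simp: indicator_def)
  also have "\<dots> = (\<Sum>j=1..R. (2 * real j - 1) * measure_pmf.prob \<phi> {g \<in> carrier G. j \<le> wl g})"
    using int by (subst Bochner_Integration.integral_sum) auto
  also have "\<dots> \<le> (\<Sum>j=1..R. (2 * real j) * (2 * real j powr - \<alpha>))"
    using weak_moment_tail[OF assms(1,4)] by (intro sum_mono mult_mono) auto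
  also have "\<dots> = 4 * (\<Sum>j=1..R. real j powr ((2 - \<alpha>) - 1))"
    unfolding sum_distrib_left
  proof (intro sum.cong refl)
    fix j assume "j \<in> {1..R}"
    then have j: "real j > 0" by simp
    have "real j powr ((2 - \<alpha>) - 1) = real j powr (1 + - \<alpha>)" by (rule arg_cong[where f = "\<lambda>z. real j powr z"]) simp
    also have "\<dots> = real j * real j powr - \<alpha>" using j by (subst powr_add) auto
    finally show "2 * real j * (2 * real j powr - \<alpha>) = 4 * real j powr (2 - \<alpha> - 1)" by simp
  qed
  also have "\<dots> \<le> 4 * (3 / (2 - \<alpha>) * real R powr (2 - \<alpha>))"
    using assms by (intro mult_left_mono sum_powr_le) auto
  finally show ?thesis by simp
qed

lemma weak_moment_return_one:
  "weak_moment G S \<rho>\<^bsub>\<alpha>\<^esub> (return_pmf \<one>) \<le> ereal (2 * \<rho>\<^bsub>\<alpha>\<^esub> 0)"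
  unfolding weak_moment_def by (intro SUP_least) (auto simp: power_moment_def indicator_def)

lemma Phi_tilde_ge:
  assumes "\<And>\<phi>. symmetric_probability G \<phi> \<Longrightarrow> weak_moment G S \<rho>\<^bsub>\<alpha>\<^esub> \<phi> \<le> ereal (2 * \<rho>\<^bsub>\<alpha>\<^esub> 0)
    \<Longrightarrow> b \<le> pmf (conv_power G \<phi> (2 * n)) \<one>"
  shows "b \<le> Phi_tilde G S \<rho>\<^bsub>\<alpha>\<^esub> n"
proof -
  have "symmetric_probability G (return_pmf \<one>)" by (simp add: symmetric_probability_iff)
  then show ?thesis
    unfolding Phi_tilde_def using assms weak_moment_return_one by (intro cINF_greatest) auto
qed

lemma Phi_tilde_le:
  assumes "symmetric_probability G \<phi>" "weak_moment G S \<rho>\<^bsub>\<alpha>\<^esub> \<phi> \<le> ereal (2 * \<rho>\<^bsub>\<alpha>\<^esub> 0)"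
  shows "Phi_tilde G S \<rho>\<^bsub>\<alpha>\<^esub> n \<le> pmf (conv_power G \<phi> (2 * n)) \<one>"
  unfolding Phi_tilde_def using assms by (intro cINF_lower bdd_belowI[where m = 0]) auto

text \<open>
  Translation by \<open>y\<close> moves \<open>f\<close> by at most \<open>wl y * A / R\<close>, by subadditivity, and by at most \<open>2\<close>, because \<open>f\<close> has
  norm one; both are at most a multiple of \<open>min (wl y) R / R\<close>. The loss in the Rayleigh quotient is half the mean
  square of that bound.
\<close>

lemma Phi_tilde_ge_test_function:
  assumes \<alpha>: "0 < \<alpha>" "\<alpha> < 2" and "0 \<le> A" "1 \<le> R"
    and \<Omega>: "finite \<Omega>" "\<Omega> \<subseteq> carrier G"
    and f: "\<And>x. f x \<ge> 0" "\<And>x. x \<in> carrier G - \<Omega> \<Longrightarrow> f x = 0" "(\<Sum>x\<in>\<Omega>. (f x)\<^sup>2) = 1"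
    and shift: "\<And>s. s \<in> S \<Longrightarrow> shift_le f s (A / real R)"
    and small: "6 * (A + 2)\<^sup>2 / (2 - \<alpha>) * real R powr - \<alpha> \<le> 1"
  shows "(1 - 6 * (A + 2)\<^sup>2 / (2 - \<alpha>) * real R powr - \<alpha>) ^ (2 * n)
    \<le> real (card \<Omega>) * Phi_tilde G S \<rho>\<^bsub>\<alpha>\<^esub> n"
proof -
  define q where "q = 1 - 6 * (A + 2)\<^sup>2 / (2 - \<alpha>) * real R powr - \<alpha>"
  have \<Omega>_ne: "\<Omega> \<noteq> {}" using f(3) by auto
  then have card_pos: "real (card \<Omega>) > 0" using \<Omega> by (simp add: card_gt_0_iff)
  have R: "real R > 0" using assms by simp
  have "q ^ (2 * n) / real (card \<Omega>) \<le> Phi_tilde G S \<rho>\<^bsub>\<alpha>\<^esub> n"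
  proof (rule Phi_tilde_ge)
    fix \<phi> assume \<phi>: "symmetric_probability G \<phi>" "weak_moment G S \<rho>\<^bsub>\<alpha>\<^esub> \<phi> \<le> ereal (2 * \<rho>\<^bsub>\<alpha>\<^esub> 0)"
    have sub: "set_pmf \<phi> \<subseteq> carrier G" using \<phi> by (simp add: symmetric_probability_def)
    \<comment> \<open>the constant \<open>A + 2\<close> covers both estimates, the trivial one \<open>2\<close> being used when \<open>R < wl g\<close>\<close>
    define m where "m g = real (min (wl g) R) * ((A + 2) / real R)" for g
    have m: "shift_le f g (m g)" if "g \<in> carrier G" for g
    proof (cases "wl g \<le> R")
      case True
      have "shift_le f g (real (wl g) * (A / real R))" using shift_le_wl[OF shift that] .
      then show ?thesis
        using True R by (elim shift_le_mono) (auto simp: m_def intro!: mult_left_mono divide_right_mono)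
    next
      case False
      have "shift_le f g (2 * L2_set f \<Omega>)" using shift_le_trivial[OF \<Omega>(1) f(2) that] by simp
      then show ?thesis using False f(3) R \<open>0 \<le> A\<close> by (elim shift_le_mono) (auto simp: m_def L2_set_def)
    qed
    have corr: "1 - (m g)\<^sup>2 / 2 \<le> (\<Sum>x\<in>\<Omega>. f x * f (x \<otimes> g))" if "g \<in> carrier G" for g
      using correlation_ge[OF \<Omega> f(2) that m[OF that]] f(3) by simp
    have m_bdd: "\<bar>m g\<bar> \<le> A + 2" for g
    proof -
      have "real (min (wl g) R) * ((A + 2) / real R) \<le> real R * ((A + 2) / real R)"
        using \<open>0 \<le> A\<close> by (intro mult_right_mono) auto
      then show ?thesis using R \<open>0 \<le> A\<close> by (simp add: m_def)
    qed
    have int_m: "integrable (measure_pmf \<phi>) (\<lambda>g. (m g)\<^sup>2)"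
    proof (rule measure_pmf.integrable_const_bound[where B = "(A + 2)\<^sup>2"])
      show "AE g in measure_pmf \<phi>. norm ((m g)\<^sup>2) \<le> (A + 2)\<^sup>2"
        using m_bdd \<open>0 \<le> A\<close> by (auto intro!: AE_I2 simp: abs_le_square_iff[symmetric])
    qed simp
    have f_le1: "f x \<le> 1" if "x \<in> carrier G" for x
    proof (cases "x \<in> \<Omega>")
      case True
      have "(f x)\<^sup>2 \<le> 1" using f(3) member_le_sum[of x \<Omega> "\<lambda>x. (f x)\<^sup>2"] \<Omega> True by auto
      then show ?thesis by (simp add: power_le_one_iff abs_square_le_1 abs_le_iff)
    qed (use f(2) that in auto)
    have int_q: "integrable (measure_pmf \<phi>) (\<lambda>y. \<Sum>x\<in>\<Omega>. f x * f (x \<otimes> y))"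
    proof (intro Bochner_Integration.integrable_sum integrable_mult_right)
      fix x assume x: "x \<in> \<Omega>"
      show "integrable (measure_pmf \<phi>) (\<lambda>y. f (x \<otimes> y))"
        using f_le1 f(1) x sub \<Omega>(2)
        by (intro measure_pmf.integrable_const_bound[where B = 1]) (auto simp: AE_measure_pmf_iff subset_iff)
    qed
    have "measure_pmf.expectation \<phi> (\<lambda>g. (m g)\<^sup>2)
        = ((A + 2) / real R)\<^sup>2 * measure_pmf.expectation \<phi> (\<lambda>g. real (min (wl g) R) ^ 2)"
    proof -
      have "(\<lambda>g. (m g)\<^sup>2) = (\<lambda>g. ((A + 2) / real R)\<^sup>2 * real (min (wl g) R) ^ 2)"
        by (rule ext) (simp only: m_def power_mult_distrib mult.commute)
      then show ?thesis by simp
    qed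
    also have "\<dots> \<le> ((A + 2) / real R)\<^sup>2 * (12 / (2 - \<alpha>) * real R powr (2 - \<alpha>))"
      using truncated_second_moment[OF \<alpha> sub \<phi>(2)] by (intro mult_left_mono) auto
    also have "real R powr (2 - \<alpha>) = real R ^ 2 * real R powr - \<alpha>"
      using R powr_add[of "real R" 2 "- \<alpha>"] by simp
    also have "((A + 2) / real R)\<^sup>2 * (12 / (2 - \<alpha>) * (real R ^ 2 * real R powr - \<alpha>)) = 2 * (1 - q)"
      using R by (simp add: q_def power_divide)
    finally have Em: "measure_pmf.expectation \<phi> (\<lambda>g. (m g)\<^sup>2) \<le> 2 * (1 - q)" .
    have "q \<le> measure_pmf.expectation \<phi> (\<lambda>g. 1 - (m g)\<^sup>2 / 2)"
      using Em int_m by simp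
    also have "\<dots> \<le> measure_pmf.expectation \<phi> (\<lambda>y. \<Sum>x\<in>\<Omega>. f x * f (x \<otimes> y))"
      using corr sub int_q int_m by (intro integral_mono_AE) (auto simp: AE_measure_pmf_iff subset_iff)
    also have "\<dots> = (\<Sum>x\<in>\<Omega>. \<Sum>z\<in>\<Omega>. f x * pmf \<phi> (inv x \<otimes> z) * f z)"
      using quadratic_form_eq_expectation[OF \<Omega> f(2) sub] by simp
    finally have "q ^ (2 * n) \<le> real (card \<Omega>) * pmf (conv_power G \<phi> (2 * n)) \<one>"
      using small by (intro return_probability_ge_rayleigh[OF \<phi>(1) \<Omega> f(1,3)]) (auto simp: q_def)
    then show "q ^ (2 * n) / real (card \<Omega>) \<le> pmf (conv_power G \<phi> (2 * n)) \<one>"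
      using card_pos by (simp add: field_simps)
  qed
  then show ?thesis using card_pos by (simp add: field_simps q_def)
qed

end

section \<open>Test functions on a finitely generated group\<close>

context group begin

lemma pmf_convolution_finite:
  assumes "finite Z" "set_pmf \<mu> \<subseteq> Z" "Z \<subseteq> carrier G" "set_pmf \<nu> \<subseteq> carrier G" "g \<in> carrier G"
  shows "pmf (convolution G \<mu> \<nu>) g = (\<Sum>z\<in>Z. pmf \<mu> z * pmf \<nu> (inv z \<otimes> g))"
proof -
  have eq: "pmf (map_pmf ((\<otimes>) z) \<nu>) g = pmf \<nu> (inv z \<otimes> g)" if z: "z \<in> carrier G" for z
  proof -
    have "pmf (map_pmf ((\<otimes>) z) \<nu>) g = measure_pmf.prob \<nu> ((\<otimes>) z -` {g})" by (simp add: pmf_map)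
    also have "\<dots> = measure_pmf.prob \<nu> {inv z \<otimes> g}"
    proof (rule measure_pmf.finite_measure_eq_AE)
      show "AE x in measure_pmf \<nu>. (x \<in> (\<otimes>) z -` {g}) = (x \<in> {inv z \<otimes> g})"
      proof (rule AE_pmfI)
        fix x assume "x \<in> set_pmf \<nu>"
        then have x: "x \<in> carrier G" using assms by auto
        have "z \<otimes> (inv z \<otimes> g) = g" "inv z \<otimes> (z \<otimes> x) = x"
          using z x assms(5) by (simp_all add: m_assoc[symmetric])
        then show "(x \<in> (\<otimes>) z -` {g}) = (x \<in> {inv z \<otimes> g})" by auto
      qed
    qed auto
    finally show ?thesis by (simp add: measure_pmf_single)
  qed
  have "pmf (convolution G \<mu> \<nu>) g = measure_pmf.expectation \<mu> (\<lambda>x. pmf (map_pmf ((\<otimes>) x) \<nu>) g)"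
    by (simp add: convolution_bind pmf_bind map_pmf_def)
  also have "\<dots> = (\<Sum>z\<in>Z. pmf (map_pmf ((\<otimes>) z) \<nu>) g * pmf \<mu> z)"
    using assms by (intro integral_measure_pmf_real) auto
  also have "\<dots> = (\<Sum>z\<in>Z. pmf \<mu> z * pmf \<nu> (inv z \<otimes> g))"
    using assms eq by (intro sum.cong refl) (auto simp: mult.commute subset_iff)
  finally show ?thesis .
qed

lemma finite_set_pmf_conv_power:
  "finite (set_pmf \<mu>) \<Longrightarrow> finite (set_pmf (conv_power G \<mu> n))"
  by (induction n) (auto simp: conv_power_0 conv_power_Suc convolution_bind)

text \<open>
  For a symmetric measure the correlation of \<open>p = \<phi>^(m)\<close> with its translate by \<open>g\<close> equals \<open>\<phi>^(2m)\<close> at \<open>g\<close>, so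
  the energy of a translation is a difference of two values of \<open>\<phi>^(2m)\<close>. Taking \<open>Z\<close> empty shows that these values
  are largest at the identity.
\<close>

lemma shift_energy_conv_power:
  assumes sym: "symmetric_probability G \<phi>" and fin: "finite (set_pmf \<phi>)"
    and g: "g \<in> carrier G" and Z: "finite Z" "Z \<subseteq> carrier G"
  shows "(\<Sum>x\<in>Z. (pmf (conv_power G \<phi> m) x - pmf (conv_power G \<phi> m) (x \<otimes> g))\<^sup>2)
    \<le> 2 * (pmf (conv_power G \<phi> (2 * m)) \<one> - pmf (conv_power G \<phi> (2 * m)) g)"
proof -
  define p where "p = pmf (conv_power G \<phi> m)"
  have sub: "set_pmf \<phi> \<subseteq> carrier G" using sym by (simp add: symmetric_probability_def)
  have p_inv: "p (inv x) = p x" if "x \<in> carrier G" for x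
    using symmetric_conv_power[OF sym, of m] that by (simp add: symmetric_probability_def p_def)
  define W where "W = set_pmf (conv_power G \<phi> m)"
  have W: "finite W" "W \<subseteq> carrier G"
    using finite_set_pmf_conv_power[OF fin] set_pmf_conv_power[OF sub] by (auto simp: W_def)
  have p_0: "p x = 0" if "x \<notin> W" for x using that by (simp add: p_def W_def set_pmf_iff)
  have inv_W: "m_inv G ` W = W"
  proof -
    have "inv x \<in> W" if "x \<in> W" for x
      using that p_inv[of x] W(2) by (auto simp: W_def set_pmf_iff p_def)
    then show ?thesis using W(2) by (force simp: image_iff subset_iff)
  qed
  have conv: "pmf (conv_power G \<phi> (2 * m)) h = (\<Sum>x\<in>W. p x * p (x \<otimes> h))" if h: "h \<in> carrier G" for h
  proof -
    have "pmf (conv_power G \<phi> (2 * m)) h = pmf (convolution G (conv_power G \<phi> m) (conv_power G \<phi> m)) h"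
      using conv_power_add[OF sub, of m m] by (simp add: mult_2)
    also have "\<dots> = (\<Sum>x\<in>m_inv G ` W. p x * p (inv x \<otimes> h))"
      unfolding p_def inv_W using W h by (intro pmf_convolution_finite) (auto simp: W_def)
    also have "\<dots> = (\<Sum>x\<in>W. p (inv x) * p (inv (inv x) \<otimes> h))"
      by (subst sum.reindex[OF inj_on_subset[OF inj_on_inv W(2)]]) simp
    also have "\<dots> = (\<Sum>x\<in>W. p x * p (x \<otimes> h))"
      using W p_inv by (intro sum.cong refl) (auto simp: subset_iff)
    finally show ?thesis .
  qed
  have norm: "pmf (conv_power G \<phi> (2 * m)) \<one> = (\<Sum>x\<in>W. (p x)\<^sup>2)"
    unfolding conv[OF one_closed] using W(2) by (intro sum.cong refl) (auto simp: power2_eq_square subset_iff)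
  have le: "(\<Sum>x\<in>X. (p x)\<^sup>2) \<le> pmf (conv_power G \<phi> (2 * m)) \<one>" if "finite X" for X
  proof -
    have "(\<Sum>x\<in>X. (p x)\<^sup>2) = (\<Sum>x\<in>X \<inter> W. (p x)\<^sup>2)"
      using that p_0 by (intro sum.mono_neutral_right) auto
    also have "\<dots> \<le> (\<Sum>x\<in>W. (p x)\<^sup>2)" using W by (intro sum_mono2) auto
    finally show ?thesis using norm by simp
  qed
  define X where "X = Z \<union> W"
  have X: "finite X" "X \<subseteq> carrier G" using Z W by (auto simp: X_def)
  have "(\<Sum>x\<in>Z. (p x - p (x \<otimes> g))\<^sup>2) \<le> (\<Sum>x\<in>X. (p x - p (x \<otimes> g))\<^sup>2)"
    using X by (intro sum_mono2) (auto simp: X_def)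
  also have "\<dots> = (\<Sum>x\<in>X. (p x)\<^sup>2) + (\<Sum>x\<in>X. (p (x \<otimes> g))\<^sup>2) - 2 * (\<Sum>x\<in>X. p x * p (x \<otimes> g))"
    by (simp add: power2_diff sum.distrib sum_subtractf sum_distrib_left mult.assoc)
  also have "(\<Sum>x\<in>X. p x * p (x \<otimes> g)) = (\<Sum>x\<in>W. p x * p (x \<otimes> g))"
    using X p_0 by (intro sum.mono_neutral_right) (auto simp: X_def)
  also have "\<dots> = pmf (conv_power G \<phi> (2 * m)) g" using conv[OF g] by simp
  also have "(\<Sum>x\<in>X. (p (x \<otimes> g))\<^sup>2) = (\<Sum>x\<in>(\<lambda>x. x \<otimes> g) ` X. (p x)\<^sup>2)"
    by (simp add: sum.reindex[OF inj_on_mult_right[OF g X(2)]])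
  finally show ?thesis using le[of X] le[of "(\<lambda>x. x \<otimes> g) ` X"] X unfolding p_def by simp
qed

lemma shift_le_scale: "shift_le f y a \<Longrightarrow> 0 \<le> c \<Longrightarrow> shift_le (\<lambda>x. f x * c) y (a * c)"
  unfolding shift_le_def by (auto simp: left_diff_distrib[symmetric] L2_set_left_distrib[symmetric] intro!: mult_right_mono)

end

context fg_group
begin

text \<open>
  In the terms of spectral geometry: there is a set of at most \<open>c\<close> elements whose Dirichlet eigenvalue for the
  generators is at most of order \<open>b\<^sup>2\<close>.
\<close>

definition has_test_function :: "real \<Rightarrow> real \<Rightarrow> bool" where
  "has_test_function b c \<longleftrightarrow> (\<exists>\<Omega> f. finite \<Omega> \<and> \<Omega> \<subseteq> carrier G \<and> (\<forall>x. 0 \<le> f x)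
    \<and> (\<forall>x\<in>carrier G - \<Omega>. f x = 0) \<and> (\<Sum>x\<in>\<Omega>. (f x)\<^sup>2) = 1
    \<and> (\<forall>s\<in>S. shift_le f s b) \<and> real (card \<Omega>) \<le> c)"

lemma has_test_functionI:
  assumes "finite \<Omega>" "\<Omega> \<subseteq> carrier G" "\<And>x. 0 \<le> f x" "\<And>x. x \<in> carrier G - \<Omega> \<Longrightarrow> f x = 0"
    and "0 < v" "v \<le> (\<Sum>x\<in>\<Omega>. (f x)\<^sup>2)" "\<And>s. s \<in> S \<Longrightarrow> shift_le f s a" "a \<le> b * sqrt v" "0 \<le> b"
    and "real (card \<Omega>) \<le> c"
  shows "has_test_function b c"
proof -
  define N where "N = (\<Sum>x\<in>\<Omega>. (f x)\<^sup>2)"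
  have N: "N > 0" "v \<le> N" using assms by (auto simp: N_def)
  define g where "g x = f x * (1 / sqrt N)" for x
  have "(\<Sum>x\<in>\<Omega>. (g x)\<^sup>2) = N * (1 / sqrt N)\<^sup>2"
    by (simp only: g_def power_mult_distrib N_def sum_distrib_right)
  then have 1: "(\<Sum>x\<in>\<Omega>. (g x)\<^sup>2) = 1" using N by (simp add: power_divide)
  have 2: "shift_le g s b" if "s \<in> S" for s
  proof (rule shift_le_mono)
    show "shift_le g s (a * (1 / sqrt N))"
      unfolding g_def using N assms(7)[OF that] by (intro shift_le_scale) auto
    have "a \<le> b * sqrt N" using assms(8) mult_left_mono[OF real_sqrt_le_mono[OF N(2)] assms(9)] by linarith
    then show "a * (1 / sqrt N) \<le> b" using N by (simp add: field_simps)
  qed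
  show ?thesis
    unfolding has_test_function_def
    by (rule exI[of _ \<Omega>], rule exI[of _ g]) (use 1 2 assms(1-4,10) N in \<open>auto simp: g_def\<close>)
qed

lemma has_test_functionE:
  assumes "has_test_function b c"
  obtains \<Omega> f where "finite \<Omega>" "\<Omega> \<subseteq> carrier G" "\<And>x. 0 \<le> f x" "\<And>x. x \<in> carrier G - \<Omega> \<Longrightarrow> f x = 0"
    "(\<Sum>x\<in>\<Omega>. (f x)\<^sup>2) = 1" "\<And>s. s \<in> S \<Longrightarrow> shift_le f s b" "real (card \<Omega>) \<le> c"
proof -
  obtain \<Omega> f where *: "finite \<Omega> \<and> \<Omega> \<subseteq> carrier G \<and> (\<forall>x. 0 \<le> f x)
    \<and> (\<forall>x\<in>carrier G - \<Omega>. f x = 0) \<and> (\<Sum>x\<in>\<Omega>. (f x)\<^sup>2) = 1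
    \<and> (\<forall>s\<in>S. shift_le f s b) \<and> real (card \<Omega>) \<le> c"
    using assms unfolding has_test_function_def by (elim exE)
  show thesis by (rule that[of \<Omega> f]) (use * in blast)+
qed

lemma has_test_function_mono:
  assumes "has_test_function b c" "b \<le> b'" "c \<le> c'" shows "has_test_function b' c'"
proof -
  obtain \<Omega> f where *: "finite \<Omega>" "\<Omega> \<subseteq> carrier G" "\<And>x. 0 \<le> f x" "\<And>x. x \<in> carrier G - \<Omega> \<Longrightarrow> f x = 0"
    "(\<Sum>x\<in>\<Omega>. (f x)\<^sup>2) = 1" "\<And>s. s \<in> S \<Longrightarrow> shift_le f s b" "real (card \<Omega>) \<le> c"
    by (rule has_test_functionE[OF assms(1)]) (rule that)
  have "\<And>s. s \<in> S \<Longrightarrow> shift_le f s b'" using *(6) assms(2) by (rule shift_le_mono)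
  moreover have "real (card \<Omega>) \<le> c'" using *(7) assms(3) by (rule order_trans)
  ultimately show ?thesis using *(1-5) unfolding has_test_function_def by (intro exI[of _ \<Omega>] exI[of _ f]) simp
qed

text \<open>
  At scale \<open>R\<close> the gradient is of order \<open>1 / R\<close> and the support has logarithmic size of order \<open>w R\<close>. One
  constant for both keeps the bookkeeping small.
\<close>

definition test_profile :: "(nat \<Rightarrow> real) \<Rightarrow> real \<Rightarrow> bool" where
  "test_profile w A \<longleftrightarrow> 0 \<le> A \<and> (\<forall>R\<ge>1. has_test_function (A / real R) (exp (A * w R)))"

lemma test_profileI:
  "0 \<le> A \<Longrightarrow> (\<And>R. R \<ge> 1 \<Longrightarrow> has_test_function (A / real R) (exp (A * w R))) \<Longrightarrow> test_profile w A"
  by (simp add: test_profile_def)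

lemma test_profileD: "test_profile w A \<Longrightarrow> R \<ge> 1 \<Longrightarrow> has_test_function (A / real R) (exp (A * w R))"
  by (simp add: test_profile_def)

lemma test_profile_finite:
  assumes "finite (carrier G)"
  shows "\<exists>A. test_profile (\<lambda>_. 1) A"
proof
  have c: "real (card (carrier G)) \<ge> 1"
    using assms one_closed by (metis One_nat_def Suc_leI card_gt_0_iff empty_iff of_nat_1 of_nat_le_iff)
  show "test_profile (\<lambda>_. 1) (ln (real (card (carrier G))))"
  proof (rule test_profileI)
    fix R :: nat
    show "has_test_function (ln (real (card (carrier G))) / real R) (exp (ln (real (card (carrier G))) * 1))"
      by (rule has_test_functionI[where \<Omega> = "carrier G" and f = "\<lambda>_. 1" and v = 1 and a = 0])
        (use c assms in \<open>auto simp: shift_le_def L2_set_def\<close>)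
  qed (use c in auto)
qed

text \<open>
  Truncated subtraction makes this vanish outside the ball.
\<close>

definition tent :: "nat \<Rightarrow> 'g \<Rightarrow> real" where "tent R x = real (R - wl x)"

lemma tent_outside: "x \<in> carrier G - wball R \<Longrightarrow> tent R x = 0"
  by (auto simp: tent_def wball_def)

lemma tent_diff_sq:
  assumes "x \<in> carrier G" "s \<in> S"
  shows "(tent R x - tent R (x \<otimes> s))\<^sup>2 \<le> indicator (wball R) x"
proof -
  have s: "s \<in> carrier G" using assms S_sub by auto
  have 1: "wl (x \<otimes> s) \<le> wl x + 1" using wl_mult[OF assms(1) s] wl_S[OF assms(2)] by simp
  have "wl ((x \<otimes> s) \<otimes> inv s) \<le> wl (x \<otimes> s) + wl (inv s)" using assms s by (intro wl_mult) auto
  then have 2: "wl x \<le> wl (x \<otimes> s) + 1" using wl_inv[OF s] wl_S[OF assms(2)] assms s by (simp add: m_assoc)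
  show ?thesis
  proof (cases "x \<in> wball R")
    case True
    have "\<bar>tent R x - tent R (x \<otimes> s)\<bar> \<le> 1" using 1 2 unfolding tent_def by linarith
    then show ?thesis using True by (simp add: abs_square_le_1)
  next
    case False
    then have "wl x > R" using assms by (simp add: wball_def)
    then show ?thesis using False 2 by (simp add: tent_def)
  qed
qed

lemma tent_shift:
  assumes "s \<in> S" shows "shift_le (tent R) s (sqrt (volume G S R))"
  unfolding shift_le_def L2_set_def
proof (intro allI impI real_sqrt_le_mono)
  fix Z assume Z: "finite Z" "Z \<subseteq> carrier G"
  have "(\<Sum>x\<in>Z. (tent R x - tent R (x \<otimes> s))\<^sup>2) \<le> (\<Sum>x\<in>Z. indicator (wball R) x)"
    using Z assms by (intro sum_mono tent_diff_sq) auto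
  also have "\<dots> = real (card (Z \<inter> wball R))" using Z by (simp add: indicator_def sum.If_cases Int_def)
  also have "\<dots> \<le> real (card (wball R))" by (intro of_nat_mono card_mono) auto
  finally show "(\<Sum>x\<in>Z. (tent R x - tent R (x \<otimes> s))\<^sup>2) \<le> volume G S R" by (simp add: volume_eq)
qed

text \<open>
  The radius one is separate because \<open>1 div 2 = 0\<close>; from radius two on, \<open>R \<le> 3 * (R div 2)\<close>.
\<close>

lemma volume_doubling:
  assumes "polynomial_growth G S d"
  shows "\<exists>\<kappa>>0. \<forall>R\<ge>1. \<kappa> * volume G S R \<le> volume G S (R div 2)"
proof -
  obtain c C where c: "c > 0" "C > 0" and
    *: "\<And>r. r \<ge> 1 \<Longrightarrow> c * real r ^ d \<le> volume G S r \<and> volume G S r \<le> C * real r ^ d"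
    using polynomial_growth_bounds[OF assms] by blast
  define \<kappa> where "\<kappa> = min (c / (C * 3 ^ d)) (1 / C)"
  have "\<kappa> > 0" using c by (simp add: \<kappa>_def)
  moreover have "\<kappa> * volume G S R \<le> volume G S (R div 2)" if R: "R \<ge> 1" for R
  proof (cases "R = 1")
    case True
    have "\<kappa> * volume G S 1 \<le> (1 / C) * (C * real 1 ^ d)"
      using *[of 1] c volume_ge_1[of 1] by (intro mult_mono) (auto simp: \<kappa>_def)
    also have "\<dots> \<le> volume G S (R div 2)" using c volume_ge_1 by simp
    finally show ?thesis using True by simp
  next
    case False
    have "\<kappa> * volume G S R \<le> c / (C * 3 ^ d) * (C * real R ^ d)"
      using *[OF R] c volume_ge_1[of R] by (intro mult_mono) (auto simp: \<kappa>_def)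
    also have "\<dots> = c * (real R / 3) ^ d" using c by (simp add: power_divide)
    also have "\<dots> \<le> c * real (R div 2) ^ d"
    proof -
      have "R \<le> 3 * (R div 2)" using False R by presburger
      then show ?thesis using c by (intro mult_left_mono power_mono) auto
    qed
    also have "\<dots> \<le> volume G S (R div 2)" using *[of "R div 2"] False R by auto
    finally show ?thesis .
  qed
  ultimately show ?thesis by blast
qed

text \<open>
  On the ball of half the radius the tent is at least \<open>R / 2\<close>, and by doubling that ball carries a fixed
  fraction of the volume.
\<close>

lemma tent_mass:
  assumes "polynomial_growth G S d"
  shows "\<exists>c>0. \<forall>R\<ge>1. c * real R ^ 2 * volume G S R \<le> (\<Sum>x\<in>wball R. (tent R x)\<^sup>2)"
proof -
  obtain \<kappa> where \<kappa>: "\<kappa> > 0" "\<And>R. R \<ge> 1 \<Longrightarrow> \<kappa> * volume G S R \<le> volume G S (R div 2)"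
    using volume_doubling[OF assms] by blast
  have "\<kappa> / 4 * real R ^ 2 * volume G S R \<le> (\<Sum>x\<in>wball R. (tent R x)\<^sup>2)" if R: "R \<ge> 1" for R
  proof -
    have "\<kappa> / 4 * real R ^ 2 * volume G S R = (real R / 2) ^ 2 * (\<kappa> * volume G S R)"
      by (simp add: power_divide)
    also have "\<dots> \<le> (real R / 2) ^ 2 * volume G S (R div 2)"
      using \<kappa>(2)[OF R] by (intro mult_left_mono) auto
    also have "\<dots> = (\<Sum>x\<in>wball (R div 2). (real R / 2) ^ 2)" by (simp add: volume_eq)
    also have "\<dots> \<le> (\<Sum>x\<in>wball (R div 2). (tent R x)\<^sup>2)"
    proof (intro sum_mono power_mono)
      fix x assume "x \<in> wball (R div 2)"
      then have "wl x \<le> R div 2" by (simp add: wball_def)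
      then have "R \<le> 2 * (R - wl x)" by linarith
      then show "real R / 2 \<le> tent R x" unfolding tent_def by linarith
    qed simp
    also have "\<dots> \<le> (\<Sum>x\<in>wball R. (tent R x)\<^sup>2)"
      using wball_mono[of "R div 2" R] by (intro sum_mono2) auto
    finally show ?thesis .
  qed
  then show ?thesis using \<kappa>(1) by (intro exI[of _ "\<kappa> / 4"]) auto
qed

text \<open>
  The tent changes by at most one per step and only inside the ball, so its gradient energy is at most the
  volume, against a mass of order \<open>R\<^sup>2\<close> times the volume.
\<close>

lemma test_profile_polynomial_growth:
  assumes "polynomial_growth G S d"
  shows "\<exists>A. test_profile (\<lambda>r. ln (1 + real r)) A"
proof -
  obtain c where c: "c > 0" "\<And>R. R \<ge> 1 \<Longrightarrow> c * real R ^ 2 * volume G S R \<le> (\<Sum>x\<in>wball R. (tent R x)\<^sup>2)"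
    using tent_mass[OF assms] by blast
  obtain C where C: "C > 0" "\<And>r. r \<ge> 1 \<Longrightarrow> volume G S r \<le> C * real r ^ d"
    using polynomial_growth_bounds[OF assms] by blast
  define A where "A = max (1 / sqrt c) (real d + \<bar>ln C\<bar> / ln 2)"
  have A: "A \<ge> 0" "A \<ge> 1 / sqrt c" "A \<ge> real d + \<bar>ln C\<bar> / ln 2" using c(1) by (auto simp: A_def le_max_iff_disj)
  have "test_profile (\<lambda>r. ln (1 + real r)) A"
  proof (rule test_profileI[OF A(1)])
    fix R :: nat assume R: "R \<ge> 1"
    let ?v = "c * real R ^ 2 * volume G S R"
    have V: "volume G S R \<ge> 1" by (rule volume_ge_1)
    have "sqrt ?v = sqrt c * real R * sqrt (volume G S R)" by (simp add: real_sqrt_mult)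
    then have "sqrt (volume G S R) = 1 / sqrt c / real R * sqrt ?v" using c R by simp
    also have "\<dots> \<le> A / real R * sqrt ?v" using A R c V by (intro mult_right_mono divide_right_mono) auto
    finally have 1: "sqrt (volume G S R) \<le> A / real R * sqrt ?v" .
    have "real (card (wball R)) \<le> C * real R ^ d" using C(2)[OF R] by (simp add: volume_eq)
    also have "\<dots> = exp (ln C + real d * ln (real R))"
      using C R by (simp add: exp_add exp_of_nat_mult)
    also have "\<dots> \<le> exp (A * ln (1 + real R))"
    proof -
      have "ln 2 \<le> ln (1 + real R)" using R by simp
      then have "ln C \<le> \<bar>ln C\<bar> / ln 2 * ln (1 + real R)"
        using mult_left_mono[of "ln 2" "ln (1 + real R)" "\<bar>ln C\<bar> / ln 2"] by simp
      moreover have "real d * ln (real R) \<le> real d * ln (1 + real R)" using R by (intro mult_left_mono) auto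
      ultimately have "ln C + real d * ln (real R) \<le> (real d + \<bar>ln C\<bar> / ln 2) * ln (1 + real R)"
        by (simp add: algebra_simps)
      also have "\<dots> \<le> A * ln (1 + real R)" using A R by (intro mult_right_mono) auto
      finally show ?thesis by simp
    qed
    finally have 2: "real (card (wball R)) \<le> exp (A * ln (1 + real R))" .
    have "0 < ?v" using c(1) R V by simp
    then show "has_test_function (A / real R) (exp (A * ln (1 + real R)))"
      using 1 2 c(2)[OF R] A(1) tent_outside tent_shift wball_carrier
      by (intro has_test_functionI[of "wball R" "tent R" ?v "sqrt (volume G S R)"]) (auto simp: tent_def)
  qed
  then show ?thesis ..
qed

lemma pmf_uniform_S: "s \<in> S \<Longrightarrow> pmf (pmf_of_set S) s = 1 / real (card S)"
  using finite_S one_in_S by (subst pmf_of_set) auto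

lemma set_pmf_uniform_S: "set_pmf (pmf_of_set S) = S"
  using finite_S one_in_S by (intro set_pmf_of_set) auto

lemma symmetric_uniform_S: "symmetric_probability G (pmf_of_set S)"
  unfolding symmetric_probability_def set_pmf_uniform_S
proof (intro conjI ballI S_sub)
  fix g assume "g \<in> carrier G"
  then have "inv g \<in> S \<longleftrightarrow> g \<in> S" using inv_in_S[of g] inv_in_S[of "inv g"] by auto
  then show "pmf (pmf_of_set S) (inv g) = pmf (pmf_of_set S) g"
    using finite_S one_in_S by (subst (1 2) pmf_of_set) (auto simp: indicator_def)
qed

text \<open>
  The drop of the return probability over two steps is the average over the two-step measure of
  \<open>p\<^sub>2\<^sub>m(\<one>) - p\<^sub>2\<^sub>m(g)\<close>. Each term is nonnegative, and since the generating set contains the identity, every generator \<open>s\<close> carries at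
  least the mass \<open>1 / (card S)\<^sup>2\<close> there; so the drop controls the energy of translation by \<open>s\<close>.
\<close>

lemma shift_le_conv_power:
  assumes s: "s \<in> S"
  shows "shift_le (pmf (conv_power G (pmf_of_set S) m)) s
    (sqrt (2 * real (card S) ^ 2 * (Phi G S (2 * m) - Phi G S (2 * m + 2))))"
proof -
  let ?u = "pmf_of_set S"
  let ?p = "\<lambda>n. pmf (conv_power G ?u n)"
  note sym = symmetric_uniform_S
  have sub: "set_pmf ?u \<subseteq> carrier G" using set_pmf_uniform_S S_sub by simp
  have fin: "finite (set_pmf ?u)" using set_pmf_uniform_S finite_S by simp
  have sc: "s \<in> carrier G" using s S_sub by auto
  have cS: "real (card S) > 0" using finite_S one_in_S by (auto simp: card_gt_0_iff)
  have max_one: "?p (2 * m) g \<le> ?p (2 * m) \<one>" if "g \<in> carrier G" for g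
    using shift_energy_conv_power[OF sym fin that, of "{}" m] by simp
  let ?W = "set_pmf (conv_power G ?u 2)"
  have W: "finite ?W" "?W \<subseteq> carrier G"
    using finite_set_pmf_conv_power[OF fin] set_pmf_conv_power[OF sub] by auto
  have u2: "conv_power G ?u 2 = convolution G ?u ?u"
    using convolution_one(1)[OF sub] by (simp add: numeral_2_eq_2 conv_power_Suc conv_power_0)
  have ge: "1 / real (card S) ^ 2 \<le> ?p 2 s"
    using convolution_ge_partial_sum[of "{\<one>}" \<one> s ?u ?u] sc pmf_uniform_S[OF s] pmf_uniform_S[OF one_in_S]
    by (simp add: u2 power2_eq_square)
  then have "?p 2 s > 0" using cS by (smt (verit) divide_pos_pos zero_less_power)
  then have sW: "s \<in> ?W" by (simp add: set_pmf_iff)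
  have "Phi G S (2 * m + 2) = pmf (convolution G (conv_power G ?u 2) (conv_power G ?u (2 * m))) \<one>"
    using conv_power_add[OF sub, of 2 "2 * m"] by (simp add: Phi_def add.commute)
  also have "\<dots> = (\<Sum>g\<in>?W. ?p 2 g * ?p (2 * m) (inv g \<otimes> \<one>))"
    using W set_pmf_conv_power[OF sub] by (intro pmf_convolution_finite) auto
  also have "\<dots> = (\<Sum>g\<in>?W. ?p 2 g * ?p (2 * m) g)"
    using W symmetric_conv_power[OF sym, of "2 * m"]
    by (intro sum.cong refl) (auto simp: symmetric_probability_def subset_iff)
  finally have "Phi G S (2 * m) - Phi G S (2 * m + 2) = (\<Sum>g\<in>?W. ?p 2 g) * ?p (2 * m) \<one> - (\<Sum>g\<in>?W. ?p 2 g * ?p (2 * m) g)"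
    using sum_pmf_eq_1[OF W(1), of "conv_power G ?u 2"] by (simp add: Phi_def)
  also have "\<dots> = (\<Sum>g\<in>?W. ?p 2 g * (?p (2 * m) \<one> - ?p (2 * m) g))"
    by (simp add: sum_distrib_right right_diff_distrib sum_subtractf)
  also have "\<dots> \<ge> ?p 2 s * (?p (2 * m) \<one> - ?p (2 * m) s)"
    using max_one W by (intro member_le_sum[OF sW]) auto
  finally have "?p 2 s * (?p (2 * m) \<one> - ?p (2 * m) s) \<le> Phi G S (2 * m) - Phi G S (2 * m + 2)" .
  moreover have "1 / real (card S) ^ 2 * (?p (2 * m) \<one> - ?p (2 * m) s) \<le> ?p 2 s * (?p (2 * m) \<one> - ?p (2 * m) s)"
    using ge max_one[OF sc] by (intro mult_right_mono) auto
  ultimately have "1 / real (card S) ^ 2 * (?p (2 * m) \<one> - ?p (2 * m) s) \<le> Phi G S (2 * m) - Phi G S (2 * m + 2)"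
    by linarith
  then have *: "?p (2 * m) \<one> - ?p (2 * m) s \<le> real (card S) ^ 2 * (Phi G S (2 * m) - Phi G S (2 * m + 2))"
    using cS by (simp add: field_simps)
  show ?thesis
    unfolding shift_le_def L2_set_def
  proof (intro allI impI real_sqrt_le_mono)
    fix Z assume "finite Z" "Z \<subseteq> carrier G"
    from shift_energy_conv_power[OF sym fin sc this, of m] *
    show "(\<Sum>x\<in>Z. (?p m x - ?p m (x \<otimes> s))\<^sup>2) \<le> 2 * real (card S) ^ 2 * (Phi G S (2 * m) - Phi G S (2 * m + 2))"
      by simp
  qed
qed

text \<open>
  Below the threshold the test function of the threshold radius still works after enlarging the constant.
\<close>

lemma test_profile_from_large_radii:
  assumes "A \<ge> 0" "R0 \<ge> 1" "\<And>R. R \<ge> R0 \<Longrightarrow> has_test_function (A / real R) (exp (A * real R))"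
  shows "test_profile real (A * real R0)"
proof (rule test_profileI)
  fix R :: nat assume R: "R \<ge> 1"
  have le: "max R R0 \<le> R * R0" using R assms(2) by auto
  have "A / real (max R R0) \<le> A * real R0 / real R"
  proof (rule frac_le)
    show "A \<le> A * real R0" using assms by (simp add: mult_left_mono[of 1 "real R0" A, simplified])
  qed (use R assms in auto)
  moreover have "exp (A * real (max R R0)) \<le> exp (A * real R0 * real R)"
  proof -
    have "real (max R R0) \<le> real R0 * real R" using le by (metis of_nat_le_iff of_nat_mult mult.commute)
    from mult_left_mono[OF this assms(1)] show ?thesis by (simp add: mult.assoc)
  qed
  ultimately show "has_test_function (A * real R0 / real R) (exp (A * real R0 * real R))"
    by (rule has_test_function_mono[OF assms(3)[OF max.cobounded2]])
qed (use assms in simp)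

text \<open>
  A convolution power has total mass one and squared norm \<open>v\<close>. Cutting it at height \<open>v / 4\<close> leaves at most
  \<open>4 / v\<close> points, costs at most half of the squared norm since \<open>(p - t)\<^sup>2 \<ge> p\<^sup>2 - 2 t p\<close>, and does not increase
  translation distances because the truncation is a contraction.
\<close>

lemma truncated_conv_power:
  fixes m :: nat
  defines "p \<equiv> pmf (conv_power G (pmf_of_set S) m)" and "v \<equiv> Phi G S (2 * m)"
  assumes v: "v > 0"
  shows "\<exists>\<Omega> f. finite \<Omega> \<and> \<Omega> \<subseteq> carrier G \<and> (\<forall>x. 0 \<le> f x) \<and> (\<forall>x\<in>carrier G - \<Omega>. f x = 0)
    \<and> v / 2 \<le> (\<Sum>x\<in>\<Omega>. (f x)\<^sup>2) \<and> (\<forall>s a. shift_le p s a \<longrightarrow> shift_le f s a) \<and> real (card \<Omega>) \<le> 4 / v"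
proof -
  define W where "W = set_pmf (conv_power G (pmf_of_set S) m)"
  have sub: "set_pmf (pmf_of_set S) \<subseteq> carrier G" using set_pmf_uniform_S S_sub by simp
  have W: "finite W" "W \<subseteq> carrier G"
    using finite_set_pmf_conv_power[of "pmf_of_set S" m] set_pmf_conv_power[OF sub, of m]
    by (simp_all add: W_def set_pmf_uniform_S finite_S)
  have sum1: "(\<Sum>x\<in>W. p x) = 1" unfolding p_def using W by (intro sum_pmf_eq_1) (auto simp: W_def)
  have p0: "p x = 0" if "x \<notin> W" for x using that by (simp add: W_def p_def set_pmf_iff)
  have pos: "0 \<le> p x" for x by (simp add: p_def)
  have "v = pmf (convolution G (conv_power G (pmf_of_set S) m) (conv_power G (pmf_of_set S) m)) \<one>"
    using conv_power_add[OF sub, of m m] by (simp add: v_def Phi_def mult_2)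
  also have "\<dots> = (\<Sum>x\<in>W. p x * p (inv x \<otimes> \<one>))"
    unfolding p_def using W by (intro pmf_convolution_finite) (auto simp: W_def)
  also have "\<dots> = (\<Sum>x\<in>W. (p x)\<^sup>2)"
    using W symmetric_conv_power[OF symmetric_uniform_S, of m]
    by (intro sum.cong refl) (auto simp: symmetric_probability_def subset_iff power2_eq_square p_def)
  finally have norm: "v = (\<Sum>x\<in>W. (p x)\<^sup>2)" .
  define t where "t = v / 4"
  define f where "f x = max 0 (p x - t)" for x
  define \<Omega> where "\<Omega> = {x \<in> W. p x > t}"
  have t: "t > 0" using v by (simp add: t_def)
  have "finite \<Omega>" "\<Omega> \<subseteq> carrier G" using W by (auto simp: \<Omega>_def)
  moreover have "f x = 0" if "x \<notin> \<Omega>" for x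
    using that p0[of x] t by (cases "x \<in> W") (auto simp: f_def \<Omega>_def)
  moreover have "v / 2 \<le> (\<Sum>x\<in>\<Omega>. (f x)\<^sup>2)"
  proof -
    have "(p x)\<^sup>2 - 2 * t * p x \<le> (f x)\<^sup>2" for x
    proof (cases "p x > t")
      case True
      then show ?thesis by (simp add: f_def power2_diff)
    next
      case False
      then have "p x * p x \<le> 2 * t * p x" using pos t by (intro mult_right_mono) auto
      then show ?thesis using False by (simp add: f_def power2_eq_square)
    qed
    then have "(\<Sum>x\<in>W. (p x)\<^sup>2 - 2 * t * p x) \<le> (\<Sum>x\<in>W. (f x)\<^sup>2)" by (intro sum_mono) auto
    also have "\<dots> = (\<Sum>x\<in>\<Omega>. (f x)\<^sup>2)"
      using W by (intro sum.mono_neutral_right) (auto simp: \<Omega>_def f_def)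
    finally have "(\<Sum>x\<in>W. (p x)\<^sup>2) - 2 * t * (\<Sum>x\<in>W. p x) \<le> (\<Sum>x\<in>\<Omega>. (f x)\<^sup>2)"
      by (simp add: sum_subtractf sum_distrib_left)
    then show ?thesis unfolding norm[symmetric] sum1 by (simp add: t_def)
  qed
  moreover have "shift_le f s a" if "shift_le p s a" for s a
    unfolding shift_le_def
  proof (intro allI impI)
    fix Z assume Z: "finite Z" "Z \<subseteq> carrier G"
    have "L2_set (\<lambda>x. f x - f (x \<otimes> s)) Z = L2_set (\<lambda>x. \<bar>f x - f (x \<otimes> s)\<bar>) Z" by (simp add: L2_set_def)
    also have "\<dots> \<le> L2_set (\<lambda>x. \<bar>p x - p (x \<otimes> s)\<bar>) Z" by (intro L2_set_mono) (auto simp: f_def)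
    also have "\<dots> = L2_set (\<lambda>x. p x - p (x \<otimes> s)) Z" by (simp add: L2_set_def)
    also have "\<dots> \<le> a" using shift_leD[OF that Z] .
    finally show "L2_set (\<lambda>x. f x - f (x \<otimes> s)) Z \<le> a" .
  qed
  moreover have "real (card \<Omega>) \<le> 4 / v"
  proof -
    have "real (card \<Omega>) * t = (\<Sum>x\<in>\<Omega>. t)" by simp
    also have "\<dots> \<le> (\<Sum>x\<in>\<Omega>. p x)" by (intro sum_mono) (auto simp: \<Omega>_def)
    also have "\<dots> \<le> (\<Sum>x\<in>W. p x)" using W pos by (intro sum_mono2) (auto simp: \<Omega>_def)
    finally show ?thesis using v sum1 by (simp add: t_def field_simps)
  qed
  moreover have "0 \<le> f x" for x by (simp add: f_def)
  ultimately show ?thesis by (intro exI[of _ \<Omega>] exI[of _ f]) auto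
qed

text \<open>
  If the return probability shrank at least by a factor \<open>1 - B / R\<^sup>2\<close> at each even time from \<open>2 R\<^sup>3\<close> to \<open>4 R\<^sup>3\<close>, it
  would end below \<open>exp (- (B R))\<close>, which for large \<open>B\<close> contradicts the assumed decay. At a time where the drop is
  smaller, the truncated convolution power has gradient of order \<open>1 / R\<close> and support of size \<open>exp (O(R))\<close>.
\<close>

lemma test_profile_return_probability:
  assumes "by_integer_part (Phi G S) \<simeq> (\<lambda>t. exp (- (t powr (1 / 3))))"
  shows "\<exists>A. test_profile real A"
proof -
  obtain a b' N where ab: "a > 0" "b' > 0" and lower: "\<And>n. n \<ge> N \<Longrightarrow> b' * exp (- ((a * real n) powr (1 / 3))) \<le> Phi G S n"
    using growth_equiv_at_nat[OF assms] by blast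
  \<comment> \<open>the cube root of \<open>a * 4 * R ^ 3\<close> is linear in \<open>R\<close>; the last two summands absorb the factor \<open>b'\<close> and make the bound strict\<close>
  define B where "B = (4 * a) powr (1 / 3) + \<bar>ln b'\<bar> + 1"
  have B: "B \<ge> 1" by (simp add: B_def)
  define R0 where "R0 = max 1 N"
  define A where "A = 2 * real (card S) * sqrt B + B + 2"
  have A: "A \<ge> 0" using B by (simp add: A_def)
  have lower_R: "exp (- (B * real R)) < Phi G S n" if R: "R \<ge> R0" and n: "2 * R ^ 3 \<le> n" "n \<le> 4 * R ^ 3" for R n
  proof -
    have "R \<ge> 1" "R \<ge> N" using R by (auto simp: R0_def)
    then have "R \<le> R ^ 3" by (simp add: self_le_power)
    then have nN: "n \<ge> N" using n \<open>R \<ge> N\<close> by linarith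
    have "real n \<le> 4 * real R ^ 3" using n(2) by (metis of_nat_le_iff of_nat_mult of_nat_numeral of_nat_power)
    then have "(a * real n) powr (1 / 3) \<le> (4 * a * real R ^ 3) powr (1 / 3)"
      using ab by (intro powr_mono2) auto
    also have "\<dots> = (4 * a) powr (1 / 3) * (real R ^ 3) powr (1 / 3)" by (rule powr_mult)
    also have "(real R ^ 3) powr (1 / 3) = real R"
    proof -
      have "real R ^ 3 = real R powr 3" using \<open>R \<ge> 1\<close> by simp
      then show ?thesis using \<open>R \<ge> 1\<close> by (simp only: powr_powr) simp
    qed
    finally have 1: "(a * real n) powr (1 / 3) \<le> (4 * a) powr (1 / 3) * real R" .
    have "\<bar>ln b'\<bar> * 1 \<le> \<bar>ln b'\<bar> * real R" using \<open>R \<ge> 1\<close> by (intro mult_left_mono) auto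
    then have "- ln b' < (\<bar>ln b'\<bar> + 1) * real R" using \<open>R \<ge> 1\<close> by (simp add: algebra_simps)
    then have "- (B * real R) < ln b' - (a * real n) powr (1 / 3)" using 1 by (simp add: B_def algebra_simps)
    then have "exp (- (B * real R)) < exp (ln b' + - ((a * real n) powr (1 / 3)))" by simp
    also have "\<dots> = b' * exp (- ((a * real n) powr (1 / 3)))" unfolding exp_add using ab by simp
    also have "\<dots> \<le> Phi G S n" using lower[OF nN] .
    finally show ?thesis .
  qed
  have "test_profile real (A * real R0)"
  proof (rule test_profile_from_large_radii[OF A])
    show "R0 \<ge> 1" by (simp add: R0_def)
    fix R assume R: "R \<ge> R0"
    then have R1: "R \<ge> 1" by (simp add: R0_def)
    define \<delta> where "\<delta> = B / real R ^ 2"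
    have \<delta>: "\<delta> > 0" using B R1 by (simp add: \<delta>_def)
    let ?M = "R ^ 3"
    have "\<exists>m. ?M \<le> m \<and> m < 2 * ?M \<and> (1 - \<delta>) * Phi G S (2 * m) \<le> Phi G S (2 * m + 2)"
    proof (rule ccontr)
      assume "\<not> ?thesis"
      then have less: "Phi G S (2 * m + 2) < (1 - \<delta>) * Phi G S (2 * m)" if "?M \<le> m" "m < 2 * ?M" for m
        using that by (meson not_le)
      have "Phi G S (2 * (?M + k)) \<le> exp (- \<delta> * real k)" if "k \<le> ?M" for k
        using that
      proof (induction k)
        case 0
        then show ?case by (simp add: Phi_def pmf_le_1)
      next
        case (Suc k)
        have "Phi G S (2 * (?M + Suc k)) \<le> (1 - \<delta>) * Phi G S (2 * (?M + k))"
          using less[of "?M + k"] Suc.prems by simp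
        also have "\<dots> \<le> exp (- \<delta>) * Phi G S (2 * (?M + k))"
          using exp_ge_add_one_self[of "- \<delta>"] by (intro mult_right_mono) (auto simp: Phi_def)
        also have "\<dots> \<le> exp (- \<delta>) * exp (- \<delta> * real k)" using Suc by (intro mult_left_mono) auto
        also have "\<dots> = exp (- \<delta> * real (Suc k))" by (simp add: exp_add[symmetric] algebra_simps)
        finally show ?case .
      qed
      from this[of ?M] have "Phi G S (4 * ?M) \<le> exp (- \<delta> * real ?M)" by simp
      also have "\<delta> * real ?M = B * real R" using R1 by (simp add: \<delta>_def power2_eq_square power3_eq_cube)
      then have "exp (- \<delta> * real ?M) = exp (- (B * real R))" by simp
      finally show False using lower_R[OF R, of "4 * ?M"] by simp
    qed
    then obtain m where m: "?M \<le> m" "m < 2 * ?M" "(1 - \<delta>) * Phi G S (2 * m) \<le> Phi G S (2 * m + 2)" by blast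
    define v where "v = Phi G S (2 * m)"
    have v_gt: "exp (- (B * real R)) < v" unfolding v_def using m by (intro lower_R[OF R]) auto
    then have v: "v > 0" by (smt (verit) exp_gt_zero)
    obtain \<Omega> f where *: "finite \<Omega>" "\<Omega> \<subseteq> carrier G" "\<forall>x. 0 \<le> f x" "\<forall>x\<in>carrier G - \<Omega>. f x = 0"
      "v / 2 \<le> (\<Sum>x\<in>\<Omega>. (f x)\<^sup>2)"
      and shift: "\<And>s a. shift_le (pmf (conv_power G (pmf_of_set S) m)) s a \<Longrightarrow> shift_le f s a"
      and card: "real (card \<Omega>) \<le> 4 / v"
      using truncated_conv_power[of m] v unfolding v_def by blast
    let ?a = "sqrt (2 * real (card S) ^ 2 * (Phi G S (2 * m) - Phi G S (2 * m + 2)))"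
    \<comment> \<open>the drop at time \<open>2 * m\<close> is at most the fraction \<open>\<delta>\<close> of \<open>v\<close>, while half of \<open>v\<close> survives the truncation\<close>
    have "?a \<le> sqrt (2 * real (card S) ^ 2 * (\<delta> * v))"
      using m(3) by (intro real_sqrt_le_mono mult_left_mono) (auto simp: v_def algebra_simps)
    also have "2 * real (card S) ^ 2 * (\<delta> * v) = (2 * real (card S)) ^ 2 * \<delta> * (v / 2)"
      by (simp add: power2_eq_square)
    also have "sqrt \<dots> = 2 * real (card S) * sqrt \<delta> * sqrt (v / 2)"
      unfolding real_sqrt_mult real_sqrt_abs by simp
    also have "sqrt \<delta> = sqrt B / real R" by (simp add: \<delta>_def real_sqrt_divide)
    also have "2 * real (card S) * (sqrt B / real R) * sqrt (v / 2) \<le> A / real R * sqrt (v / 2)"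
    proof (intro mult_right_mono)
      have "2 * real (card S) * sqrt B \<le> A" using B by (simp add: A_def)
      then show "2 * real (card S) * (sqrt B / real R) \<le> A / real R"
        by (simp add: divide_right_mono)
    qed (use v in simp)
    finally have shift_bound: "?a \<le> A / real R * sqrt (v / 2)" .
    have "4 / v \<le> 4 / exp (- (B * real R))" using v v_gt by (intro divide_left_mono) auto
    also have "\<dots> = 4 * exp (B * real R)" by (simp add: exp_minus field_simps)
    also have "\<dots> \<le> exp 2 * exp (B * real R)"
    proof -
      have "(2::real) ^ 2 \<le> (exp 1) ^ 2" using exp_ge_add_one_self[of 1] by (intro power_mono) auto
      then show ?thesis by (simp add: exp_double[symmetric] flip: exp_of_nat_mult)
    qed
    also have "\<dots> = exp (B * real R + 2)" by (simp add: exp_add)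
    also have "\<dots> \<le> exp (A * real R)"
    proof -
      have "(B + 2) * real R \<le> A * real R" using B by (intro mult_right_mono) (auto simp: A_def)
      moreover have "B * real R + 2 \<le> (B + 2) * real R" using R1 by (simp add: algebra_simps)
      ultimately show ?thesis by simp
    qed
    finally have "real (card \<Omega>) \<le> exp (A * real R)" using card by linarith
    then show "has_test_function (A / real R) (exp (A * real R))"
      using * v shift_bound A shift[OF shift_le_conv_power]
      by (intro has_test_functionI[of \<Omega> f "v / 2" ?a]) auto
  qed
  then show ?thesis ..
qed

end

section \<open>Lamp and position in a wreath product\<close>

text \<open>
  Translation norms are bounded over arbitrary finite sets \<open>Z\<close>; this passes to the fibres over the positions, on
  which the sums factor.
\<close>

lemma sum_le_slices:
  fixes g :: "'x \<times> 'y \<Rightarrow> real"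
  assumes "finite Z" "finite B" "\<And>h. h \<in> B \<Longrightarrow> finite (T h)" "\<And>z. 0 \<le> g z"
    and "\<And>f h. (f, h) \<in> Z \<Longrightarrow> g (f, h) \<noteq> 0 \<Longrightarrow> h \<in> B \<and> f \<in> T h"
  shows "(\<Sum>z\<in>Z. g z) \<le> (\<Sum>h\<in>B. \<Sum>f\<in>T h. g (f, h))"
proof -
  have inj: "inj_on (\<lambda>(h, f). (f, h)) (Sigma B T)" by (auto intro: inj_onI)
  let ?W = "(\<lambda>(h, f). (f, h)) ` Sigma B T"
  have fin: "finite ?W" using assms by auto
  have "(\<Sum>z\<in>Z. g z) = (\<Sum>z\<in>Z \<inter> ?W. g z)"
    using assms(1,5) by (intro sum.mono_neutral_right) force+
  also have "\<dots> \<le> (\<Sum>z\<in>?W. g z)" using fin assms(4) by (intro sum_mono2) auto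
  also have "\<dots> = (\<Sum>(h, f)\<in>Sigma B T. g (f, h))"
    by (subst sum.reindex[OF inj]) (auto intro!: sum.cong)
  also have "\<dots> = (\<Sum>h\<in>B. \<Sum>f\<in>T h. g (f, h))" using assms by (subst sum.Sigma) auto
  finally show ?thesis .
qed

locale wreath = H: fg_group H SH + K: fg_group K SK + G: fg_group "K \<wr> H" SG
  for H :: "('h, 'a) monoid_scheme" and SH :: "'h set"
    and K :: "('k, 'b) monoid_scheme" and SK :: "'k set"
    and SG :: "(('h \<Rightarrow> 'k) \<times> 'h) set"
begin

abbreviation wreath_mult (infixl \<open>\<star>\<close> 70) where "x \<star> y \<equiv> x \<otimes>\<^bsub>K \<wr> H\<^esub> y"
abbreviation wreath_one (\<open>\<e>\<close>) where "\<e> \<equiv> \<one>\<^bsub>K \<wr> H\<^esub>"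
abbreviation conv where "conv \<equiv> convolution (K \<wr> H)"

text \<open>
  Embedding of \<open>K\<close> as the lamp group over the identity of \<open>H\<close>; right multiplication by it changes the lamp at
  the current position.
\<close>

definition lamp :: "'k \<Rightarrow> ('h \<Rightarrow> 'k) \<times> 'h" where
  "lamp k = (\<lambda>x\<in>carrier H. if x = \<one>\<^bsub>H\<^esub> then k else \<one>\<^bsub>K\<^esub>, \<one>\<^bsub>H\<^esub>)"

definition move :: "'h \<Rightarrow> ('h \<Rightarrow> 'k) \<times> 'h" where
  "move h = (\<lambda>x\<in>carrier H. \<one>\<^bsub>K\<^esub>, h)"

lemma in_carrier_wreath:
  "(f, h) \<in> carrier (K \<wr> H) \<longleftrightarrow>
    f \<in> carrier H \<rightarrow>\<^sub>E carrier K \<and> finite {x \<in> carrier H. f x \<noteq> \<one>\<^bsub>K\<^esub>} \<and> h \<in> carrier H"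
  by (simp add: wreath_product_def semidirect_product_def carrier_sum_group K.is_group)

lemma mult_wreath:
  assumes "h \<in> carrier H"
  shows "(f, h) \<star> (f', h')
    = (\<lambda>x\<in>carrier H. f x \<otimes>\<^bsub>K\<^esub> f' (inv\<^bsub>H\<^esub> h \<otimes>\<^bsub>H\<^esub> x), h \<otimes>\<^bsub>H\<^esub> h')"
  using assms by (auto simp: wreath_product_def semidirect_product_def left_translate_def)

lemma one_wreath: "\<e> = (\<lambda>x\<in>carrier H. \<one>\<^bsub>K\<^esub>, \<one>\<^bsub>H\<^esub>)"
  by (simp add: wreath_product_def semidirect_product_def)

lemma mult_move:
  assumes "(f, h) \<in> carrier (K \<wr> H)" "h' \<in> carrier H"
  shows "(f, h) \<star> move h' = (f, h \<otimes>\<^bsub>H\<^esub> h')"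
proof -
  have "h \<in> carrier H" and f: "f \<in> carrier H \<rightarrow>\<^sub>E carrier K" using assms by (auto simp: in_carrier_wreath)
  moreover have "(\<lambda>x\<in>carrier H. f x \<otimes>\<^bsub>K\<^esub> (\<lambda>x\<in>carrier H. \<one>\<^bsub>K\<^esub>) (inv\<^bsub>H\<^esub> h \<otimes>\<^bsub>H\<^esub> x)) = f"
    using f \<open>h \<in> carrier H\<close> by (auto simp: PiE_iff extensional_def)
  ultimately show ?thesis by (simp add: mult_wreath move_def)
qed

lemma mult_lamp:
  assumes "(f, h) \<in> carrier (K \<wr> H)" "k \<in> carrier K"
  shows "(f, h) \<star> lamp k = (f(h := f h \<otimes>\<^bsub>K\<^esub> k), h)"
proof -
  have h: "h \<in> carrier H" and f: "f \<in> carrier H \<rightarrow>\<^sub>E carrier K" using assms by (auto simp: in_carrier_wreath)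
  have "inv\<^bsub>H\<^esub> h \<otimes>\<^bsub>H\<^esub> x = \<one>\<^bsub>H\<^esub> \<longleftrightarrow> x = h" if "x \<in> carrier H" for x
    using h that by (metis H.inv_closed H.inv_equality H.inv_inv H.l_inv)
  then have "(\<lambda>x\<in>carrier H. f x \<otimes>\<^bsub>K\<^esub> (\<lambda>x\<in>carrier H. if x = \<one>\<^bsub>H\<^esub> then k else \<one>\<^bsub>K\<^esub>) (inv\<^bsub>H\<^esub> h \<otimes>\<^bsub>H\<^esub> x))
      = f(h := f h \<otimes>\<^bsub>K\<^esub> k)"
    using f h by (auto simp: PiE_iff extensional_def fun_eq_iff)
  then show ?thesis using h by (simp add: mult_wreath lamp_def)
qed

lemma move_closed: "h \<in> carrier H \<Longrightarrow> move h \<in> carrier (K \<wr> H)"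
  by (auto simp: in_carrier_wreath move_def)

lemma lamp_closed: "k \<in> carrier K \<Longrightarrow> lamp k \<in> carrier (K \<wr> H)"
  by (auto simp: in_carrier_wreath lamp_def intro!: finite_subset[of _ "{\<one>\<^bsub>H\<^esub>}"])

lemma lamp_one: "lamp \<one>\<^bsub>K\<^esub> = \<e>"
  by (auto simp: lamp_def one_wreath)

lemma move_one: "move \<one>\<^bsub>H\<^esub> = \<e>"
  by (auto simp: move_def one_wreath)

lemma lamp_mult:
  assumes "k \<in> carrier K" "k' \<in> carrier K"
  shows "lamp (k \<otimes>\<^bsub>K\<^esub> k') = lamp k \<star> lamp k'"
  using mult_lamp[of "fst (lamp k)" "snd (lamp k)" k'] lamp_closed[OF assms(1)] assms
  by (auto simp: lamp_def)

lemma move_mult: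
  assumes "h \<in> carrier H" "h' \<in> carrier H"
  shows "move (h \<otimes>\<^bsub>H\<^esub> h') = move h \<star> move h'"
  using mult_move[of "fst (move h)" "snd (move h)" h'] move_closed[OF assms(1)] assms
  by (auto simp: move_def)

lemma lamp_inv:
  assumes "k \<in> carrier K" shows "inv\<^bsub>K \<wr> H\<^esub> (lamp k) = lamp (inv\<^bsub>K\<^esub> k)"
  using assms by (intro G.inv_equality) (auto simp: lamp_mult[symmetric] lamp_one lamp_closed)

lemma move_inv:
  assumes "h \<in> carrier H" shows "inv\<^bsub>K \<wr> H\<^esub> (move h) = move (inv\<^bsub>H\<^esub> h)"
  using assms by (intro G.inv_equality) (auto simp: move_mult[symmetric] move_one move_closed)

text \<open>
  Both factors generate: a finitely supported configuration is produced one lamp at a time by walking to the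
  lamp, setting it, and walking back.
\<close>

lemma wreath_induct [consumes 1, case_names lamp move mult]:
  assumes g: "g \<in> carrier (K \<wr> H)"
    and lamp: "\<And>k. k \<in> carrier K \<Longrightarrow> P (lamp k)"
    and move: "\<And>h. h \<in> carrier H \<Longrightarrow> P (move h)"
    and mult: "\<And>x y. x \<in> carrier (K \<wr> H) \<Longrightarrow> y \<in> carrier (K \<wr> H) \<Longrightarrow> P x \<Longrightarrow> P y \<Longrightarrow> P (x \<star> y)"
  shows "P g"
proof -
  obtain f h where fh: "g = (f, h)" by (cases g)
  have *: "P (f, \<one>\<^bsub>H\<^esub>)" if "finite A" "f \<in> carrier H \<rightarrow>\<^sub>E carrier K" "{x \<in> carrier H. f x \<noteq> \<one>\<^bsub>K\<^esub>} = A" for A f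
    using that
  proof (induction A arbitrary: f rule: finite_induct)
    case empty
    then have "(f, \<one>\<^bsub>H\<^esub>) = move \<one>\<^bsub>H\<^esub>" by (auto simp: move_def PiE_iff extensional_def fun_eq_iff)
    then show ?case using move by simp
  next
    case (insert x A)
    then have x: "x \<in> carrier H" by blast
    \<comment> \<open>one lamp fewer, so the induction hypothesis applies\<close>
    define f' where "f' = f(x := \<one>\<^bsub>K\<^esub>)"
    have f': "f' \<in> carrier H \<rightarrow>\<^sub>E carrier K" using insert.prems x by (auto simp: f'_def PiE_iff extensional_def)
    have supp: "{y \<in> carrier H. f' y \<noteq> \<one>\<^bsub>K\<^esub>} = A" using insert.prems(2) insert.hyps(2) by (auto simp: f'_def)
    have P: "P (f', \<one>\<^bsub>H\<^esub>)" by (rule insert.IH[OF f' supp])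
    have c: "(f', z) \<in> carrier (K \<wr> H)" if "z \<in> carrier H" for z
      using f' supp insert.hyps(1) that by (simp add: in_carrier_wreath)
    have k: "f x \<in> carrier K" using insert.prems x by auto
    have 1: "(f', x) = (f', \<one>\<^bsub>H\<^esub>) \<star> move x" using mult_move[OF c x] x by simp
    have 2: "(f, x) = (f', x) \<star> lamp (f x)" using mult_lamp[OF c[OF x] k] k by (simp add: f'_def)
    have fc: "(f, x) \<in> carrier (K \<wr> H)" unfolding 2 using c[OF x] lamp_closed[OF k] by (rule G.m_closed)
    have 3: "(f, \<one>\<^bsub>H\<^esub>) = (f, x) \<star> move (inv\<^bsub>H\<^esub> x)" using mult_move[OF fc] x by simp
    have "P (f', x)" unfolding 1 using P move c x by (intro mult move_closed) auto
    then have "P (f, x)" unfolding 2 using c[OF x] lamp_closed[OF k] lamp[OF k] by (intro mult)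
    then show ?case unfolding 3 using fc x move by (intro mult move_closed) auto
  qed
  have f: "f \<in> carrier H \<rightarrow>\<^sub>E carrier K" "finite {x \<in> carrier H. f x \<noteq> \<one>\<^bsub>K\<^esub>}" and h: "h \<in> carrier H"
    using g by (auto simp: fh in_carrier_wreath)
  have c: "(f, \<one>\<^bsub>H\<^esub>) \<in> carrier (K \<wr> H)" using f by (simp add: in_carrier_wreath)
  have "g = (f, \<one>\<^bsub>H\<^esub>) \<star> move h" using mult_move[OF c h] h by (simp add: fh)
  then show ?thesis using *[OF f(2,1) refl] c h move by (auto intro: mult move_closed)
qed

lemma shift_le_lamp_wl:
  assumes "\<And>s. s \<in> SK \<Longrightarrow> G.shift_le F (lamp s) a"
  shows "k \<in> carrier K \<Longrightarrow> G.shift_le F (lamp k) (real (K.wl k) * a)"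
  by (rule K.wl_induct_bound[where P = "\<lambda>g r. G.shift_le F (lamp g) r"])
    (auto simp: lamp_one lamp_mult assms intro: G.shift_le_one G.shift_le_mult lamp_closed)

lemma shift_le_move_wl:
  assumes "\<And>s. s \<in> SH \<Longrightarrow> G.shift_le F (move s) a"
  shows "h \<in> carrier H \<Longrightarrow> G.shift_le F (move h) (real (H.wl h) * a)"
  by (rule H.wl_induct_bound[where P = "\<lambda>g r. G.shift_le F (move g) r"])
    (auto simp: move_one move_mult assms intro: G.shift_le_one G.shift_le_mult move_closed)

text \<open>
  Switching one lamp and moving one step suffice to control an arbitrary finite generating set, with a constant
  independent of the function.
\<close>

lemma shift_le_generators:
  "\<exists>L\<ge>0. \<forall>F a. (\<forall>s\<in>SK. G.shift_le F (lamp s) a) \<longrightarrow> (\<forall>s\<in>SH. G.shift_le F (move s) a)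
    \<longrightarrow> (\<forall>s\<in>SG. G.shift_le F s (L * a))"
proof -
  let ?P = "\<lambda>g L. \<forall>F a. (\<forall>s\<in>SK. G.shift_le F (lamp s) a) \<longrightarrow> (\<forall>s\<in>SH. G.shift_le F (move s) a)
    \<longrightarrow> G.shift_le F g (L * a)"
  have "\<exists>L. ?P g L" if "g \<in> carrier (K \<wr> H)" for g
    using that
  proof (induction g rule: wreath_induct)
    case (lamp k)
    show ?case by (rule exI[of _ "real (K.wl k)"]) (use lamp in \<open>auto intro: shift_le_lamp_wl\<close>)
  next
    case (move h)
    show ?case by (rule exI[of _ "real (H.wl h)"]) (use move in \<open>auto intro: shift_le_move_wl\<close>)
  next
    case (mult x y)
    then obtain L L' where "?P x L" "?P y L'" by blast
    then have "?P (x \<star> y) (L + L')" using mult.hyps by (auto simp: distrib_right intro!: G.shift_le_mult)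
    then show ?case by blast
  qed
  then obtain L where L: "\<And>g. g \<in> SG \<Longrightarrow> ?P g (L g)" using G.S_sub by (metis subsetD)
  define M where "M = (\<Sum>g\<in>SG. \<bar>L g\<bar>)"
  have "L g \<le> M" if "g \<in> SG" for g
    using member_le_sum[OF that, of "\<lambda>g. \<bar>L g\<bar>"] G.finite_S by (auto simp: M_def)
  moreover have "a \<ge> 0" if "\<forall>s\<in>SH. G.shift_le F (move s) a" for F a
    using that H.one_in_S G.shift_le_nonneg by blast
  ultimately have "G.shift_le F g (M * a)"
    if "\<forall>s\<in>SK. G.shift_le F (lamp s) a" "\<forall>s\<in>SH. G.shift_le F (move s) a" "g \<in> SG" for F a g
    using L[OF that(3)] that by (meson G.shift_le_mono mult_right_mono)
  moreover have "M \<ge> 0" by (simp add: M_def sum_nonneg)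
  ultimately show ?thesis by blast
qed

section \<open>Product test functions on a wreath product\<close>

text \<open>
  A product over the whole base rather than over \<open>B\<close>, so that its members are configurations of the wreath
  product.
\<close>

definition lamps :: "'h set \<Rightarrow> ('h \<Rightarrow> 'k set) \<Rightarrow> ('h \<Rightarrow> 'k) set" where
  "lamps B T = (\<Pi>\<^sub>E x\<in>carrier H. if x \<in> B then T x else {\<one>\<^bsub>K\<^esub>})"

lemma bij_betw_lamps:
  assumes "B \<subseteq> carrier H"
  shows "bij_betw (\<lambda>f. restrict f B) (lamps B T) (PiE B T)"
proof (rule bij_betw_byWitness)
  let ?e = "\<lambda>p. \<lambda>x\<in>carrier H. if x \<in> B then p x else \<one>\<^bsub>K\<^esub>"
  show "\<forall>f\<in>lamps B T. ?e (restrict f B) = f"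
  proof
    fix f assume f: "f \<in> lamps B T"
    show "?e (restrict f B) = f"
    proof
      fix x show "?e (restrict f B) x = f x"
        using f by (cases "x \<in> carrier H"; cases "x \<in> B")
          (force simp: lamps_def PiE_iff extensional_def)+
    qed
  qed
  show "\<forall>p\<in>PiE B T. restrict (?e p) B = p"
    using assms by (auto simp: PiE_iff extensional_def fun_eq_iff subset_iff)
  show "(\<lambda>f. restrict f B) ` lamps B T \<subseteq> PiE B T"
    using assms by (auto simp: lamps_def PiE_iff subset_iff split: if_splits)
  show "?e ` PiE B T \<subseteq> lamps B T"
    by (auto simp: lamps_def PiE_iff)
qed

text \<open>
  This makes the norm and the energy of a product test function computable lamp by lamp.
\<close>

lemma sum_lamps:
  fixes g :: "'h \<Rightarrow> 'k \<Rightarrow> real"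
  assumes "finite B" "B \<subseteq> carrier H" "\<And>x. x \<in> B \<Longrightarrow> finite (T x)"
  shows "(\<Sum>f\<in>lamps B T. \<Prod>x\<in>B. g x (f x)) = (\<Prod>x\<in>B. \<Sum>k\<in>T x. g x k)"
proof -
  have "(\<Sum>f\<in>lamps B T. \<Prod>x\<in>B. g x (f x)) = (\<Sum>f\<in>lamps B T. \<Prod>x\<in>B. g x (restrict f B x))" by simp
  also have "\<dots> = (\<Sum>p\<in>PiE B T. \<Prod>x\<in>B. g x (p x))"
    by (rule sum.reindex_bij_betw[OF bij_betw_lamps[OF assms(2)]])
  also have "\<dots> = (\<Prod>x\<in>B. \<Sum>k\<in>T x. g x k)" using assms by (subst prod_sum_PiE) auto
  finally show ?thesis .
qed

lemma finite_lamps: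
  assumes "finite B" "B \<subseteq> carrier H" "\<And>x. x \<in> B \<Longrightarrow> finite (T x)" shows "finite (lamps B T)"
  using bij_betw_finite[OF bij_betw_lamps[OF assms(2)], of T] finite_PiE[OF assms(1,3)] by simp

lemma card_lamps:
  assumes "finite B" "B \<subseteq> carrier H" shows "card (lamps B T) = (\<Prod>x\<in>B. card (T x))"
  using bij_betw_same_card[OF bij_betw_lamps[OF assms(2)], of T] card_PiE[OF assms(1)] by simp

lemma lamps_sub_carrier:
  assumes "f \<in> lamps B T" "finite B" "\<And>x. x \<in> B \<Longrightarrow> T x \<subseteq> carrier K" "h \<in> carrier H"
  shows "(f, h) \<in> carrier (K \<wr> H)"
proof -
  have "{x \<in> carrier H. f x \<noteq> \<one>\<^bsub>K\<^esub>} \<subseteq> B" using assms(1) by (auto simp: lamps_def PiE_iff split: if_splits)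
  then have "finite {x \<in> carrier H. f x \<noteq> \<one>\<^bsub>K\<^esub>}" using assms(2) finite_subset by blast
  moreover have "f x \<in> carrier K" if "x \<in> carrier H" for x
    using assms that by (cases "x \<in> B") (auto simp: lamps_def PiE_iff split: if_splits)
  ultimately show ?thesis using assms by (auto simp: in_carrier_wreath lamps_def PiE_iff)
qed

text \<open>
  The function is \<open>F (f, h) = tent h * (\<Prod>x\<in>B. \<psi> (f x))\<close>, extended by zero to configurations with a nontrivial
  lamp outside \<open>B\<close>. A move affects only the tent, and a switch at \<open>h\<close> affects only the factor of the lamp
  at \<open>h\<close>; where \<open>h\<close> is outside \<open>B\<close> the tent vanishes before and after the switch. The squares of all other factors
  sum to one.
\<close>

lemma wreath_test_function:
  fixes R :: nat and \<psi> :: "'k \<Rightarrow> real" and \<Theta> :: "'k set"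
  assumes \<Theta>: "finite \<Theta>" "\<Theta> \<subseteq> carrier K"
    and \<psi>: "\<And>k. 0 \<le> \<psi> k" "\<And>k. k \<in> carrier K - \<Theta> \<Longrightarrow> \<psi> k = 0" "(\<Sum>k\<in>\<Theta>. (\<psi> k)\<^sup>2) = 1"
      "\<And>s. s \<in> SK \<Longrightarrow> K.shift_le \<psi> s a"
  defines "B \<equiv> H.wball R" and "N \<equiv> (\<Sum>h\<in>H.wball R. (H.tent R h)\<^sup>2)"
  shows "\<exists>\<Omega> F. finite \<Omega> \<and> \<Omega> \<subseteq> carrier (K \<wr> H) \<and> (\<forall>z. 0 \<le> F z) \<and> (\<forall>z\<in>carrier (K \<wr> H) - \<Omega>. F z = 0)
    \<and> (\<Sum>z\<in>\<Omega>. (F z)\<^sup>2) = N \<and> card \<Omega> = card \<Theta> ^ card B * card B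
    \<and> (\<forall>s\<in>SH. G.shift_le F (move s) (sqrt (real (card B))))
    \<and> (\<forall>s\<in>SK. G.shift_le F (lamp s) (a * sqrt N))"
proof -
  have B: "finite B" "B \<subseteq> carrier H" using H.wball_carrier by (auto simp: B_def)
  define cond where "cond f \<longleftrightarrow> (\<forall>x\<in>carrier H - B. f x = \<one>\<^bsub>K\<^esub>)" for f :: "'h \<Rightarrow> 'k"
  define \<Psi> where "\<Psi> f = (if cond f then \<Prod>x\<in>B. \<psi> (f x) else 0)" for f
  define F where "F = (\<lambda>(f, h). H.tent R h * \<Psi> f)"
  define L where "L = lamps B (\<lambda>_. \<Theta>)"
  define \<Omega> where "\<Omega> = L \<times> B"
  have L_fin: "finite L" unfolding L_def using B \<Theta> by (intro finite_lamps) auto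
  have \<Omega>_fin: "finite \<Omega>" using L_fin B by (simp add: \<Omega>_def)
  have \<Omega>_sub: "\<Omega> \<subseteq> carrier (K \<wr> H)"
    using B \<Theta> by (auto simp: \<Omega>_def L_def subset_iff intro!: lamps_sub_carrier[of _ B "\<lambda>_. \<Theta>"])
  have condI: "cond f" if "f \<in> lamps B T" for f T using that by (auto simp: cond_def lamps_def PiE_iff)
  have in_lamps: "f \<in> lamps B T" if "(f, h) \<in> carrier (K \<wr> H)" "cond f" "\<And>x. x \<in> B \<Longrightarrow> f x \<in> T x" for f h T
    using that by (auto simp: lamps_def PiE_iff cond_def in_carrier_wreath)
  have \<Psi>_zero: "\<Psi> f = 0" if "(f, h) \<in> carrier (K \<wr> H)" "f \<notin> L" for f h
  proof (cases "cond f")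
    case True
    note c = that(1)
    have "\<exists>x\<in>B. f x \<notin> \<Theta>" using in_lamps[OF c True, of "\<lambda>_. \<Theta>"] that(2) unfolding L_def by blast
    then obtain x where x: "x \<in> B" "f x \<notin> \<Theta>" by blast
    moreover have "f x \<in> carrier K" using c x(1) B(2) by (auto simp: in_carrier_wreath)
    ultimately have "\<psi> (f x) = 0" using \<psi>(2) by simp
    then show ?thesis using x(1) B(1) by (auto simp: \<Psi>_def)
  qed (simp add: \<Psi>_def)
  have \<Psi>_norm: "(\<Sum>f\<in>L. (\<Psi> f)\<^sup>2) = 1"
  proof -
    have "(\<Sum>f\<in>L. (\<Psi> f)\<^sup>2) = (\<Sum>f\<in>L. \<Prod>x\<in>B. (\<psi> (f x))\<^sup>2)"
      using condI by (intro sum.cong refl) (auto simp: \<Psi>_def L_def prod_power_distrib)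
    also have "\<dots> = 1" unfolding L_def using B \<Theta> \<psi>(3) by (subst sum_lamps) auto
    finally show ?thesis .
  qed
  have F_nonneg: "0 \<le> F z" for z
    using \<psi>(1) by (auto simp: F_def \<Psi>_def H.tent_def prod_nonneg split: prod.splits)
  have F_zero: "F z = 0" if "z \<in> carrier (K \<wr> H) - \<Omega>" for z
  proof -
    obtain f h where z: "z = (f, h)" by (cases z)
    then have "f \<notin> L \<or> h \<in> carrier H - B" using that by (auto simp: \<Omega>_def in_carrier_wreath)
    then show ?thesis using \<Psi>_zero[of f h] that H.tent_outside[of h R] by (auto simp: z F_def B_def)
  qed
  have F_norm: "(\<Sum>z\<in>\<Omega>. (F z)\<^sup>2) = N"
  proof -
    have "(\<Sum>z\<in>\<Omega>. (F z)\<^sup>2) = (\<Sum>f\<in>L. \<Sum>h\<in>B. (F (f, h))\<^sup>2)" by (simp add: \<Omega>_def sum.cartesian_product)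
    also have "\<dots> = (\<Sum>f\<in>L. (\<Psi> f)\<^sup>2 * (\<Sum>h\<in>B. (H.tent R h)\<^sup>2))"
      by (simp add: F_def power_mult_distrib sum_distrib_left mult.commute)
    also have "\<dots> = N" using \<Psi>_norm by (simp add: sum_distrib_right[symmetric] N_def B_def)
    finally show ?thesis .
  qed
  have card: "card \<Omega> = card \<Theta> ^ card B * card B"
    using B by (simp add: \<Omega>_def L_def card_cartesian_product card_lamps)
  have shift_move: "G.shift_le F (move s) (sqrt (real (card B)))" if s: "s \<in> SH" for s
    unfolding G.shift_le_def L2_set_def
  proof (intro allI impI real_sqrt_le_mono)
    fix Z assume Z: "finite Z" "Z \<subseteq> carrier (K \<wr> H)"
    have sc: "s \<in> carrier H" using s H.S_sub by auto
    let ?g = "\<lambda>z. indicator B (snd z) * (\<Psi> (fst z))\<^sup>2 :: real"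
    have "(\<Sum>z\<in>Z. (F z - F (z \<star> move s))\<^sup>2) \<le> (\<Sum>z\<in>Z. ?g z)"
    proof (rule sum_mono)
      fix z assume "z \<in> Z"
      then obtain f h where z: "z = (f, h)" "(f, h) \<in> carrier (K \<wr> H)" using Z by (cases z) auto
      then have h: "h \<in> carrier H" by (simp add: in_carrier_wreath)
      have "(F z - F (z \<star> move s))\<^sup>2 = ((H.tent R h - H.tent R (h \<otimes>\<^bsub>H\<^esub> s)) * \<Psi> f)\<^sup>2"
        unfolding z(1) mult_move[OF z(2) sc] by (simp add: F_def left_diff_distrib)
      also have "\<dots> \<le> indicator B h * (\<Psi> f)\<^sup>2"
        unfolding power_mult_distrib B_def using H.tent_diff_sq[OF h s] by (intro mult_right_mono) auto
      finally show "(F z - F (z \<star> move s))\<^sup>2 \<le> ?g z" by (simp add: z)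
    qed
    also have "\<dots> \<le> (\<Sum>h\<in>B. \<Sum>f\<in>L. ?g (f, h))"
    proof (rule sum_le_slices)
      fix f h assume "(f, h) \<in> Z" "?g (f, h) \<noteq> 0"
      then show "h \<in> B \<and> f \<in> L" using \<Psi>_zero[of f h] Z by (auto simp: indicator_def split: if_splits)
    qed (use Z B L_fin in auto)
    also have "\<dots> = real (card B)" using \<Psi>_norm by simp
    finally show "(\<Sum>z\<in>Z. (F z - F (z \<star> move s))\<^sup>2) \<le> real (card B)" .
  qed
  have shift_lamp: "G.shift_le F (lamp s) (a * sqrt N)" if s: "s \<in> SK" for s
  proof -
    have sc: "s \<in> carrier K" using s K.S_sub by auto
    have a: "a \<ge> 0" using K.shift_le_nonneg[OF \<psi>(4)[OF s]] .
    \<comment> \<open>the difference \<open>\<psi> k - \<psi> (k s)\<close> is supported here\<close>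
    define \<Theta>' where "\<Theta>' = \<Theta> \<union> (\<lambda>k. k \<otimes>\<^bsub>K\<^esub> inv\<^bsub>K\<^esub> s) ` \<Theta>"
    have \<Theta>': "finite \<Theta>'" "\<Theta>' \<subseteq> carrier K" using \<Theta> sc by (auto simp: \<Theta>'_def)
    have \<Theta>'_zero: "\<psi> k - \<psi> (k \<otimes>\<^bsub>K\<^esub> s) = 0" if k: "k \<in> carrier K" "k \<notin> \<Theta>'" for k
    proof -
      have "k \<otimes>\<^bsub>K\<^esub> s \<notin> \<Theta>"
      proof
        assume "k \<otimes>\<^bsub>K\<^esub> s \<in> \<Theta>"
        moreover have "k = (k \<otimes>\<^bsub>K\<^esub> s) \<otimes>\<^bsub>K\<^esub> inv\<^bsub>K\<^esub> s" using k sc by (simp add: K.m_assoc)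
        ultimately show False using k(2) unfolding \<Theta>'_def by blast
      qed
      then show ?thesis using k sc \<psi>(2)[of k] \<psi>(2)[of "k \<otimes>\<^bsub>K\<^esub> s"] by (auto simp: \<Theta>'_def)
    qed
    define T where "T h x = (if x = h then \<Theta>' else \<Theta>)" for h x :: 'h
    define w where "w h x k = (if x = h then (\<psi> k - \<psi> (k \<otimes>\<^bsub>K\<^esub> s))\<^sup>2 else (\<psi> k)\<^sup>2)" for h x :: 'h and k
    let ?g = "\<lambda>z. (F z - F (z \<star> lamp s))\<^sup>2"
    have g_eq: "?g (f, h) = (if h \<in> B \<and> cond f then (H.tent R h)\<^sup>2 * (\<Prod>x\<in>B. w h x (f x)) else 0)"
      if fh: "(f, h) \<in> carrier (K \<wr> H)" for f h
    proof -
      have h: "h \<in> carrier H" using fh by (simp add: in_carrier_wreath)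
      have eq: "?g (f, h) = (H.tent R h)\<^sup>2 * (\<Psi> f - \<Psi> (f(h := f h \<otimes>\<^bsub>K\<^esub> s)))\<^sup>2"
        unfolding mult_lamp[OF fh sc]
        by (simp add: F_def right_diff_distrib[symmetric] power_mult_distrib)
      show ?thesis
      proof (cases "h \<in> B")
        case False
        then show ?thesis using eq h H.tent_outside[of h R] by (simp add: B_def)
      next
        case hB: True
        have cond_eq: "cond (f(h := f h \<otimes>\<^bsub>K\<^esub> s)) \<longleftrightarrow> cond f" using hB by (auto simp: cond_def)
        show ?thesis
        proof (cases "cond f")
          case False
          then show ?thesis using eq cond_eq by (simp add: \<Psi>_def)
        next
          case True
          have split: "(\<Prod>x\<in>B. u x) = u h * (\<Prod>x\<in>B - {h}. u x)" for u :: "'h \<Rightarrow> real"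
            using B(1) hB by (rule prod.remove)
          have "\<Psi> f - \<Psi> (f(h := f h \<otimes>\<^bsub>K\<^esub> s))
              = (\<psi> (f h) - \<psi> (f h \<otimes>\<^bsub>K\<^esub> s)) * (\<Prod>x\<in>B - {h}. \<psi> (f x))"
            using True cond_eq by (simp add: \<Psi>_def split left_diff_distrib)
          moreover have "(\<Prod>x\<in>B. w h x (f x)) = (\<psi> (f h) - \<psi> (f h \<otimes>\<^bsub>K\<^esub> s))\<^sup>2 * (\<Prod>x\<in>B - {h}. \<psi> (f x))\<^sup>2"
            by (simp add: split w_def prod_power_distrib)
          ultimately show ?thesis using eq hB True by (simp add: power_mult_distrib)
        qed
      qed
    qed
    show ?thesis
      unfolding G.shift_le_def
    proof (intro allI impI)
      fix Z assume Z: "finite Z" "Z \<subseteq> carrier (K \<wr> H)"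
      have "(\<Sum>z\<in>Z. ?g z) \<le> (\<Sum>h\<in>B. \<Sum>f\<in>lamps B (T h). ?g (f, h))"
      proof (rule sum_le_slices)
        fix f h assume fh: "(f, h) \<in> Z" "?g (f, h) \<noteq> 0"
        then have c: "(f, h) \<in> carrier (K \<wr> H)" using Z by auto
        then have hB: "h \<in> B" and cf: "cond f" and nz: "(\<Prod>x\<in>B. w h x (f x)) \<noteq> 0"
          using fh(2) by (auto simp: g_eq split: if_splits)
        have "f x \<in> T h x" if x: "x \<in> B" for x
        proof -
          have "f x \<in> carrier K" using c x B(2) by (auto simp: in_carrier_wreath)
          moreover have "w h x (f x) \<noteq> 0" using nz x B(1) by auto
          ultimately show ?thesis using \<Theta>'_zero \<psi>(2) by (auto simp: w_def T_def split: if_splits)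
        qed
        then show "h \<in> B \<and> f \<in> lamps B (T h)" using hB in_lamps[OF c cf] by blast
      next
        fix h assume "h \<in> B"
        show "finite (lamps B (T h))" using B \<Theta> \<Theta>' by (intro finite_lamps) (auto simp: T_def)
      qed (use Z B in auto)
      also have "\<dots> \<le> (\<Sum>h\<in>B. (H.tent R h)\<^sup>2 * a\<^sup>2)"
      proof (rule sum_mono)
        fix h assume h: "h \<in> B"
        have T_sub: "T h x \<subseteq> carrier K" for x using \<Theta> \<Theta>' by (auto simp: T_def)
        have "(\<Sum>f\<in>lamps B (T h). ?g (f, h)) = (\<Sum>f\<in>lamps B (T h). (H.tent R h)\<^sup>2 * (\<Prod>x\<in>B. w h x (f x)))"
        proof (intro sum.cong refl)
          fix f assume f: "f \<in> lamps B (T h)"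
          have "(f, h) \<in> carrier (K \<wr> H)" using f B h T_sub by (intro lamps_sub_carrier[of f B "T h"]) auto
          then show "?g (f, h) = (H.tent R h)\<^sup>2 * (\<Prod>x\<in>B. w h x (f x))" using g_eq h condI[OF f] by simp
        qed
        also have "\<dots> = (H.tent R h)\<^sup>2 * (\<Prod>x\<in>B. \<Sum>k\<in>T h x. w h x k)"
          using B \<Theta> \<Theta>' by (subst sum_lamps[symmetric]) (auto simp: sum_distrib_left T_def)
        also have "(\<Prod>x\<in>B. \<Sum>k\<in>T h x. w h x k)
            = (\<Sum>k\<in>\<Theta>'. (\<psi> k - \<psi> (k \<otimes>\<^bsub>K\<^esub> s))\<^sup>2) * (\<Prod>x\<in>B - {h}. 1)"
          using \<psi>(3) by (subst prod.remove[OF B(1) h]) (auto simp: T_def w_def intro!: prod.neutral)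
        also have "\<dots> = (L2_set (\<lambda>k. \<psi> k - \<psi> (k \<otimes>\<^bsub>K\<^esub> s)) \<Theta>')\<^sup>2"
          by (simp add: L2_set_def sum_nonneg)
        also have "(H.tent R h)\<^sup>2 * \<dots> \<le> (H.tent R h)\<^sup>2 * a\<^sup>2"
          using K.shift_leD[OF \<psi>(4)[OF s] \<Theta>'] by (intro mult_left_mono power_mono) auto
        finally show "(\<Sum>f\<in>lamps B (T h). ?g (f, h)) \<le> (H.tent R h)\<^sup>2 * a\<^sup>2" .
      qed
      also have "\<dots> = N * a\<^sup>2" by (simp add: N_def B_def sum_distrib_right)
      finally have "sqrt (\<Sum>z\<in>Z. ?g z) \<le> sqrt (N * a\<^sup>2)" by (rule real_sqrt_le_mono)
      also have "\<dots> = a * sqrt N" using a by (simp add: real_sqrt_mult mult.commute)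
      finally show "L2_set (\<lambda>z. F z - F (z \<star> lamp s)) Z \<le> a * sqrt N" by (simp add: L2_set_def)
    qed
  qed
  show ?thesis
    by (rule exI[of _ \<Omega>], rule exI[of _ F])
      (use \<Omega>_fin \<Omega>_sub F_nonneg F_zero F_norm card shift_move shift_lamp in blast)
qed

text \<open>
  A product over \<open>V\<^sub>H R\<close> lamps multiplies the logarithmic size of the support by \<open>V\<^sub>H R\<close>, but since a generator
  touches one lamp only, the gradient does not deteriorate.
\<close>

lemma wreath_test_profile:
  assumes poly: "polynomial_growth H SH d" and prof: "K.test_profile w A" and w: "\<And>r. 0 \<le> w r"
  shows "\<exists>A'. G.test_profile (\<lambda>R. real R ^ d * (1 + w R)) A'"
proof -
  obtain c where c: "c > 0"
    "\<And>R. R \<ge> 1 \<Longrightarrow> c * real R ^ 2 * volume H SH R \<le> (\<Sum>x\<in>H.wball R. (H.tent R x)\<^sup>2)"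
    using H.tent_mass[OF poly] by blast
  obtain C where C: "C > 0" "\<And>r. r \<ge> 1 \<Longrightarrow> volume H SH r \<le> C * real r ^ d"
    using H.polynomial_growth_bounds[OF poly] by blast
  obtain L where L: "L \<ge> 0" and gens: "\<And>F a. (\<forall>s\<in>SK. G.shift_le F (lamp s) a) \<Longrightarrow>
      (\<forall>s\<in>SH. G.shift_le F (move s) a) \<Longrightarrow> (\<forall>s\<in>SG. G.shift_le F s (L * a))"
    using shift_le_generators by blast
  have A: "A \<ge> 0" using prof by (simp add: K.test_profile_def)
  define A1 where "A1 = A + 1 / sqrt c"
  define A' where "A' = L * A1 + C * (A + 1)"
  have A1: "A1 \<ge> 0" using A c(1) by (simp add: A1_def)
  have A': "A' \<ge> 0" "L * A1 \<le> A'" "C * (A + 1) \<le> A'" using A A1 L C(1) by (auto simp: A'_def)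
  have "G.test_profile (\<lambda>R. real R ^ d * (1 + w R)) A'"
  proof (rule G.test_profileI[OF A'(1)])
    fix R :: nat assume R: "R \<ge> 1"
    obtain \<Theta> \<psi> where \<Theta>: "finite \<Theta>" "\<Theta> \<subseteq> carrier K"
      and \<psi>: "\<And>k. 0 \<le> \<psi> k" "\<And>k. k \<in> carrier K - \<Theta> \<Longrightarrow> \<psi> k = 0" "(\<Sum>k\<in>\<Theta>. (\<psi> k)\<^sup>2) = 1"
        "\<And>s. s \<in> SK \<Longrightarrow> K.shift_le \<psi> s (A / real R)" and cardT: "real (card \<Theta>) \<le> exp (A * w R)"
      by (rule K.has_test_functionE[OF K.test_profileD[OF prof R]]) (rule that)
    define B where "B = H.wball R"
    define N where "N = (\<Sum>h\<in>H.wball R. (H.tent R h)\<^sup>2)"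
    obtain \<Omega> F where \<Omega>: "finite \<Omega>" "\<Omega> \<subseteq> carrier (K \<wr> H)" and F: "\<forall>z. 0 \<le> F z" "\<forall>z\<in>carrier (K \<wr> H) - \<Omega>. F z = 0"
      "(\<Sum>z\<in>\<Omega>. (F z)\<^sup>2) = N" and card: "card \<Omega> = card \<Theta> ^ card B * card B"
      and mv: "\<forall>s\<in>SH. G.shift_le F (move s) (sqrt (real (card B)))"
      and lp: "\<forall>s\<in>SK. G.shift_le F (lamp s) (A / real R * sqrt N)"
      using wreath_test_function[OF \<Theta> \<psi>, of R] unfolding B_def N_def by blast
    have V: "volume H SH R \<ge> 1" "volume H SH R = real (card B)"
      by (rule H.volume_ge_1) (simp add: H.volume_eq B_def)
    have N_ge: "c * real R ^ 2 * real (card B) \<le> N" using c(2)[OF R] V by (simp add: N_def)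
    have N: "N > 0"
    proof -
      have "0 < c * real R ^ 2 * real (card B)" using c(1) R V by (intro mult_pos_pos) auto
      then show ?thesis using N_ge by linarith
    qed
    have "sqrt (c * real R ^ 2 * real (card B)) \<le> sqrt N" using N_ge by (rule real_sqrt_le_mono)
    then have "sqrt c * real R * sqrt (real (card B)) \<le> sqrt N" by (simp add: real_sqrt_mult)
    then have sV: "sqrt (real (card B)) \<le> 1 / sqrt c / real R * sqrt N"
      using c(1) R by (simp add: field_simps)
    have "A / real R * sqrt N \<le> A1 / real R * sqrt N"
      using c(1) N by (intro mult_right_mono divide_right_mono) (auto simp: A1_def)
    then have 1: "\<forall>s\<in>SK. G.shift_le F (lamp s) (A1 / real R * sqrt N)" using lp G.shift_le_mono by blast
    have "1 / sqrt c / real R * sqrt N \<le> A1 / real R * sqrt N"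
      using A N by (intro mult_right_mono divide_right_mono) (auto simp: A1_def)
    then have 2: "\<forall>s\<in>SH. G.shift_le F (move s) (A1 / real R * sqrt N)"
      using mv sV G.shift_le_mono order_trans by blast
    have shift: "\<forall>s\<in>SG. G.shift_le F s (L * (A1 / real R * sqrt N))" using gens[OF 1 2] .
    have le: "L * (A1 / real R * sqrt N) \<le> A' / real R * sqrt N"
    proof -
      have "(L * A1) / real R * sqrt N \<le> A' / real R * sqrt N"
        using A'(2) N by (intro mult_right_mono divide_right_mono) auto
      then show ?thesis by simp
    qed
    have "real (card \<Omega>) = real (card \<Theta>) ^ card B * real (card B)" using card by simp
    also have "\<dots> \<le> exp (A * w R) ^ card B * exp (real (card B))"
    proof (intro mult_mono power_mono cardT)
      show "real (card B) \<le> exp (real (card B))" using exp_ge_add_one_self[of "real (card B)"] by linarith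
    qed auto
    also have "\<dots> = exp (real (card B) * (A * w R + 1))"
      by (simp add: exp_add[symmetric] exp_of_nat_mult[symmetric] algebra_simps)
    also have "\<dots> \<le> exp (A' * (real R ^ d * (1 + w R)))"
    proof -
      have "real (card B) * (A * w R + 1) \<le> (C * real R ^ d) * ((A + 1) * (1 + w R))"
        using C(2)[OF R] V A w[of R] by (intro mult_mono) (auto simp: algebra_simps)
      also have "\<dots> = C * (A + 1) * (real R ^ d * (1 + w R))" by (simp add: mult_ac)
      also have "\<dots> \<le> A' * (real R ^ d * (1 + w R))" using A'(3) w[of R] by (intro mult_right_mono) auto
      finally show ?thesis by simp
    qed
    finally have "real (card \<Omega>) \<le> exp (A' * (real R ^ d * (1 + w R)))" .
    then show "G.has_test_function (A' / real R) (exp (A' * (real R ^ d * (1 + w R))))"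
      using \<Omega> F N shift le A'(1)
      by (intro G.has_test_functionI[of \<Omega> F N "L * (A1 / real R * sqrt N)"]) auto
  qed
  then show ?thesis ..
qed

end

text \<open>
  For large \<open>R\<close> the loss in the Rayleigh quotient is at most one half, where \<open>1 - x \<ge> exp (- 2 x)\<close>.
\<close>

lemma (in fg_group) Phi_tilde_lower_profile:
  assumes \<alpha>: "0 < \<alpha>" "\<alpha> < 2" and prof: "test_profile W A" and W: "\<And>r. 0 \<le> W r"
  shows "\<exists>C>0. \<exists>R0\<ge>1. \<forall>R\<ge>R0. \<forall>n. exp (- (C * (W R + real n * real R powr - \<alpha>))) \<le> Phi_tilde G S \<rho>\<^bsub>\<alpha>\<^esub> n"
proof -
  have A: "A \<ge> 0" using prof by (simp add: test_profile_def)
  define b where "b = 6 * (A + 2)\<^sup>2 / (2 - \<alpha>)"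
  have b: "b > 0" using A \<alpha> by (simp add: b_def)
  have "((\<lambda>R. b * real R powr - \<alpha>) \<longlongrightarrow> b * 0) sequentially"
    using \<alpha> by (intro tendsto_mult tendsto_const tendsto_neg_powr filterlim_real_sequentially) auto
  then have "\<forall>\<^sub>F R in sequentially. b * real R powr - \<alpha> < 1 / 2"
    by (rule order_tendstoD) simp
  then obtain R1 where R1: "\<And>R. R \<ge> R1 \<Longrightarrow> b * real R powr - \<alpha> < 1 / 2"
    unfolding eventually_sequentially by blast
  define C where "C = max A (4 * b)"
  show ?thesis
  proof (intro exI[of _ C] exI[of _ "max 1 R1"] conjI allI impI)
    show "C > 0" using b by (simp add: C_def less_max_iff_disj)
    fix R n assume R: "R \<ge> max 1 R1"
    then have R_ge1: "R \<ge> 1" by simp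
    define x where "x = b * real R powr - \<alpha>"
    have x: "0 \<le> x" "x \<le> 1 / 2" using R1[of R] R b by (auto simp: x_def)
    obtain \<Omega> f where *: "finite \<Omega>" "\<Omega> \<subseteq> carrier G" "\<And>x. 0 \<le> f x" "\<And>x. x \<in> carrier G - \<Omega> \<Longrightarrow> f x = 0"
      "(\<Sum>x\<in>\<Omega>. (f x)\<^sup>2) = 1" "\<And>s. s \<in> S \<Longrightarrow> shift_le f s (A / real R)" and card: "real (card \<Omega>) \<le> exp (A * W R)"
      by (rule has_test_functionE[OF test_profileD[OF prof R_ge1]]) (rule that)
    have Pt: "0 \<le> Phi_tilde G S \<rho>\<^bsub>\<alpha>\<^esub> n" by (rule Phi_tilde_ge) simp
    have "exp (- 2 * x) \<le> 1 - x"
    proof -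
      have "- (2 * x) \<le> ln (1 - x)"
        using ln_one_minus_pos_lower_bound[of x] x mult_mono[of x "1 / 2" x x] by (simp add: power2_eq_square)
      then show ?thesis using x by (simp add: ln_ge_iff)
    qed
    then have "exp (- 2 * x) ^ (2 * n) \<le> (1 - x) ^ (2 * n)" by (intro power_mono) auto
    also have "\<dots> \<le> real (card \<Omega>) * Phi_tilde G S \<rho>\<^bsub>\<alpha>\<^esub> n"
      using Phi_tilde_ge_test_function[OF \<alpha> A R_ge1 *] x unfolding x_def b_def by simp
    also have "\<dots> \<le> exp (A * W R) * Phi_tilde G S \<rho>\<^bsub>\<alpha>\<^esub> n" using card Pt by (intro mult_right_mono)
    also have "exp (- 2 * x) ^ (2 * n) = exp (- 4 * real n * x)"
      by (simp add: exp_of_nat_mult[symmetric] mult_ac)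
    finally have "exp (- (A * W R)) * exp (- 4 * real n * x) \<le> exp (- (A * W R)) * (exp (A * W R) * Phi_tilde G S \<rho>\<^bsub>\<alpha>\<^esub> n)"
      by (intro mult_left_mono) auto
    also have "\<dots> = Phi_tilde G S \<rho>\<^bsub>\<alpha>\<^esub> n" by (simp add: mult.assoc[symmetric] exp_add[symmetric])
    finally have main: "exp (- (A * W R + 4 * b * (real n * real R powr - \<alpha>))) \<le> Phi_tilde G S \<rho>\<^bsub>\<alpha>\<^esub> n"
      by (simp add: exp_add[symmetric] x_def algebra_simps)
    have "A * W R \<le> C * W R" using W by (intro mult_right_mono) (auto simp: C_def)
    moreover have "4 * b * (real n * real R powr - \<alpha>) \<le> C * (real n * real R powr - \<alpha>)"
      by (intro mult_right_mono) (auto simp: C_def)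
    ultimately have "A * W R + 4 * b * (real n * real R powr - \<alpha>) \<le> C * (W R + real n * real R powr - \<alpha>)"
      by (simp add: distrib_left)
    then have "exp (- (C * (W R + real n * real R powr - \<alpha>))) \<le> exp (- (A * W R + 4 * b * (real n * real R powr - \<alpha>)))" by simp
    then show "exp (- (C * (W R + real n * real R powr - \<alpha>))) \<le> Phi_tilde G S \<rho>\<^bsub>\<alpha>\<^esub> n" using main by linarith
  qed simp
qed

section \<open>The lazy jump walk\<close>

context group begin

lemma pmf_map_mult_right:
  assumes "set_pmf \<theta> \<subseteq> carrier G" "y \<in> carrier G" "x \<in> carrier G"
  shows "pmf (map_pmf (\<lambda>z. z \<otimes> y) \<theta>) x = pmf \<theta> (x \<otimes> inv y)"
proof -
  have "pmf (map_pmf (\<lambda>z. z \<otimes> y) \<theta>) x = measure_pmf.prob \<theta> ((\<lambda>z. z \<otimes> y) -` {x})" by (simp add: pmf_map)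
  also have "\<dots> = measure_pmf.prob \<theta> {x \<otimes> inv y}"
  proof (rule measure_pmf.finite_measure_eq_AE)
    show "AE z in measure_pmf \<theta>. (z \<in> (\<lambda>z. z \<otimes> y) -` {x}) = (z \<in> {x \<otimes> inv y})"
    proof (rule AE_pmfI)
      fix z assume "z \<in> set_pmf \<theta>"
      then have z: "z \<in> carrier G" using assms by auto
      have "(x \<otimes> inv y) \<otimes> y = x" "(z \<otimes> y) \<otimes> inv y = z"
        using z assms by (simp_all add: m_assoc)
      then show "(z \<in> (\<lambda>z. z \<otimes> y) -` {x}) = (z \<in> {x \<otimes> inv y})" by auto
    qed
  qed auto
  finally show ?thesis by (simp add: measure_pmf_single)
qed

lemma convolution_map_right:
  "convolution G \<theta> \<nu> = bind_pmf \<nu> (\<lambda>y. map_pmf (\<lambda>x. x \<otimes> y) \<theta>)"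
  unfolding convolution_bind map_pmf_def by (rule bind_commute_pmf)

lemma convolution_bind_left:
  "convolution G (bind_pmf M N) \<nu> = bind_pmf M (\<lambda>i. convolution G (N i) \<nu>)"
  by (simp add: convolution_bind bind_assoc_pmf)

lemma convolution_bind_right:
  "convolution G \<theta> (bind_pmf M N) = bind_pmf M (\<lambda>i. convolution G \<theta> (N i))"
  by (simp add: convolution_map_right bind_assoc_pmf)

text \<open>
  Convolution averages translates, so it cannot increase the largest atom.
\<close>

lemma pmf_convolution_le:
  assumes "set_pmf \<theta> \<subseteq> carrier G" "set_pmf \<nu> \<subseteq> carrier G" "\<And>x. pmf \<theta> x \<le> c"
  shows "pmf (convolution G \<theta> \<nu>) x \<le> c"
proof (cases "x \<in> carrier G")
  case True
  have le: "pmf (map_pmf (\<lambda>z. z \<otimes> y) \<theta>) x \<le> c" if "y \<in> set_pmf \<nu>" for y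
    using pmf_map_mult_right[OF assms(1) _ True, of y] assms that by auto
  have "pmf (convolution G \<theta> \<nu>) x = measure_pmf.expectation \<nu> (\<lambda>y. pmf (map_pmf (\<lambda>z. z \<otimes> y) \<theta>) x)"
    by (simp add: convolution_map_right pmf_bind)
  also have "\<dots> \<le> measure_pmf.expectation \<nu> (\<lambda>_. c)"
  proof (rule integral_mono_AE)
    show "integrable (measure_pmf \<nu>) (\<lambda>y. pmf (map_pmf (\<lambda>z. z \<otimes> y) \<theta>) x)"
      by (rule measure_pmf.integrable_const_bound[where B = 1]) (auto simp: pmf_le_1)
  qed (use le in \<open>auto simp: AE_measure_pmf_iff\<close>)
  finally show ?thesis by simp
next
  case False
  then have "x \<notin> set_pmf (convolution G \<theta> \<nu>)" using set_pmf_convolution[OF assms(1,2)] by auto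
  then have "pmf (convolution G \<theta> \<nu>) x = 0" by (simp only: set_pmf_iff not_not)
  then show ?thesis using assms(3)[of x] pmf_nonneg[of \<theta> x] by linarith
qed

end

context wreath begin

definition switch :: "nat \<Rightarrow> (('h \<Rightarrow> 'k) \<times> 'h) pmf" where
  "switch r = map_pmf lamp (pmf_of_set (K.wball r))"

definition jump :: "nat \<Rightarrow> 'h \<Rightarrow> (('h \<Rightarrow> 'k) \<times> 'h) pmf" where
  "jump r h = conv (conv (switch r) (return_pmf (move h))) (switch r)"

definition lazy_jump :: "real \<Rightarrow> nat \<Rightarrow> (('h \<Rightarrow> 'k) \<times> 'h) pmf" where
  "lazy_jump p r = bind_pmf (bernoulli_pmf p)
    (\<lambda>b. if b then bind_pmf (pmf_of_set (H.wball r)) (jump r) else return_pmf \<e>)"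

text \<open>
  The position is deterministic, only lamps in \<open>A\<close> may be lit, and no configuration has more than the given
  mass. This is what survives of the conditional law of the lamps given the trajectory in \<open>H\<close>: independence of the
  lamps is not recorded, only its effect on the largest atom.
\<close>

definition spread :: "(('h \<Rightarrow> 'k) \<times> 'h) pmf \<Rightarrow> 'h set \<Rightarrow> 'h \<Rightarrow> real \<Rightarrow> bool" where
  "spread \<theta> A h c \<longleftrightarrow> h \<in> carrier H
    \<and> (\<forall>z\<in>set_pmf \<theta>. z \<in> carrier (K \<wr> H) \<and> snd z = h \<and> (\<forall>x\<in>carrier H - A. fst z x = \<one>\<^bsub>K\<^esub>))
    \<and> (\<forall>z. pmf \<theta> z \<le> c)"

lemma wball_K: "finite (K.wball r)" "K.wball r \<noteq> {}" "set_pmf (pmf_of_set (K.wball r)) = K.wball r"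
proof -
  show ne: "K.wball r \<noteq> {}" using K.one_in_wball[of r] by blast
  show "finite (K.wball r)" by simp
  then show "set_pmf (pmf_of_set (K.wball r)) = K.wball r" using ne by (intro set_pmf_of_set)
qed

lemma wball_H: "finite (H.wball r)" "H.wball r \<noteq> {}" "set_pmf (pmf_of_set (H.wball r)) = H.wball r"
proof -
  show ne: "H.wball r \<noteq> {}" using H.one_in_wball[of r] by blast
  show "finite (H.wball r)" by simp
  then show "set_pmf (pmf_of_set (H.wball r)) = H.wball r" using ne by (intro set_pmf_of_set)
qed

lemma set_switch: "set_pmf (switch r) = lamp ` K.wball r"
  by (simp add: switch_def wball_K)

lemma switch_closed: "set_pmf (switch r) \<subseteq> carrier (K \<wr> H)"
  using K.wball_carrier lamp_closed unfolding set_switch by blast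

lemma jump_closed: "h \<in> carrier H \<Longrightarrow> set_pmf (jump r h) \<subseteq> carrier (K \<wr> H)"
  unfolding jump_def by (intro G.set_pmf_convolution switch_closed) (simp add: move_closed)

lemma lazy_jump_closed: "set_pmf (lazy_jump p r) \<subseteq> carrier (K \<wr> H)"
proof -
  have "set_pmf (if b then bind_pmf (pmf_of_set (H.wball r)) (jump r) else return_pmf \<e>) \<subseteq> carrier (K \<wr> H)" for b
    using jump_closed H.wball_carrier by (auto simp: wball_H)
  then show ?thesis unfolding lazy_jump_def set_bind_pmf by (intro UN_least)
qed

lemma spread_closed: "spread \<theta> A h c \<Longrightarrow> set_pmf \<theta> \<subseteq> carrier (K \<wr> H)"
  by (auto simp: spread_def)

text \<open>
  If the lamp at \<open>h\<close> was off for sure, the final state of that lamp reveals which \<open>k\<close> was drawn, so only one of the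
  \<open>card (K.wball r)\<close> equally likely draws contributes to a given configuration. If it may have been lit
  already, averaging still cannot increase the largest atom.
\<close>

lemma spread_switch:
  assumes sp: "spread \<theta> A h (\<epsilon> ^ card A)" and A: "finite A" and \<epsilon>: "\<epsilon> = 1 / real (card (K.wball r))"
  shows "spread (conv \<theta> (switch r)) (insert h A) h (\<epsilon> ^ card (insert h A))"
proof -
  let ?c = "\<epsilon> ^ card A"
  note \<theta> = spread_closed[OF sp]
  have h: "h \<in> carrier H" using sp by (simp add: spread_def)
  have le: "pmf \<theta> z \<le> ?c" for z using sp unfolding spread_def by blast
  have sub: "set_pmf (conv \<theta> (switch r)) \<subseteq> carrier (K \<wr> H)"
    using \<theta> switch_closed by (rule G.set_pmf_convolution)
  have supp: "snd z = h \<and> (\<forall>x\<in>carrier H - insert h A. fst z x = \<one>\<^bsub>K\<^esub>)"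
    if z: "z \<in> set_pmf (conv \<theta> (switch r))" for z
  proof -
    obtain y k where y: "y \<in> set_pmf \<theta>" and k: "k \<in> K.wball r" and zy: "z = y \<star> lamp k"
      using z by (auto simp: G.convolution_bind set_switch)
    obtain f where f: "y = (f, h)" using y sp by (cases y) (auto simp: spread_def)
    have "z = (f(h := f h \<otimes>\<^bsub>K\<^esub> k), h)"
      unfolding zy f using y \<theta> k K.wball_carrier f by (intro mult_lamp) auto
    then show ?thesis using y f sp by (auto simp: spread_def)
  qed
  have "pmf (conv \<theta> (switch r)) z \<le> \<epsilon> ^ card (insert h A)" for z
  proof (cases "h \<in> A")
    case True
    then show ?thesis using G.pmf_convolution_le[OF \<theta> switch_closed le] by (simp add: insert_absorb)
  next
    case hA: False
    show ?thesis
    proof (cases "z \<in> set_pmf (conv \<theta> (switch r))")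
      case False
      then have "pmf (conv \<theta> (switch r)) z = 0" by (simp only: set_pmf_iff not_not)
      then show ?thesis by (simp add: \<epsilon>)
    next
      case True
      then have zc: "z \<in> carrier (K \<wr> H)" using sub by blast
      obtain f where z: "z = (f, h)" using supp[OF True] by (cases z) auto
      have fh: "f h \<in> carrier K" using zc z h by (auto simp: in_carrier_wreath)
      have val: "pmf (map_pmf (\<lambda>y. y \<star> lamp k) \<theta>) z \<le> (if k = f h then ?c else 0)" if k: "k \<in> K.wball r" for k
      proof -
        have kc: "k \<in> carrier K" using k K.wball_carrier by auto
        have eq: "pmf (map_pmf (\<lambda>y. y \<star> lamp k) \<theta>) z = pmf \<theta> (f(h := f h \<otimes>\<^bsub>K\<^esub> inv\<^bsub>K\<^esub> k), h)"
          using G.pmf_map_mult_right[OF \<theta> lamp_closed[OF kc] zc] mult_lamp[of f h "inv\<^bsub>K\<^esub> k"] zc kc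
          by (simp add: lamp_inv z)
        show ?thesis
        proof (cases "k = f h")
          case True
          then show ?thesis using eq le by simp
        next
          case False
          then have ne: "f h \<otimes>\<^bsub>K\<^esub> inv\<^bsub>K\<^esub> k \<noteq> \<one>\<^bsub>K\<^esub>"
            using kc fh by (metis K.inv_closed K.inv_equality K.inv_inv)
          have "(f(h := f h \<otimes>\<^bsub>K\<^esub> inv\<^bsub>K\<^esub> k), h) \<notin> set_pmf \<theta>"
          proof
            assume "(f(h := f h \<otimes>\<^bsub>K\<^esub> inv\<^bsub>K\<^esub> k), h) \<in> set_pmf \<theta>"
            then have "fst (f(h := f h \<otimes>\<^bsub>K\<^esub> inv\<^bsub>K\<^esub> k), h) h = \<one>\<^bsub>K\<^esub>" using sp h hA unfolding spread_def by blast
            then show False using ne by simp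
          qed
          then show ?thesis using eq False by (simp add: set_pmf_iff)
        qed
      qed
      have "pmf (conv \<theta> (switch r)) z
          = measure_pmf.expectation (pmf_of_set (K.wball r)) (\<lambda>k. pmf (map_pmf (\<lambda>y. y \<star> lamp k) \<theta>) z)"
        by (simp add: G.convolution_map_right switch_def bind_map_pmf pmf_bind)
      also have "\<dots> = (\<Sum>k\<in>K.wball r. pmf (map_pmf (\<lambda>y. y \<star> lamp k) \<theta>) z) / real (card (K.wball r))"
        using wball_K by (simp add: integral_pmf_of_set)
      also have "\<dots> \<le> (\<Sum>k\<in>K.wball r. if k = f h then ?c else 0) / real (card (K.wball r))"
        using val by (intro divide_right_mono sum_mono) auto
      also have "\<dots> \<le> ?c / real (card (K.wball r))"
        using wball_K by (intro divide_right_mono) (auto simp: \<epsilon>)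
      also have "\<dots> = \<epsilon> ^ card (insert h A)" using hA A by (simp add: \<epsilon>)
      finally show ?thesis .
    qed
  qed
  then show ?thesis using supp sub h unfolding spread_def by blast
qed

lemma spread_move:
  assumes sp: "spread \<theta> A h c" and h': "h' \<in> carrier H"
  shows "spread (conv \<theta> (return_pmf (move h'))) A (h \<otimes>\<^bsub>H\<^esub> h') c"
proof -
  note \<theta> = spread_closed[OF sp]
  have h: "h \<in> carrier H" using sp by (simp add: spread_def)
  have mv: "set_pmf (return_pmf (move h')) \<subseteq> carrier (K \<wr> H)" using move_closed[OF h'] by simp
  have le: "pmf \<theta> z \<le> c" for z using sp unfolding spread_def by blast
  have "z \<in> carrier (K \<wr> H) \<and> snd z = h \<otimes>\<^bsub>H\<^esub> h' \<and> (\<forall>x\<in>carrier H - A. fst z x = \<one>\<^bsub>K\<^esub>)"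
    if z: "z \<in> set_pmf (conv \<theta> (return_pmf (move h')))" for z
  proof -
    obtain y where y: "y \<in> set_pmf \<theta>" and zy: "z = y \<star> move h'"
      using z by (auto simp: G.convolution_bind)
    obtain f where f: "y = (f, h)" using y sp by (cases y) (auto simp: spread_def)
    have "(f, h) \<in> carrier (K \<wr> H)" using y \<theta> f by auto
    then have "z = (f, h \<otimes>\<^bsub>H\<^esub> h')" unfolding zy f using h' by (intro mult_move)
    moreover have "z \<in> carrier (K \<wr> H)" using G.set_pmf_convolution[OF \<theta> mv] z by blast
    ultimately show ?thesis using y f sp by (auto simp: spread_def)
  qed
  then show ?thesis
    using G.pmf_convolution_le[OF \<theta> mv le] h h' unfolding spread_def by blast
qed

lemma spread_jump:
  assumes sp: "spread \<theta> A h (\<epsilon> ^ card A)" and A: "finite A" and \<epsilon>: "\<epsilon> = 1 / real (card (K.wball r))"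
    and h': "h' \<in> carrier H"
  defines "A' \<equiv> insert (h \<otimes>\<^bsub>H\<^esub> h') (insert h A)"
  shows "spread (conv \<theta> (jump r h')) A' (h \<otimes>\<^bsub>H\<^esub> h') (\<epsilon> ^ card A')"
proof -
  have mv: "set_pmf (return_pmf (move h')) \<subseteq> carrier (K \<wr> H)" using move_closed[OF h'] by simp
  note \<theta> = spread_closed[OF sp]
  have "conv \<theta> (jump r h')
      = conv (conv (conv \<theta> (switch r)) (return_pmf (move h'))) (switch r)"
    unfolding jump_def using \<theta> switch_closed mv
    by (simp only: G.convolution_assoc G.set_pmf_convolution)
  moreover have "spread (conv \<theta> (switch r)) (insert h A) h (\<epsilon> ^ card (insert h A))"
    using sp A \<epsilon> by (rule spread_switch)
  ultimately show ?thesis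
    unfolding A'_def using A \<epsilon> spread_move[OF _ h'] by (simp only:) (intro spread_switch, auto)
qed

text \<open>
  Induction on the remaining steps. Once \<open>A\<close> holds a quarter of the volume of the ball, the largest atom is
  already below the first summand and stays there. Before that, at most a quarter of the targets of a jump lie in
  \<open>A\<close>, and each fresh target at least halves the largest atom, so that a jump multiplies the second summand by at
  most \<open>1 / 4 + 3 / 4 * (1 / 2) = 5 / 8\<close> on average, and a step of the lazy walk by \<open>(1 - p) + 5 / 8 * p\<close>.
\<close>

lemma spread_return_bound:
  assumes p: "0 \<le> p" "p \<le> 1" and \<epsilon>: "\<epsilon> = 1 / real (card (K.wball r))" and two: "2 \<le> card (K.wball r)"
    and sp: "spread \<theta> A h (\<epsilon> ^ card A)" and A: "finite A"
  shows "pmf (conv \<theta> (conv_power (K \<wr> H) (lazy_jump p r) m)) z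
    \<le> \<epsilon> powr (real (card (H.wball r)) / 4) + \<epsilon> ^ card A * (1 - 3 / 8 * p) ^ m"
  using sp A
proof (induction m arbitrary: \<theta> A h)
  case 0
  have "pmf \<theta> z \<le> \<epsilon> ^ card A" using 0(1) unfolding spread_def by blast
  then show ?case
    using G.convolution_one(1)[OF spread_closed[OF 0(1)]] by (simp add: G.conv_power_0 add_increasing)
next
  case (Suc m)
  define V where "V = real (card (H.wball r))"
  define L where "L = \<epsilon> powr (V / 4)"
  define q where "q = 1 - 3 / 8 * p"
  define P where "P = conv_power (K \<wr> H) (lazy_jump p r) m"
  have V: "V > 0" using wball_H by (simp add: V_def card_gt_0_iff)
  have \<epsilon>01: "0 < \<epsilon>" "\<epsilon> \<le> 1 / 2" using two unfolding \<epsilon> by (auto simp: field_simps)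
  have q: "0 \<le> q" "q \<le> 1" using p by (auto simp: q_def)
  note \<theta> = spread_closed[OF Suc.prems(1)]
  have Pc: "set_pmf P \<subseteq> carrier (K \<wr> H)" unfolding P_def by (rule G.set_pmf_conv_power[OF lazy_jump_closed])
  have IH: "pmf (conv \<theta>' P) z \<le> L + \<epsilon> ^ card A' * q ^ m" if "spread \<theta>' A' h' (\<epsilon> ^ card A')" "finite A'" for \<theta>' A' h'
    using Suc.IH[OF that] by (simp add: L_def V_def q_def P_def)
  have h: "h \<in> carrier H" using Suc.prems by (simp add: spread_def)
  have "pmf (conv \<theta> (conv_power (K \<wr> H) (lazy_jump p r) (Suc m))) z \<le> L + \<epsilon> ^ card A * q ^ Suc m"
  proof (cases "real (card A) \<ge> V / 4")
    case True
    have "pmf (conv \<theta> (conv_power (K \<wr> H) (lazy_jump p r) (Suc m))) z \<le> \<epsilon> ^ card A"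
    proof (intro G.pmf_convolution_le \<theta> G.set_pmf_conv_power lazy_jump_closed)
      show "pmf \<theta> y \<le> \<epsilon> ^ card A" for y using Suc.prems(1) unfolding spread_def by blast
    qed
    also have "\<dots> = \<epsilon> powr real (card A)" using \<epsilon>01 by (simp add: powr_realpow)
    also have "\<dots> \<le> L" unfolding L_def using True \<epsilon>01 by (intro powr_mono') auto
    finally show ?thesis using \<epsilon>01 q by (simp add: add_increasing2)
  next
    case False
    have jump_bound: "pmf (conv (conv \<theta> (jump r h')) P) z
        \<le> L + \<epsilon> ^ card A * q ^ m * (if h \<otimes>\<^bsub>H\<^esub> h' \<in> A then 1 else 1 / 2)" if "h' \<in> H.wball r" for h'
    proof -
      have h': "h' \<in> carrier H" using that H.wball_carrier by auto
      let ?A' = "insert (h \<otimes>\<^bsub>H\<^esub> h') (insert h A)"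
      have "pmf (conv (conv \<theta> (jump r h')) P) z \<le> L + \<epsilon> ^ card ?A' * q ^ m"
        using Suc.prems by (intro IH[OF spread_jump[OF _ _ \<epsilon> h']]) auto
      also have "\<epsilon> ^ card ?A' \<le> \<epsilon> ^ card A * (if h \<otimes>\<^bsub>H\<^esub> h' \<in> A then 1 else 1 / 2)"
      proof (cases "h \<otimes>\<^bsub>H\<^esub> h' \<in> A")
        case True
        have "card A \<le> card ?A'" using Suc.prems by (intro card_mono) auto
        then show ?thesis using True \<epsilon>01 by (simp add: power_decreasing)
      next
        case False
        have "card (insert (h \<otimes>\<^bsub>H\<^esub> h') A) \<le> card ?A'" using Suc.prems by (intro card_mono) auto
        then have "Suc (card A) \<le> card ?A'" using False Suc.prems by simp
        then have "\<epsilon> ^ card ?A' \<le> \<epsilon> ^ Suc (card A)" using \<epsilon>01 by (intro power_decreasing) auto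
        also have "\<dots> \<le> \<epsilon> ^ card A * (1 / 2)" using \<epsilon>01 by simp
        finally show ?thesis using False by simp
      qed
      finally show ?thesis using q by (simp add: mult_right_mono mult_ac)
    qed
    have count: "(\<Sum>h'\<in>H.wball r. (if h \<otimes>\<^bsub>H\<^esub> h' \<in> A then 1 else 1 / 2 :: real)) \<le> 5 / 8 * V"
    proof -
      have "(\<Sum>h'\<in>H.wball r. (if h \<otimes>\<^bsub>H\<^esub> h' \<in> A then 1 else 1 / 2 :: real))
          = (\<Sum>h'\<in>H.wball r. 1 / 2 + (if h \<otimes>\<^bsub>H\<^esub> h' \<in> A then 1 / 2 else 0))"
        by (intro sum.cong refl) auto
      also have "\<dots> = V / 2 + real (card {h' \<in> H.wball r. h \<otimes>\<^bsub>H\<^esub> h' \<in> A}) / 2"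
        using wball_H by (simp add: sum.distrib V_def sum.If_cases Int_def)
      also have "card {h' \<in> H.wball r. h \<otimes>\<^bsub>H\<^esub> h' \<in> A} \<le> card A"
      proof (rule card_inj_on_le)
        show "inj_on (\<lambda>h'. h \<otimes>\<^bsub>H\<^esub> h') {h' \<in> H.wball r. h \<otimes>\<^bsub>H\<^esub> h' \<in> A}"
          using h H.wball_carrier by (auto intro!: inj_onI simp: subset_iff)
      qed (use Suc.prems in auto)
      finally show ?thesis using False by simp
    qed
    have stay: "pmf (conv (conv \<theta> (return_pmf \<e>)) P) z \<le> L + \<epsilon> ^ card A * q ^ m"
      using IH[OF Suc.prems] G.convolution_one(1)[OF \<theta>] by simp
    have go: "pmf (conv (conv \<theta> (bind_pmf (pmf_of_set (H.wball r)) (jump r))) P) z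
        \<le> L + \<epsilon> ^ card A * q ^ m * (5 / 8)"
    proof -
      have "pmf (conv (conv \<theta> (bind_pmf (pmf_of_set (H.wball r)) (jump r))) P) z
          = (\<Sum>h'\<in>H.wball r. pmf (conv (conv \<theta> (jump r h')) P) z) / V"
        using wball_H by (simp add: G.convolution_bind_right G.convolution_bind_left pmf_bind integral_pmf_of_set V_def)
      also have "\<dots> \<le> (\<Sum>h'\<in>H.wball r. L + \<epsilon> ^ card A * q ^ m * (if h \<otimes>\<^bsub>H\<^esub> h' \<in> A then 1 else 1 / 2)) / V"
        using jump_bound V by (intro divide_right_mono sum_mono) auto
      also have "\<dots> = L + \<epsilon> ^ card A * q ^ m * (\<Sum>h'\<in>H.wball r. (if h \<otimes>\<^bsub>H\<^esub> h' \<in> A then 1 else 1 / 2)) / V"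
        using V wball_H by (simp add: sum.distrib sum_distrib_left add_divide_distrib V_def)
      also have "\<dots> \<le> L + \<epsilon> ^ card A * q ^ m * (5 / 8 * V) / V"
        using count \<epsilon>01 q V by (intro add_left_mono divide_right_mono mult_left_mono) auto
      finally show ?thesis using V by simp
    qed
    have "conv \<theta> (conv_power (K \<wr> H) (lazy_jump p r) (Suc m)) = conv (conv \<theta> (lazy_jump p r)) P"
      unfolding G.conv_power_Suc P_def[symmetric] using G.convolution_assoc[OF \<theta> lazy_jump_closed Pc] by simp
    also have "pmf \<dots> z = p * pmf (conv (conv \<theta> (bind_pmf (pmf_of_set (H.wball r)) (jump r))) P) z
        + (1 - p) * pmf (conv (conv \<theta> (return_pmf \<e>)) P) z"
      unfolding lazy_jump_def G.convolution_bind_right[of _ "bernoulli_pmf p"] G.convolution_bind_left[of "bernoulli_pmf p"]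
      using p by (simp add: pmf_bind[of "bernoulli_pmf p"])
    also have "\<dots> \<le> p * (L + \<epsilon> ^ card A * q ^ m * (5 / 8)) + (1 - p) * (L + \<epsilon> ^ card A * q ^ m)"
      using go stay p by (intro add_mono mult_left_mono) auto
    also have "\<dots> = L + \<epsilon> ^ card A * q ^ Suc m" by (simp add: q_def algebra_simps)
    finally show ?thesis .
  qed
  then show ?case by (simp add: L_def V_def q_def)
qed

lemma symmetric_switch: "map_pmf (m_inv (K \<wr> H)) (switch r) = switch r"
proof -
  have "m_inv K ` K.wball r = K.wball r"
    using K.inv_wball K.wball_carrier by (force simp: image_iff subset_iff)
  then have "map_pmf (m_inv K) (pmf_of_set (K.wball r)) = pmf_of_set (K.wball r)"
    using wball_K K.wball_carrier inj_on_subset[OF K.inj_on_inv]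
    by (subst map_pmf_of_set_inj) auto
  then have *: "map_pmf lamp (map_pmf (m_inv K) (pmf_of_set (K.wball r))) = switch r" by (simp add: switch_def)
  have "map_pmf (m_inv (K \<wr> H)) (switch r) = map_pmf lamp (map_pmf (m_inv K) (pmf_of_set (K.wball r)))"
    unfolding switch_def map_pmf_comp
    using K.wball_carrier by (intro map_pmf_cong refl) (auto simp: wball_K lamp_inv subset_iff)
  then show ?thesis unfolding * .
qed

text \<open>
  A jump is a palindrome of independent symmetric factors around the move.
\<close>

lemma symmetric_lazy_jump: "symmetric_probability (K \<wr> H) (lazy_jump p r)"
proof -
  let ?inv = "m_inv (K \<wr> H)"
  have jump: "map_pmf ?inv (jump r h) = jump r (inv\<^bsub>H\<^esub> h)" if h: "h \<in> carrier H" for h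
  proof -
    have mv: "set_pmf (return_pmf (move h)) \<subseteq> carrier (K \<wr> H)" "set_pmf (return_pmf (move (inv\<^bsub>H\<^esub> h))) \<subseteq> carrier (K \<wr> H)"
      using move_closed h by auto
    have "map_pmf ?inv (jump r h) = conv (switch r) (conv (return_pmf (move (inv\<^bsub>H\<^esub> h))) (switch r))"
      unfolding jump_def using mv switch_closed h
      by (simp add: G.map_inv_convolution G.set_pmf_convolution symmetric_switch move_inv)
    then show ?thesis unfolding jump_def using G.convolution_assoc[OF switch_closed mv(2) switch_closed] by simp
  qed
  have "m_inv H ` H.wball r = H.wball r"
    using H.inv_wball H.wball_carrier by (force simp: image_iff subset_iff)
  then have inv_ball: "map_pmf (m_inv H) (pmf_of_set (H.wball r)) = pmf_of_set (H.wball r)"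
    using wball_H H.wball_carrier inj_on_subset[OF H.inj_on_inv] by (subst map_pmf_of_set_inj) auto
  have "map_pmf ?inv (bind_pmf (pmf_of_set (H.wball r)) (jump r))
      = bind_pmf (pmf_of_set (H.wball r)) (\<lambda>h. jump r (inv\<^bsub>H\<^esub> h))"
    unfolding map_bind_pmf using H.wball_carrier by (intro bind_pmf_cong refl jump) (auto simp: wball_H)
  also have "\<dots> = bind_pmf (map_pmf (m_inv H) (pmf_of_set (H.wball r))) (jump r)" by (simp add: bind_map_pmf)
  finally have go: "map_pmf ?inv (bind_pmf (pmf_of_set (H.wball r)) (jump r)) = bind_pmf (pmf_of_set (H.wball r)) (jump r)"
    unfolding inv_ball .
  have "map_pmf ?inv (lazy_jump p r) = lazy_jump p r"
    unfolding lazy_jump_def map_bind_pmf by (intro bind_pmf_cong refl) (auto simp: go simp flip: map_bind_pmf)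
  then show ?thesis using lazy_jump_closed by (simp add: G.symmetric_probability_iff)
qed

lemma wl_lamp_move_le:
  "\<exists>C. (\<forall>k\<in>carrier K. G.wl (lamp k) \<le> C * K.wl k) \<and> (\<forall>h\<in>carrier H. G.wl (move h) \<le> C * H.wl h)"
proof -
  define C where "C = (\<Sum>s\<in>SK. G.wl (lamp s)) + (\<Sum>s\<in>SH. G.wl (move s))"
  have lampC: "G.wl (lamp s) \<le> C" if "s \<in> SK" for s
    using member_le_sum[OF that, of "\<lambda>s. G.wl (lamp s)"] K.finite_S by (simp add: C_def)
  have moveC: "G.wl (move s) \<le> C" if "s \<in> SH" for s
    using member_le_sum[OF that, of "\<lambda>s. G.wl (move s)"] H.finite_S by (simp add: C_def)
  have mult: "real (G.wl (x \<star> y)) \<le> r + t"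
    if "x \<in> carrier (K \<wr> H)" "y \<in> carrier (K \<wr> H)" "real (G.wl x) \<le> r" "real (G.wl y) \<le> t" for x y r t
    using G.wl_mult[OF that(1,2)] that(3,4) by linarith
  have "real (G.wl (lamp k)) \<le> real (K.wl k) * real C" if "k \<in> carrier K" for k
    by (rule K.wl_induct_bound[where P = "\<lambda>g r. real (G.wl (lamp g)) \<le> r"])
      (auto simp: lamp_one lamp_mult lampC that intro: mult lamp_closed)
  then have 1: "G.wl (lamp k) \<le> C * K.wl k" if "k \<in> carrier K" for k
    using that by (metis mult.commute of_nat_le_iff of_nat_mult)
  have "real (G.wl (move h)) \<le> real (H.wl h) * real C" if "h \<in> carrier H" for h
    by (rule H.wl_induct_bound[where P = "\<lambda>g r. real (G.wl (move g)) \<le> r"])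
      (auto simp: move_one move_mult moveC that intro: mult move_closed)
  then have 2: "G.wl (move h) \<le> C * H.wl h" if "h \<in> carrier H" for h
    using that by (metis mult.commute of_nat_le_iff of_nat_mult)
  show ?thesis using 1 2 by blast
qed

text \<open>
  A jump consists of three factors, each of length at most a multiple of \<open>r\<close>.
\<close>

lemma lazy_jump_range:
  "\<exists>C. \<forall>p r. \<forall>z\<in>set_pmf (lazy_jump p r). G.wl z \<le> C * r"
proof -
  obtain C where C: "\<And>k. k \<in> carrier K \<Longrightarrow> G.wl (lamp k) \<le> C * K.wl k" "\<And>h. h \<in> carrier H \<Longrightarrow> G.wl (move h) \<le> C * H.wl h"
    using wl_lamp_move_le by blast
  have "G.wl z \<le> (3 * C) * r" if z: "z \<in> set_pmf (lazy_jump p r)" for p r z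
  proof (cases "z = \<e>")
    case False
    then obtain h where h: "h \<in> H.wball r" and "z \<in> set_pmf (jump r h)"
      using z by (auto simp: lazy_jump_def wball_H split: if_splits)
    then obtain k k' where k: "k \<in> K.wball r" "k' \<in> K.wball r" and zk: "z = (lamp k \<star> move h) \<star> lamp k'"
      by (auto simp: jump_def G.convolution_bind set_switch)
    have c: "h \<in> carrier H" "k \<in> carrier K" "k' \<in> carrier K" using h k K.wball_carrier H.wball_carrier by auto
    have le: "G.wl (lamp k) \<le> C * r" "G.wl (lamp k') \<le> C * r" "G.wl (move h) \<le> C * r"
      using C(1)[OF c(2)] C(1)[OF c(3)] C(2)[OF c(1)] h k
      by (auto simp: K.wball_def H.wball_def intro: order_trans mult_le_mono2)
    have "G.wl z \<le> G.wl (lamp k \<star> move h) + G.wl (lamp k')"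
      unfolding zk using c by (intro G.wl_mult G.m_closed lamp_closed move_closed)
    also have "G.wl (lamp k \<star> move h) \<le> G.wl (lamp k) + G.wl (move h)"
      using c by (intro G.wl_mult lamp_closed move_closed)
    finally show ?thesis using le by (simp add: algebra_simps)
  qed simp
  then show ?thesis by (intro exI[of _ "3 * C"]) auto
qed

text \<open>
  For a threshold \<open>s\<close> between \<open>1\<close> and \<open>(1 + D) powr \<alpha>\<close> the event excludes the identity, so its probability is at
  most \<open>p \<le> 1 / s\<close>; for larger thresholds no step of the walk is long enough.
\<close>

lemma weak_moment_lazy_jump:
  assumes \<alpha>: "0 < \<alpha>" and range: "\<And>z. z \<in> set_pmf (lazy_jump p r) \<Longrightarrow> G.wl z \<le> D" and p: "p = (1 + real D) powr - \<alpha>"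
  shows "weak_moment (K \<wr> H) SG \<rho>\<^bsub>\<alpha>\<^esub> (lazy_jump p r) \<le> ereal (2 * \<rho>\<^bsub>\<alpha>\<^esub> 0)"
  unfolding weak_moment_def
proof (rule SUP_least)
  fix s :: real assume "s \<in> {0<..}"
  then have s: "s > 0" by simp
  have p01: "0 \<le> p" "p \<le> 1" using \<alpha> unfolding p by (auto simp: powr_minus field_simps ge_one_powr_ge_zero)
  let ?E = "{g \<in> carrier (K \<wr> H). s < \<rho>\<^bsub>\<alpha>\<^esub> (real (G.wl g))}"
  let ?P = "measure_pmf.prob (lazy_jump p r)"
  have "s * ?P ?E \<le> 1"
  proof (cases "s \<le> 1")
    case True
    then show ?thesis using s by (intro mult_le_one) auto
  next
    case s1: False
    show ?thesis
    proof (cases "s < (1 + real D) powr \<alpha>")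
      case False
      have "(1 + real (G.wl z)) powr \<alpha> \<le> s" if "z \<in> set_pmf (lazy_jump p r)" for z
        using range[OF that] False \<alpha> powr_mono2[of \<alpha> "1 + real (G.wl z)" "1 + real D"] by simp
      then have "set_pmf (lazy_jump p r) \<inter> ?E = {}" by (force simp: power_moment_def)
      then have "?P ?E = 0" by (simp add: measure_pmf_zero_iff)
      then show ?thesis by simp
    next
      case True
      have "?P ?E \<le> ?P (- {\<e>})"
        using s1 by (intro measure_pmf.finite_measure_mono) (auto simp: power_moment_def)
      also have "\<dots> = 1 - pmf (lazy_jump p r) \<e>"
        using measure_pmf.prob_compl[of "{\<e>}" "lazy_jump p r"] by (simp add: Compl_eq_Diff_UNIV measure_pmf_single)
      also have "\<dots> \<le> p"
      proof -
        have "pmf (lazy_jump p r) \<e>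
            = p * pmf (bind_pmf (pmf_of_set (H.wball r)) (jump r)) \<e> + (1 - p)"
          unfolding lazy_jump_def using p01 by (simp add: pmf_bind[of "bernoulli_pmf p"])
        then show ?thesis using p01 by (simp add: mult_nonneg_nonneg)
      qed
      finally have "s * ?P ?E \<le> (1 + real D) powr \<alpha> * p" using True s p01 by (intro mult_mono) auto
      also have "\<dots> = 1" unfolding p by (simp add: powr_minus)
      finally show ?thesis .
    qed
  qed
  then show "ereal (s * ?P ?E) \<le> ereal (2 * \<rho>\<^bsub>\<alpha>\<^esub> 0)" by (simp add: power_moment_def)
qed

lemma Phi_tilde_upper:
  assumes \<alpha>: "0 < \<alpha>" and K: "carrier K \<noteq> {\<one>\<^bsub>K\<^esub>}"
  shows "\<exists>c>0. \<forall>r\<ge>1. \<forall>n. Phi_tilde (K \<wr> H) SG \<rho>\<^bsub>\<alpha>\<^esub> n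
    \<le> exp (- (volume H SH r * ln (volume K SK r) / 4)) + exp (- (c * real n * real r powr - \<alpha>))"
proof -
  obtain C where C: "\<And>p r z. z \<in> set_pmf (lazy_jump p r) \<Longrightarrow> G.wl z \<le> C * r"
    using lazy_jump_range by blast
  define c where "c = 3 / 4 * (1 + real C) powr - \<alpha>"
  have "c > 0" by (simp add: c_def)
  moreover have "Phi_tilde (K \<wr> H) SG \<rho>\<^bsub>\<alpha>\<^esub> n
      \<le> exp (- (volume H SH r * ln (volume K SK r) / 4)) + exp (- (c * real n * real r powr - \<alpha>))" if r: "r \<ge> 1" for r n
  proof -
    define p where "p = (1 + real (C * r)) powr - \<alpha>"
    define \<epsilon> where "\<epsilon> = 1 / real (card (K.wball r))"
    have p01: "0 \<le> p" "p \<le> 1"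
      using \<alpha> powr_mono[of "- \<alpha>" 0 "1 + real (C * r)"] unfolding p_def by (auto split: if_splits)
    have two: "2 \<le> card (K.wball r)" using K.card_wball_ge_2[OF K r] .
    have sp: "spread (return_pmf \<e>) {} \<one>\<^bsub>H\<^esub> (\<epsilon> ^ card {})"
    proof -
      have "snd \<e> = \<one>\<^bsub>H\<^esub>" "\<And>x. x \<in> carrier H \<Longrightarrow> fst \<e> x = \<one>\<^bsub>K\<^esub>"
        by (simp_all add: one_wreath)
      then show ?thesis by (auto simp: spread_def pmf_le_1)
    qed
    have "Phi_tilde (K \<wr> H) SG \<rho>\<^bsub>\<alpha>\<^esub> n \<le> pmf (conv_power (K \<wr> H) (lazy_jump p r) (2 * n)) \<e>"
      using C by (intro G.Phi_tilde_le symmetric_lazy_jump weak_moment_lazy_jump[OF \<alpha> _ p_def])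
    also have "\<dots> = pmf (conv (return_pmf \<e>) (conv_power (K \<wr> H) (lazy_jump p r) (2 * n))) \<e>"
      using G.convolution_one(2)[OF G.set_pmf_conv_power[OF lazy_jump_closed]] by simp
    also have "\<dots> \<le> \<epsilon> powr (real (card (H.wball r)) / 4) + \<epsilon> ^ card {} * (1 - 3 / 8 * p) ^ (2 * n)"
      using spread_return_bound[OF p01 \<epsilon>_def two sp] by simp
    also have "\<epsilon> powr (real (card (H.wball r)) / 4) = exp (- (volume H SH r * ln (volume K SK r) / 4))"
      using two wball_K by (simp add: powr_def \<epsilon>_def ln_div H.volume_eq K.volume_eq)
    also have "\<epsilon> ^ card {} * (1 - 3 / 8 * p) ^ (2 * n) \<le> exp (- (c * real n * real r powr - \<alpha>))"
    proof -
      have "(1 - 3 / 8 * p) ^ (2 * n) \<le> exp (- (3 / 8 * p)) ^ (2 * n)"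
        using p01 exp_ge_add_one_self[of "- (3 / 8 * p)"] by (intro power_mono) auto
      also have "\<dots> = exp (- (3 / 4 * p * real n))" by (simp add: exp_of_nat_mult[symmetric])
      also have "\<dots> \<le> exp (- (c * real n * real r powr - \<alpha>))"
      proof -
        have "((1 + real C) * real r) powr - \<alpha> \<le> p"
          unfolding p_def using r \<alpha> by (intro powr_mono2') (auto simp: distrib_right add_pos_nonneg)
        then have "(1 + real C) powr - \<alpha> * real r powr - \<alpha> \<le> p" by (simp add: powr_mult)
        then have "(3 / 4 * real n) * ((1 + real C) powr - \<alpha> * real r powr - \<alpha>) \<le> (3 / 4 * real n) * p"
          by (rule mult_left_mono) simp
        then show ?thesis by (simp add: c_def mult_ac)
      qed
      finally show ?thesis by simp
    qed
    finally show ?thesis by simp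
  qed
  ultimately show ?thesis by blast
qed

end

section \<open>Optimising the radius\<close>

lemma growth_equiv_cong:
  assumes "f \<simeq> g" "\<forall>\<^sub>F t in at_top. g t = g' t" shows "f \<simeq> g'"
proof -
  obtain c1 c2 c3 c4 where c: "c1 > 0" "c2 > 0" "c3 > 0" "c4 > 0"
    and ev: "\<forall>\<^sub>F t in at_top. c1 * f (c2 * t) \<le> g t \<and> g t \<le> c3 * f (c4 * t)"
    using assms(1) unfolding growth_equiv_def by blast
  have "\<forall>\<^sub>F t in at_top. c1 * f (c2 * t) \<le> g' t \<and> g' t \<le> c3 * f (c4 * t)"
    using ev assms(2) by eventually_elim simp
  then show ?thesis unfolding growth_equiv_def using c by blast
qed

text \<open>
  The scale \<open>s\<close> is chosen such that the rate at time \<open>t\<close> is \<open>t * s t powr - \<alpha>\<close>, the cost of the steps at radius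
  \<open>s t\<close>. For an upper bound the radius is enlarged by a constant factor so that the volume cost dominates the rate, and
  then time is stretched; for a lower bound both are shrunk instead.
\<close>

lemma growth_equiv_optimize:
  fixes \<alpha> c C :: real and \<kappa> :: "nat \<Rightarrow> real" and s :: "real \<Rightarrow> real"
  assumes \<alpha>: "0 < \<alpha>" and c: "0 < c" and C: "0 < C"
    and up: "\<And>r n. r \<ge> 1 \<Longrightarrow> \<Phi> n \<le> exp (- (c * \<kappa> r)) + exp (- (c * real n * real r powr - \<alpha>))"
    and lo: "\<And>R n. R \<ge> R0 \<Longrightarrow> exp (- (C * (\<kappa> R + real n * real R powr - \<alpha>))) \<le> \<Phi> n"
    and s: "filterlim s at_top at_top"
    and large: "\<And>M. M > 0 \<Longrightarrow> \<exists>A>0. \<forall>\<^sub>F t in at_top. M * (t * s t powr - \<alpha>) \<le> \<kappa> (nat \<lceil>A * s t\<rceil>)"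
    and small: "\<And>\<epsilon>. \<epsilon> > 0 \<Longrightarrow> \<exists>a>0. \<forall>\<^sub>F t in at_top. \<kappa> (nat \<lfloor>a * s t\<rfloor>) \<le> \<epsilon> * (t * s t powr - \<alpha>)"
  shows "by_integer_part \<Phi> \<simeq> (\<lambda>t. exp (- (t * s t powr - \<alpha>)))"
proof -
  let ?\<psi> = "\<lambda>t. t * s t powr - \<alpha>"
  obtain A where A: "A > 0" "\<forall>\<^sub>F t in at_top. (1 / c) * ?\<psi> t \<le> \<kappa> (nat \<lceil>A * s t\<rceil>)"
    using large[of "1 / c"] c by auto
  obtain a where a: "a > 0" "\<forall>\<^sub>F t in at_top. \<kappa> (nat \<lfloor>a * s t\<rfloor>) \<le> (1 / (2 * C)) * ?\<psi> t"
    using small[of "1 / (2 * C)"] C by auto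
  \<comment> \<open>the factors \<open>2\<close> compensate for rounding: the radius is at most \<open>2 * A * s t\<close> and the time at least \<open>c2 * t / 2\<close>\<close>
  define c2 where "c2 = 2 * (2 * A) powr \<alpha> / c"
  define c4 where "c4 = (a / 2) powr \<alpha> / (2 * C)"
  have c2: "c2 > 0" and c4: "c4 > 0" using A a c C by (auto simp: c2_def c4_def)
  have s_ev: "\<forall>\<^sub>F t in at_top. b \<le> s t" for b
    using s unfolding filterlim_at_top by blast
  have ev: "\<forall>\<^sub>F t in at_top. 1 / A \<le> s t \<and> 1 \<le> s t \<and> (real R0 + 1) / a \<le> s t \<and> 2 / a \<le> s t \<and> 2 / c2 \<le> t \<and> 0 < t"
    using s_ev[of "1 / A"] s_ev[of 1] s_ev[of "(real R0 + 1) / a"] s_ev[of "2 / a"]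
      eventually_ge_at_top[of "2 / c2"] eventually_gt_at_top[of 0]
    by eventually_elim simp
  have "\<forall>\<^sub>F t in at_top. (1 / 2) * by_integer_part \<Phi> (c2 * t) \<le> exp (- ?\<psi> t) \<and> exp (- ?\<psi> t) \<le> 1 * by_integer_part \<Phi> (c4 * t)"
    using ev A(2) a(2)
  proof eventually_elim
    case (elim t)
    have st: "s t \<ge> 1" "s t > 0" using elim by auto
    have t: "t > 0" using elim by simp
    have "by_integer_part \<Phi> (c2 * t) \<le> 2 * exp (- ?\<psi> t)"
    proof -
      define r where "r = nat \<lceil>A * s t\<rceil>"
      define n where "n = nat \<lfloor>c2 * t\<rfloor>"
      have As: "A * s t \<ge> 1" using elim A(1) by (simp add: field_simps)
      have r: "r \<ge> 1" "real r \<le> 2 * A * s t" using As by (auto simp: r_def; linarith)+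
      have n: "real n \<ge> c2 * t / 2"
      proof -
        have "c2 * t \<ge> 2" using elim c2 by (simp add: field_simps)
        then show ?thesis unfolding n_def by linarith
      qed
      have 1: "?\<psi> t \<le> c * \<kappa> r" using elim c by (simp add: r_def field_simps)
      have "?\<psi> t = c * (c2 * t / 2) * ((2 * A) powr - \<alpha> * s t powr - \<alpha>)"
        using c A by (simp add: c2_def powr_minus)
      also have "\<dots> = c * (c2 * t / 2) * (2 * A * s t) powr - \<alpha>" by (simp add: powr_mult)
      also have "\<dots> \<le> c * real n * real r powr - \<alpha>"
        using c n r \<alpha> c2 t by (intro mult_mono powr_mono2') auto
      finally have 2: "?\<psi> t \<le> c * real n * real r powr - \<alpha>" .
      have "\<Phi> n \<le> exp (- (c * \<kappa> r)) + exp (- (c * real n * real r powr - \<alpha>))" using up r(1) by blast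
      also have "\<dots> \<le> exp (- ?\<psi> t) + exp (- ?\<psi> t)" using 1 2 by (intro add_mono) auto
      finally show ?thesis by (simp add: by_integer_part_def n_def)
    qed
    moreover have "exp (- ?\<psi> t) \<le> by_integer_part \<Phi> (c4 * t)"
    proof -
      define R where "R = nat \<lfloor>a * s t\<rfloor>"
      define n where "n = nat \<lfloor>c4 * t\<rfloor>"
      have as: "a * s t \<ge> real R0 + 1" "a * s t \<ge> 2" using elim a(1) by (auto simp: field_simps)
      have R: "R \<ge> R0" "real R \<ge> a * s t / 2" using as unfolding R_def by linarith+
      have n: "real n \<le> c4 * t" using c4 t by (auto simp: n_def)
      have 1: "C * \<kappa> R \<le> ?\<psi> t / 2"
        using elim(3) C mult_left_mono[of "\<kappa> R" "(1 / (2 * C)) * ?\<psi> t" C] by (simp add: R_def)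
      have "C * (real n * real R powr - \<alpha>) \<le> C * (c4 * t * (a * s t / 2) powr - \<alpha>)"
        using C n R \<alpha> c4 t a st by (intro mult_left_mono mult_mono powr_mono2') auto
      also have "(a * s t / 2) powr - \<alpha> = (a / 2) powr - \<alpha> * s t powr - \<alpha>"
        by (simp add: powr_mult[symmetric])
      also have "C * (c4 * t * ((a / 2) powr - \<alpha> * s t powr - \<alpha>)) = ?\<psi> t / 2"
        using C a(1) by (simp add: c4_def powr_minus field_simps)
      finally have "C * (\<kappa> R + real n * real R powr - \<alpha>) \<le> ?\<psi> t" using 1 by (simp add: distrib_left)
      then have "exp (- ?\<psi> t) \<le> exp (- (C * (\<kappa> R + real n * real R powr - \<alpha>)))" by simp
      also have "\<dots> \<le> \<Phi> n" using lo R(1) by blast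
      finally show ?thesis by (simp add: by_integer_part_def n_def)
    qed
    ultimately show ?case by simp
  qed
  then show ?thesis
    unfolding growth_equiv_def using c2 c4
    by (intro exI[of _ "1 / 2"] exI[of _ c2] exI[of _ 1] exI[of _ c4] conjI) auto
qed

lemma growth_equiv_power:
  fixes \<alpha> c C :: real and e :: nat
  assumes \<alpha>: "0 < \<alpha>" and c: "0 < c" and C: "0 < C" and e: "e \<ge> 1"
    and up: "\<And>r n. r \<ge> 1 \<Longrightarrow> \<Phi> n \<le> exp (- (c * real r ^ e)) + exp (- (c * real n * real r powr - \<alpha>))"
    and lo: "\<And>R n. R \<ge> R0 \<Longrightarrow> exp (- (C * (real R ^ e + real n * real R powr - \<alpha>))) \<le> \<Phi> n"
  shows "by_integer_part \<Phi> \<simeq> (\<lambda>t. exp (- (t powr (real e / (\<alpha> + real e)))))"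
proof -
  define b where "b = 1 / (\<alpha> + real e)"
  have b: "b > 0" using \<alpha> e by (simp add: b_def)
  let ?s = "\<lambda>t :: real. t powr b"
  have lim: "filterlim ?s at_top at_top" using b by (rule real_powr_at_top)
  have \<psi>: "t * ?s t powr - \<alpha> = t powr (real e / (\<alpha> + real e))" "?s t ^ e = t powr (real e / (\<alpha> + real e))"
    if "t > 0" for t
  proof -
    have "1 + b * - \<alpha> = real e / (\<alpha> + real e)" using \<alpha> e by (simp add: b_def field_simps)
    then show "t * ?s t powr - \<alpha> = t powr (real e / (\<alpha> + real e))"
      using that powr_add[of t 1 "b * - \<alpha>"] by (simp add: powr_powr)
    show "?s t ^ e = t powr (real e / (\<alpha> + real e))"
      using that by (simp add: powr_realpow[symmetric] powr_powr b_def)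
  qed
  have "by_integer_part \<Phi> \<simeq> (\<lambda>t. exp (- (t * ?s t powr - \<alpha>)))"
  proof (rule growth_equiv_optimize[OF \<alpha> c C up lo lim])
    fix M :: real assume M: "M > 0"
    have "M * (t * ?s t powr - \<alpha>) \<le> real (nat \<lceil>max 1 M * ?s t\<rceil>) ^ e" if t: "t > 0" for t
    proof -
      have "M \<le> max 1 M ^ e" using e self_le_power[of "max 1 M" e] by simp
      then have "M * ?s t ^ e \<le> max 1 M ^ e * ?s t ^ e" by (intro mult_right_mono) auto
      also have "\<dots> = (max 1 M * ?s t) ^ e" by (simp add: power_mult_distrib)
      also have "\<dots> \<le> real (nat \<lceil>max 1 M * ?s t\<rceil>) ^ e" by (intro power_mono real_nat_ceiling_ge) auto
      finally show ?thesis using \<psi>[OF t] by simp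
    qed
    then have "\<forall>\<^sub>F t in at_top. M * (t * ?s t powr - \<alpha>) \<le> real (nat \<lceil>max 1 M * ?s t\<rceil>) ^ e"
      using eventually_gt_at_top[of 0] by (rule eventually_mono[rotated])
    then show "\<exists>A>0. \<forall>\<^sub>F t in at_top. M * (t * ?s t powr - \<alpha>) \<le> real (nat \<lceil>A * ?s t\<rceil>) ^ e"
      by (intro exI[of _ "max 1 M"]) auto
  next
    fix \<epsilon> :: real assume \<epsilon>: "\<epsilon> > 0"
    have "real (nat \<lfloor>min 1 \<epsilon> * ?s t\<rfloor>) ^ e \<le> \<epsilon> * (t * ?s t powr - \<alpha>)" if t: "t > 0" for t
    proof -
      have "real (nat \<lfloor>min 1 \<epsilon> * ?s t\<rfloor>) ^ e \<le> (min 1 \<epsilon> * ?s t) ^ e"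
        using \<epsilon> by (intro power_mono) auto
      also have "\<dots> = min 1 \<epsilon> ^ e * ?s t ^ e" by (simp add: power_mult_distrib)
      also have "min 1 \<epsilon> ^ e \<le> \<epsilon>"
        using \<epsilon> e power_decreasing[of 1 e "min 1 \<epsilon>"] by simp
      then have "min 1 \<epsilon> ^ e * ?s t ^ e \<le> \<epsilon> * ?s t ^ e" by (intro mult_right_mono) auto
      finally show ?thesis using \<psi>[OF t] by simp
    qed
    then have "\<forall>\<^sub>F t in at_top. real (nat \<lfloor>min 1 \<epsilon> * ?s t\<rfloor>) ^ e \<le> \<epsilon> * (t * ?s t powr - \<alpha>)"
      using eventually_gt_at_top[of 0] by (rule eventually_mono[rotated])
    then show "\<exists>a>0. \<forall>\<^sub>F t in at_top. real (nat \<lfloor>a * ?s t\<rfloor>) ^ e \<le> \<epsilon> * (t * ?s t powr - \<alpha>)"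
      using \<epsilon> by (intro exI[of _ "min 1 \<epsilon>"]) auto
  qed
  moreover have "\<forall>\<^sub>F t in at_top. exp (- (t * ?s t powr - \<alpha>)) = exp (- (t powr (real e / (\<alpha> + real e))))"
    using eventually_gt_at_top[of 0] by eventually_elim (simp add: \<psi>)
  ultimately show ?thesis by (rule growth_equiv_cong)
qed

text \<open>
  The balance is \<open>s ^ e * ln t = t * s powr - \<alpha>\<close>, and \<open>ln s\<close> is comparable with \<open>ln t\<close>.
\<close>

lemma growth_equiv_power_log:
  fixes \<alpha> c C :: real and e :: nat
  assumes \<alpha>: "0 < \<alpha>" and c: "0 < c" and C: "0 < C" and e: "e \<ge> 1"
    and up: "\<And>r n. r \<ge> 1 \<Longrightarrow> \<Phi> n \<le> exp (- (c * (real r ^ e * ln (1 + real r)))) + exp (- (c * real n * real r powr - \<alpha>))"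
    and lo: "\<And>R n. R \<ge> R0 \<Longrightarrow> exp (- (C * (real R ^ e * ln (1 + real R) + real n * real R powr - \<alpha>))) \<le> \<Phi> n"
  shows "by_integer_part \<Phi> \<simeq>
    (\<lambda>t. exp (- (t powr (real e / (\<alpha> + real e)) * ln t powr (\<alpha> / (\<alpha> + real e)))))"
proof -
  define b where "b = 1 / (\<alpha> + real e)"
  have b: "b > 0" "b < 1" using \<alpha> e by (auto simp: b_def)
  let ?s = "\<lambda>t :: real. (t / ln t) powr b"
  have lim: "filterlim ?s at_top at_top" using b by real_asymp
  have ev1: "\<forall>\<^sub>F t :: real in at_top. t > 1" by (rule eventually_gt_at_top)
  \<comment> \<open>exactly \<open>ln (?s t) = b * (ln t - ln (ln t))\<close>; half of the main term absorbs the iterated logarithm\<close>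
  have ev2: "\<forall>\<^sub>F t in at_top. b / 2 * ln t \<le> ln (?s t)" using b by real_asymp
  have ev3: "\<forall>\<^sub>F t in at_top. 1 + ?s t \<le> t" using b by real_asymp
  let ?\<psi> = "\<lambda>t. t powr (real e / (\<alpha> + real e)) * ln t powr (\<alpha> / (\<alpha> + real e))"
  have be: "b * real e = real e / (\<alpha> + real e)" "b * \<alpha> = \<alpha> / (\<alpha> + real e)" by (simp_all add: b_def)
  have sum1: "\<alpha> / (\<alpha> + real e) + real e / (\<alpha> + real e) = 1"
    using \<alpha> e by (simp add: add_divide_distrib[symmetric])
  have \<psi>: "t * ?s t powr - \<alpha> = ?\<psi> t" "?s t ^ e * ln t = ?\<psi> t" if t: "t > 1" for t
  proof -
    have l: "ln t > 0" using t by simp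
    have "?s t powr - \<alpha> = t powr - (\<alpha> / (\<alpha> + real e)) * ln t powr (\<alpha> / (\<alpha> + real e))"
      using t l be by (simp add: powr_powr powr_divide powr_minus field_simps)
    moreover have "t * t powr - (\<alpha> / (\<alpha> + real e)) = t powr (real e / (\<alpha> + real e))"
    proof -
      have "1 + - (\<alpha> / (\<alpha> + real e)) = real e / (\<alpha> + real e)" using sum1 by simp
      then show ?thesis using t powr_add[of t 1 "- (\<alpha> / (\<alpha> + real e))"] by simp
    qed
    ultimately show "t * ?s t powr - \<alpha> = ?\<psi> t" by (simp add: mult.assoc[symmetric])
    have "?s t ^ e = t powr (real e / (\<alpha> + real e)) * ln t powr - (real e / (\<alpha> + real e))"
      using t l be by (simp add: powr_realpow[symmetric] powr_powr powr_divide powr_minus field_simps)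
    moreover have "ln t powr - (real e / (\<alpha> + real e)) * ln t = ln t powr (\<alpha> / (\<alpha> + real e))"
    proof -
      have "- (real e / (\<alpha> + real e)) + 1 = \<alpha> / (\<alpha> + real e)" using sum1 by simp
      then show ?thesis using l powr_add[of "ln t" "- (real e / (\<alpha> + real e))" 1] by simp
    qed
    ultimately show "?s t ^ e * ln t = ?\<psi> t" by (simp add: mult.assoc)
  qed
  have "by_integer_part \<Phi> \<simeq> (\<lambda>t. exp (- (t * ?s t powr - \<alpha>)))"
  proof (rule growth_equiv_optimize[OF \<alpha> c C up lo lim])
    fix M :: real assume M: "M > 0"
    define A where "A = max 1 (2 * M / b)"
    have A: "A \<ge> 1" "A * (b / 2) \<ge> M"
      using b mult_right_mono[of "2 * M / b" A "b / 2"] by (auto simp: A_def)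
    have "\<forall>\<^sub>F t in at_top. M * (t * ?s t powr - \<alpha>) \<le> real (nat \<lceil>A * ?s t\<rceil>) ^ e * ln (1 + real (nat \<lceil>A * ?s t\<rceil>))"
      using ev1 ev2
    proof eventually_elim
      case (elim t)
      define N where "N = nat \<lceil>A * ?s t\<rceil>"
      let ?r = "real N"
      have l: "ln t > 0" using elim by simp
      then have st: "?s t > 0" using elim by simp
      have r: "A * ?s t \<le> ?r" unfolding N_def by (rule real_nat_ceiling_ge)
      have sr: "?s t \<le> ?r" using r A(1) st mult_right_mono[of 1 A "?s t"] by linarith
      have "M * (t * ?s t powr - \<alpha>) = M * (?s t ^ e * ln t)" using \<psi> elim by simp
      also have "\<dots> \<le> (A * (b / 2)) * (?s t ^ e * ln t)"
        using A(2) st l by (intro mult_right_mono) auto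
      also have "\<dots> \<le> (A ^ e * (b / 2)) * (?s t ^ e * ln t)"
        using A(1) e self_le_power[of A e] b st l by (intro mult_right_mono) auto
      also have "\<dots> = (A * ?s t) ^ e * (b / 2 * ln t)" by (simp add: power_mult_distrib mult_ac)
      also have "\<dots> \<le> ?r ^ e * ln (1 + ?r)"
      proof (intro mult_mono power_mono r)
        have "ln (?s t) \<le> ln (1 + ?r)" using sr st by (intro ln_mono) auto
        then show "b / 2 * ln t \<le> ln (1 + ?r)" using elim(2) by linarith
      qed (use A st l b in auto)
      finally show ?case by (simp add: N_def)
    qed
    then show "\<exists>A>0. \<forall>\<^sub>F t in at_top. M * (t * ?s t powr - \<alpha>)
        \<le> real (nat \<lceil>A * ?s t\<rceil>) ^ e * ln (1 + real (nat \<lceil>A * ?s t\<rceil>))"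
      using A by (intro exI[of _ A]) auto
  next
    fix \<epsilon> :: real assume \<epsilon>: "\<epsilon> > 0"
    define a where "a = min 1 \<epsilon>"
    have a: "0 < a" "a \<le> 1" "a ^ e \<le> \<epsilon>"
      using \<epsilon> e power_decreasing[of 1 e "min 1 \<epsilon>"] by (auto simp: a_def)
    have "\<forall>\<^sub>F t in at_top. real (nat \<lfloor>a * ?s t\<rfloor>) ^ e * ln (1 + real (nat \<lfloor>a * ?s t\<rfloor>)) \<le> \<epsilon> * (t * ?s t powr - \<alpha>)"
      using ev1 ev3
    proof eventually_elim
      case (elim t)
      define N where "N = nat \<lfloor>a * ?s t\<rfloor>"
      let ?r = "real N"
      have l: "ln t > 0" using elim by simp
      then have st: "?s t > 0" using elim by simp
      have r: "?r \<le> a * ?s t" unfolding N_def using a st by auto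
      have "?r \<le> ?s t" using r a st mult_right_mono[of a 1 "?s t"] by linarith
      then have "1 + ?r \<le> t" using elim(2) by linarith
      then have ln_le: "ln (1 + ?r) \<le> ln t" by (intro ln_mono) auto
      have "?r ^ e * ln (1 + ?r) \<le> (a * ?s t) ^ e * ln t"
        using r ln_le a st by (intro mult_mono power_mono) auto
      also have "\<dots> = a ^ e * (?s t ^ e * ln t)" by (simp add: power_mult_distrib)
      also have "\<dots> \<le> \<epsilon> * (?s t ^ e * ln t)" using a st l by (intro mult_right_mono) auto
      finally show ?case using \<psi>[OF elim(1)] by (simp add: N_def)
    qed
    then show "\<exists>a>0. \<forall>\<^sub>F t in at_top. real (nat \<lfloor>a * ?s t\<rfloor>) ^ e * ln (1 + real (nat \<lfloor>a * ?s t\<rfloor>))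
        \<le> \<epsilon> * (t * ?s t powr - \<alpha>)"
      using a by (intro exI[of _ a]) auto
  qed
  moreover have "\<forall>\<^sub>F t in at_top. exp (- (t * ?s t powr - \<alpha>)) = exp (- ?\<psi> t)"
    using ev1 by eventually_elim (simp add: \<psi>)
  ultimately show ?thesis by (rule growth_equiv_cong)
qed

text \<open>
  The lower bound on the volume is available for large radii only; for the others, a nontrivial group has
  at least two elements in each ball of positive radius.
\<close>

lemma (in fg_group) exponential_growth_bounds:
  assumes "exponential_growth G S"
  shows "carrier G \<noteq> {\<one>} \<and> (\<exists>c>0. \<forall>r\<ge>1. c * real r \<le> ln (volume G S r))"
proof
  obtain a b N where ab: "a > 0" "b > 0" and lower: "\<And>n. n \<ge> N \<Longrightarrow> b * exp (a * real n) \<le> volume G S n"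
    using growth_equiv_at_nat[OF assms[unfolded exponential_growth_def]] by blast
  \<comment> \<open>from here on the linear term dominates the constant \<open>ln b\<close> and half of it remains\<close>
  define N' where "N' = max (max 1 N) (nat \<lceil>2 * \<bar>ln b\<bar> / a\<rceil> + 1)"
  have N': "N' \<ge> 1" by (simp add: N'_def)
  have ln_lower: "a / 2 * real n \<le> ln (volume G S n)" "volume G S n > 1" if n: "n \<ge> N'" for n
  proof -
    have "n \<ge> N" "real n > 2 * \<bar>ln b\<bar> / a" using n unfolding N'_def by linarith+
    then have 1: "\<bar>ln b\<bar> < a / 2 * real n" using ab by (simp add: field_simps)
    have "exp (ln b + a * real n) \<le> volume G S n" using lower[OF \<open>n \<ge> N\<close>] ab by (simp add: exp_add)
    then have "ln b + a * real n \<le> ln (volume G S n)" using volume_ge_1[of n] by (simp add: ln_ge_iff)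
    then show "a / 2 * real n \<le> ln (volume G S n)" using 1 by linarith
    then have "0 < ln (volume G S n)" using 1 by linarith
    then show "volume G S n > 1" using volume_ge_1[of n] by (simp add: ln_gt_zero_iff)
  qed
  show nontriv: "carrier G \<noteq> {\<one>}"
  proof
    assume "carrier G = {\<one>}"
    then have "wball N' = {\<one>}" using wball_carrier[of N'] one_in_wball[of N'] by blast
    then show False using ln_lower(2)[of N'] by (simp add: volume_eq)
  qed
  define c where "c = min (a / 2) (ln 2 / real N')"
  have c_le: "c \<le> a / 2" "c \<le> ln 2 / real N'" unfolding c_def by (rule min.cobounded1, rule min.cobounded2)
  have "c > 0" using ab N' by (simp add: c_def)
  moreover have "c * real r \<le> ln (volume G S r)" if r: "r \<ge> 1" for r
  proof (cases "r \<ge> N'")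
    case True
    have "c * real r \<le> a / 2 * real r" using c_le(1) by (rule mult_right_mono) simp
    then show ?thesis using ln_lower(1)[OF True] by linarith
  next
    case False
    have "c * real r \<le> ln 2 / real N' * real N'" using False c_le(2) by (intro mult_mono) auto
    also have "\<dots> = ln 2" using N' by simp
    also have "\<dots> \<le> ln (volume G S r)"
      using card_wball_ge_2[OF nontriv r] by (intro ln_mono) (auto simp: volume_eq)
    finally show ?thesis .
  qed
  ultimately show "\<exists>c>0. \<forall>r\<ge>1. c * real r \<le> ln (volume G S r)" by blast
qed

context wreath begin

text \<open>
  The summand one in \<open>1 + w R\<close>, which accounts for the position in \<open>H\<close>, is absorbed because \<open>w\<close> is bounded below.
\<close>

lemma Phi_tilde_two_sided:
  assumes \<alpha>: "0 < \<alpha>" "\<alpha> < 2" and poly: "polynomial_growth H SH d" and K: "carrier K \<noteq> {\<one>\<^bsub>K\<^esub>}"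
    and prof: "\<exists>A. K.test_profile w A" and w: "\<And>r. 0 \<le> w r" "\<And>r. r \<ge> 1 \<Longrightarrow> w0 \<le> w r" "0 < w0"
    and vol: "\<exists>c>0. \<forall>r\<ge>1. c * w r \<le> ln (volume K SK r)"
  shows "\<exists>c>0. \<exists>C>0. \<exists>R0\<ge>1.
    (\<forall>r\<ge>1. \<forall>n. Phi_tilde (K \<wr> H) SG \<rho>\<^bsub>\<alpha>\<^esub> n
      \<le> exp (- (c * (real r ^ d * w r))) + exp (- (c * real n * real r powr - \<alpha>)))
    \<and> (\<forall>R\<ge>R0. \<forall>n. exp (- (C * (real R ^ d * w R + real n * real R powr - \<alpha>))) \<le> Phi_tilde (K \<wr> H) SG \<rho>\<^bsub>\<alpha>\<^esub> n)"
proof -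
  let ?\<Phi> = "Phi_tilde (K \<wr> H) SG \<rho>\<^bsub>\<alpha>\<^esub>"
  obtain A where A: "K.test_profile w A" using prof by blast
  obtain A' where A': "G.test_profile (\<lambda>R. real R ^ d * (1 + w R)) A'"
    using wreath_test_profile[OF poly A w(1)] by blast
  have "0 \<le> real r ^ d * (1 + w r)" for r using w(1)[of r] by simp
  from G.Phi_tilde_lower_profile[OF \<alpha> A' this]
  obtain C1 R0 where C1: "C1 > 0" "R0 \<ge> 1"
    and lower: "\<And>R n. R \<ge> R0 \<Longrightarrow> exp (- (C1 * (real R ^ d * (1 + w R) + real n * real R powr - \<alpha>))) \<le> ?\<Phi> n"
    by blast
  obtain c1 where c1: "c1 > 0" and upper: "\<And>r n. r \<ge> 1 \<Longrightarrow> ?\<Phi> n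
    \<le> exp (- (volume H SH r * ln (volume K SK r) / 4)) + exp (- (c1 * real n * real r powr - \<alpha>))"
    using Phi_tilde_upper[OF \<alpha>(1) K] by blast
  obtain c2 where c2: "c2 > 0" "\<And>r. r \<ge> 1 \<Longrightarrow> c2 * w r \<le> ln (volume K SK r)" using vol by blast
  obtain c3 where c3: "c3 > 0" "\<And>r. r \<ge> 1 \<Longrightarrow> c3 * real r ^ d \<le> volume H SH r"
    using H.polynomial_growth_bounds[OF poly] by blast
  define c where "c = min c1 (c3 * c2 / 4)"
  define C where "C = C1 * (1 + 1 / w0)"
  have c: "c > 0" using c1 c2 c3 by (simp add: c_def)
  have C: "C > 0" using C1 w(3) by (simp add: C_def add_pos_pos)
  have "?\<Phi> n \<le> exp (- (c * (real r ^ d * w r))) + exp (- (c * real n * real r powr - \<alpha>))" if r: "r \<ge> 1" for r n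
  proof -
    have "c * (real r ^ d * w r) \<le> c3 * c2 / 4 * (real r ^ d * w r)"
      using w(1)[of r] by (intro mult_right_mono) (auto simp: c_def)
    also have "\<dots> = (c3 * real r ^ d) * (c2 * w r) / 4" by simp
    also have "\<dots> \<le> volume H SH r * ln (volume K SK r) / 4"
      using c2(1) c2(2)[OF r] c3(1) c3(2)[OF r] w(1)[of r] order_trans[OF zero_le_one H.volume_ge_1[of r]] by (intro divide_right_mono mult_mono) auto
    finally have "exp (- (volume H SH r * ln (volume K SK r) / 4)) \<le> exp (- (c * (real r ^ d * w r)))" by simp
    moreover have "c * (real n * real r powr - \<alpha>) \<le> c1 * (real n * real r powr - \<alpha>)"
      by (intro mult_right_mono) (auto simp: c_def)
    then have "exp (- (c1 * real n * real r powr - \<alpha>)) \<le> exp (- (c * real n * real r powr - \<alpha>))" by (simp add: mult.assoc)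
    ultimately show ?thesis using upper[OF r, of n] by linarith
  qed
  moreover have "exp (- (C * (real R ^ d * w R + real n * real R powr - \<alpha>))) \<le> ?\<Phi> n" if R: "R \<ge> R0" for R n
  proof -
    have wR: "w R \<ge> w0" using w(2) R C1(2) by simp
    have "1 + w R \<le> (1 + 1 / w0) * w R" using wR w(3) by (simp add: field_simps)
    then have "real R ^ d * (1 + w R) \<le> (1 + 1 / w0) * (real R ^ d * w R)"
      using mult_left_mono[of "1 + w R" "(1 + 1 / w0) * w R" "real R ^ d"] by (simp add: mult_ac)
    moreover have "1 * (real n * real R powr - \<alpha>) \<le> (1 + 1 / w0) * (real n * real R powr - \<alpha>)"
      using w(3) by (intro mult_right_mono) auto
    ultimately have "real R ^ d * (1 + w R) + real n * real R powr - \<alpha>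
        \<le> (1 + 1 / w0) * (real R ^ d * w R + real n * real R powr - \<alpha>)"
      by (simp add: distrib_left)
    then have "C1 * (real R ^ d * (1 + w R) + real n * real R powr - \<alpha>)
        \<le> C * (real R ^ d * w R + real n * real R powr - \<alpha>)"
      using C1(1) by (simp add: C_def mult.assoc)
    then have "exp (- (C * (real R ^ d * w R + real n * real R powr - \<alpha>)))
        \<le> exp (- (C1 * (real R ^ d * (1 + w R) + real n * real R powr - \<alpha>)))" by simp
    then show ?thesis using lower[OF R, of n] by linarith
  qed
  ultimately show ?thesis using c C C1(2) by blast
qed

text \<open>
  For a finite base there is no rate to optimise: for each fixed \<open>n\<close> the radius in the lower bound can be taken so
  large that the cost of the steps is below one.
\<close>

lemma growth_equiv_constant:
  assumes \<alpha>: "0 < \<alpha>" and C: "0 < C"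
    and lo: "\<And>R n. R \<ge> R0 \<Longrightarrow> exp (- (C * (1 + real n * real R powr - \<alpha>))) \<le> \<Phi> n" and le1: "\<And>n. \<Phi> n \<le> 1"
  shows "by_integer_part \<Phi> \<simeq> (\<lambda>t. exp (- (t powr 0)))"
proof -
  have lower: "exp (- (2 * C)) \<le> \<Phi> n" for n
  proof -
    have "((\<lambda>R. real n * real R powr - \<alpha>) \<longlongrightarrow> real n * 0) sequentially"
      using \<alpha> by (intro tendsto_mult tendsto_const tendsto_neg_powr filterlim_real_sequentially) auto
    then have "\<forall>\<^sub>F R in sequentially. real n * real R powr - \<alpha> < 1" by (rule order_tendstoD) simp
    then obtain R1 where "\<And>R. R \<ge> R1 \<Longrightarrow> real n * real R powr - \<alpha> < 1" unfolding eventually_sequentially by blast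
    then have "real n * real (max R0 R1) powr - \<alpha> < 1" by simp
    then have "C * (1 + real n * real (max R0 R1) powr - \<alpha>) \<le> C * 2" using C by (intro mult_left_mono) auto
    then have "exp (- (2 * C)) \<le> exp (- (C * (1 + real n * real (max R0 R1) powr - \<alpha>)))" by simp
    then show ?thesis using lo[OF max.cobounded1] by (rule order_trans)
  qed
  have "\<forall>\<^sub>F t in at_top. exp (- 1) * by_integer_part \<Phi> (1 * t) \<le> exp (- (t powr 0)) \<and>
      exp (- (t powr 0)) \<le> exp (2 * C) * by_integer_part \<Phi> (1 * t)"
    using eventually_gt_at_top[of 0]
  proof eventually_elim
    case (elim t)
    have "exp (2 * C) * exp (- (2 * C)) \<le> exp (2 * C) * \<Phi> (nat \<lfloor>t\<rfloor>)" using lower by (intro mult_left_mono) auto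
    then have "1 \<le> exp (2 * C) * \<Phi> (nat \<lfloor>t\<rfloor>)" by (simp flip: exp_add)
    moreover have "exp (- 1) \<le> (1 :: real)" by simp
    ultimately have "exp (- 1) \<le> exp (2 * C) * \<Phi> (nat \<lfloor>t\<rfloor>)" by linarith
    then show ?case using elim le1[of "nat \<lfloor>t\<rfloor>"] by (simp add: by_integer_part_def)
  qed
  then show ?thesis
    unfolding growth_equiv_def
    by (intro exI[of _ "exp (- 1)"] exI[of _ 1] exI[of _ "exp (2 * C)"] conjI) auto
qed

lemma Phi_tilde_le_1: "Phi_tilde (K \<wr> H) SG \<rho>\<^bsub>\<alpha>\<^esub> n \<le> 1"
proof -
  have sym: "symmetric_probability (K \<wr> H) (return_pmf \<e>)"
    by (simp add: G.symmetric_probability_iff)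
  have "Phi_tilde (K \<wr> H) SG \<rho>\<^bsub>\<alpha>\<^esub> n \<le> pmf (conv_power (K \<wr> H) (return_pmf \<e>) (2 * n)) \<e>"
    by (rule G.Phi_tilde_le[OF sym G.weak_moment_return_one])
  also have "\<dots> \<le> 1" by (rule pmf_le_1)
  finally show ?thesis .
qed

end

section \<open>The three regimes\<close>

theorem theorem5p2:
  fixes \<alpha> :: real and d :: nat
    and H :: "('h, 'a) monoid_scheme" and K :: "('k, 'b) monoid_scheme"
    and SH :: "'h set" and SK :: "'k set" and SG :: "(('h \<Rightarrow> 'k) \<times> 'h) set"
  assumes "0 < \<alpha>" and "\<alpha> < 2"
    and "group H" and "symmetric_generating_set H SH"
    and "group K" and "symmetric_generating_set K SK"
    and "symmetric_generating_set (K \<wr> H) SG"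
    and "polynomial_growth H SH d"
  shows "(finite (carrier K) \<and> carrier K \<noteq> {\<one>\<^bsub>K\<^esub>} \<longrightarrow>
            by_integer_part (Phi_tilde (K \<wr> H) SG \<rho>\<^bsub>\<alpha>\<^esub>)
              \<simeq> (\<lambda>t. exp (- (t powr (d / (\<alpha> + d))))))
       \<and> (infinite (carrier K) \<and> (\<exists>D. polynomial_growth K SK D) \<and> 0 < d \<longrightarrow>
            by_integer_part (Phi_tilde (K \<wr> H) SG \<rho>\<^bsub>\<alpha>\<^esub>)
              \<simeq> (\<lambda>t. exp (- (t powr (d / (\<alpha> + d)) * ln t powr (\<alpha> / (\<alpha> + d))))))
       \<and> (exponential_growth K SK \<and>
          by_integer_part (Phi K SK) \<simeq> (\<lambda>t. exp (- (t powr (1 / 3)))) \<longrightarrow>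
            by_integer_part (Phi_tilde (K \<wr> H) SG \<rho>\<^bsub>\<alpha>\<^esub>)
              \<simeq> (\<lambda>t. exp (- (t powr ((d + 1) / (\<alpha> + d + 1))))))"
proof -
  interpret wreath H SH K SK SG
    using assms(3-7) group_wreath_product[OF assms(5,3)]
    by (intro wreath.intro fg_group.intro fg_group_axioms.intro)
  let ?\<Phi> = "Phi_tilde (K \<wr> H) SG \<rho>\<^bsub>\<alpha>\<^esub>"
  note two_sided = Phi_tilde_two_sided[OF assms(1,2,8)]
  show ?thesis
  proof (intro conjI impI; elim conjE)
    assume fin: "finite (carrier K)" and nt: "carrier K \<noteq> {\<one>\<^bsub>K\<^esub>}"
    have "ln 2 * 1 \<le> ln (volume K SK r)" if "r \<ge> 1" for r
      using K.card_wball_ge_2[OF nt that] by (simp add: K.volume_eq)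
    then have vol: "\<exists>c>0. \<forall>r\<ge>1. c * 1 \<le> ln (volume K SK r)" by (intro exI[of _ "ln 2"]) auto
    obtain c C R0 where cC: "c > 0" "C > 0"
      and "\<forall>r\<ge>1. \<forall>n. ?\<Phi> n \<le> exp (- (c * (real r ^ d * 1))) + exp (- (c * real n * real r powr - \<alpha>))"
      and "\<forall>R\<ge>R0. \<forall>n. exp (- (C * (real R ^ d * 1 + real n * real R powr - \<alpha>))) \<le> ?\<Phi> n"
      using two_sided[OF nt K.test_profile_finite[OF fin] _ _ _ vol, of 1] by auto
    then have up: "\<And>r n. r \<ge> 1 \<Longrightarrow> ?\<Phi> n \<le> exp (- (c * real r ^ d)) + exp (- (c * real n * real r powr - \<alpha>))"
      and lo: "\<And>R n. R \<ge> R0 \<Longrightarrow> exp (- (C * (real R ^ d + real n * real R powr - \<alpha>))) \<le> ?\<Phi> n"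
      by (simp_all add: mult.commute)
    show "by_integer_part ?\<Phi> \<simeq> (\<lambda>t. exp (- (t powr (d / (\<alpha> + d)))))"
    proof (cases "d = 0")
      case True
      then show ?thesis using growth_equiv_constant[OF assms(1) cC(2), of R0 ?\<Phi>] lo Phi_tilde_le_1 by simp
    next
      case False
      then show ?thesis using growth_equiv_power[OF assms(1) cC _ up lo] by simp
    qed
  next
    assume inf: "infinite (carrier K)" and polyK: "\<exists>D. polynomial_growth K SK D" and d: "0 < d"
    have nt: "carrier K \<noteq> {\<one>\<^bsub>K\<^esub>}" using inf by auto
    have "1 * ln (1 + real r) \<le> ln (volume K SK r)" for r
      using K.card_wball_infinite[OF inf, of r] by (simp add: K.volume_eq)
    then have vol: "\<exists>c>0. \<forall>r\<ge>1. c * ln (1 + real r) \<le> ln (volume K SK r)" by (intro exI[of _ 1]) auto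
    have prof: "\<exists>A. K.test_profile (\<lambda>r. ln (1 + real r)) A" using polyK K.test_profile_polynomial_growth by blast
    obtain c C R0 where cC: "c > 0" "C > 0"
      and "\<forall>r\<ge>1. \<forall>n. ?\<Phi> n \<le> exp (- (c * (real r ^ d * ln (1 + real r)))) + exp (- (c * real n * real r powr - \<alpha>))"
      and "\<forall>R\<ge>R0. \<forall>n. exp (- (C * (real R ^ d * ln (1 + real R) + real n * real R powr - \<alpha>))) \<le> ?\<Phi> n"
      using two_sided[OF nt prof _ _ _ vol, of "ln 2"] by auto
    then have up: "\<And>r n. r \<ge> 1 \<Longrightarrow> ?\<Phi> n \<le> exp (- (c * (real r ^ d * ln (1 + real r)))) + exp (- (c * real n * real r powr - \<alpha>))"
      and lo: "\<And>R n. R \<ge> R0 \<Longrightarrow> exp (- (C * ((real R ^ d * ln (1 + real R)) + real n * real R powr - \<alpha>))) \<le> ?\<Phi> n"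
      by simp_all
    show "by_integer_part ?\<Phi> \<simeq> (\<lambda>t. exp (- (t powr (d / (\<alpha> + d)) * ln t powr (\<alpha> / (\<alpha> + d)))))"
      using growth_equiv_power_log[OF assms(1) cC _ up lo] d by simp
  next
    assume ex: "exponential_growth K SK" and ret: "by_integer_part (Phi K SK) \<simeq> (\<lambda>t. exp (- (t powr (1 / 3))))"
    have nt: "carrier K \<noteq> {\<one>\<^bsub>K\<^esub>}" and vol: "\<exists>c>0. \<forall>r\<ge>1. c * real r \<le> ln (volume K SK r)"
      using K.exponential_growth_bounds[OF ex] by auto
    obtain c C R0 where cC: "c > 0" "C > 0"
      and "\<forall>r\<ge>1. \<forall>n. ?\<Phi> n \<le> exp (- (c * (real r ^ d * real r))) + exp (- (c * real n * real r powr - \<alpha>))"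
      and "\<forall>R\<ge>R0. \<forall>n. exp (- (C * (real R ^ d * real R + real n * real R powr - \<alpha>))) \<le> ?\<Phi> n"
      using two_sided[OF nt K.test_profile_return_probability[OF ret] _ _ _ vol, of 1] by auto
    then have up: "\<And>r n. r \<ge> 1 \<Longrightarrow> ?\<Phi> n \<le> exp (- (c * real r ^ (d + 1))) + exp (- (c * real n * real r powr - \<alpha>))"
      and lo: "\<And>R n. R \<ge> R0 \<Longrightarrow> exp (- (C * (real R ^ (d + 1) + real n * real R powr - \<alpha>))) \<le> ?\<Phi> n"
      by (simp_all add: mult.commute)
    show "by_integer_part ?\<Phi> \<simeq> (\<lambda>t. exp (- (t powr ((d + 1) / (\<alpha> + d + 1)))))"
      using growth_equiv_power[OF assms(1) cC _ up lo, of R0] by (simp add: add_ac)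
  qed
qed

end
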